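(* Let $W$ be a Weyl group with root system $\Phi$, set of reflections $T$, and longest element $w_{\mathrm{o}}$, let $N=\ell(w_{\mathrm{o}})$, and fix a reflection ordering $\varphi:T\to\{1,\dots,N\}$. Let $D(W)$ be the associated edge-labelled digraph on $W$. 1. For any pair of elements $u,v\in W$, there is a unique path from $u$ to $v$ in the directed graph $D(W)$ such that its sequence of labels is strictly increasing (resp. strictly decreasing). 2. The unique label-increasing (resp. label-decreasing) path from $u$ to $v$ has the smallest possible length $\ell(u,v)$. Moreover, it is lexicographically minimal (resp. lexicographically maximal) among all shortest paths from $u$ to $v$. 3. For any $u\in W$, $$R_{\varphi^{-1}(1)}\cdots R_{\varphi^{-1}(N)}(u)=\sum_{v\in W}\varepsilon^{\ell(u,v)}\,v,$$ where $R_\tau=1+\varepsilon Q_\tau$.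
   Context: $W$ is a Weyl group with a fixed (reduced crystallographic) root system $\Phi$ and positive roots $\Phi^+$; $S$ is the set of simple reflections, $\ell$ the length function, $T$ the set of reflections (conjugates of simple reflections), each $\tau\in T$ corresponding to a positive root $\alpha$. ${\rm ht}(\alpha)$ is the height of $\alpha$, the sum of its coefficients in the basis of simple roots. $k$ is a field of characteristic $0$, $k[W]$ is the $k$-vector space with basis $W$, and $\varepsilon$ is a formal variable, so that $R_\tau$ acts on $k[\varepsilon]\otimes k[W]$; products of operators are compositions. The linear operators $Q_\tau$, $\tau\in T$ (with positive root $\alpha$), are defined by: $Q_\tau(w)=\tau w$ if $\ell(\tau w)=\ell(w)+1$; $Q_\tau(w)=\tau w$ if $\ell(\tau w)=\ell(w)-\ell(\tau)$ and $\ell(\tau)=2\,{\rm ht}(\alpha)-1$; and $Q_\tau(w)=0$ otherwise. A reflection subgroup $W'$ of $W$ is a subgroup generated by a subset of $T$; it corresponds to the root subsystem of roots in $\Phi$ whose reflections lie in $W'$, with positive roots those of the subsystem lying in $\Phi^+$; its canonical generators are the reflections in the simple roots of this subsystem. It is dihedral if it has exactly two canonical generators. A reflection ordering is a bijection $\varphi:T\to\{1,\dots,N\}$ such that for every dihedral reflection subgroup with canonical generators $a,b$ the sequence $\varphi(a),\varphi(aba),\varphi(ababa),\dots,\varphi(bab),\varphi(b)$ (listing every reflection of the subgroup once) is either increasing or decreasing. The digraph $D(W)$ has vertex set $W$; for $u\in W$, $\tau\in T$ (with positive root $\alpha$) there is a directed edge from $u$ to $v=\tau u$ if either $\ell(v)=\ell(u)+1$,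 or $\ell(v)=\ell(u)-\ell(\tau)$ and $\ell(\tau)=2\,{\rm ht}(\alpha)-1$. This edge is labelled by $\varphi(\tau)$. For $u,v\in W$, $\ell(u,v)$ is the length (number of edges) of a shortest directed path in $D(W)$ from $u$ to $v$. The path of length $0$ is allowed (when $u=v$). Paths are compared lexicographically by their sequences of labels. *)

theory Defs
  imports
    "HOL-Analysis.Analysis"
    "HOL-Algebra.Bij"
    "HOL-Algebra.Generated_Groups"
    "HOL-Library.Poly_Mapping"
    "HOL-Computational_Algebra.Polynomial"
    "Graph_Theory.Arc_Walk"
begin

section \<open>Root systems\<close>

definition reflection :: "'a::real_inner \<Rightarrow> 'a \<Rightarrow> 'a" where
  "reflection \<alpha> x = x - (2 * (x \<bullet> \<alpha>) / (\<alpha> \<bullet> \<alpha>)) *\<^sub>R \<alpha>"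

text \<open>Reduced crystallographic root systems. The roots are not required to span the ambient
  space; in particular the empty root system (with trivial Weyl group) is allowed.\<close>

definition root_system :: "'a::euclidean_space set \<Rightarrow> bool" where
  "root_system \<Phi> \<longleftrightarrow>
     finite \<Phi> \<and> 0 \<notin> \<Phi> \<and>
     (\<forall>\<alpha>\<in>\<Phi>. reflection \<alpha> ` \<Phi> = \<Phi>) \<and>
     (\<forall>\<alpha>\<in>\<Phi>. \<forall>\<beta>\<in>\<Phi>. 2 * (\<beta> \<bullet> \<alpha>) / (\<alpha> \<bullet> \<alpha>) \<in> \<int>) \<and>
     (\<forall>\<alpha>\<in>\<Phi>. \<forall>c. c *\<^sub>R \<alpha> \<in> \<Phi> \<longrightarrow> c = 1 \<or> c = -1)"

definition positive_system :: "'a::euclidean_space set \<Rightarrow> 'a set \<Rightarrow> bool" where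
  "positive_system \<Phi> P \<longleftrightarrow>
     (\<exists>\<gamma>. (\<forall>\<alpha>\<in>\<Phi>. \<gamma> \<bullet> \<alpha> \<noteq> 0) \<and> P = {\<alpha> \<in> \<Phi>. \<gamma> \<bullet> \<alpha> > 0})"

text \<open>The simple roots are the indecomposable positive roots.\<close>

definition simple_roots :: "'a::euclidean_space set \<Rightarrow> 'a set" where
  "simple_roots P = {\<alpha> \<in> P. \<not> (\<exists>\<beta>\<in>P. \<exists>\<gamma>\<in>P. \<alpha> = \<beta> + \<gamma>)}"

definition height :: "'a::euclidean_space set \<Rightarrow> 'a \<Rightarrow> real" where
  "height P \<alpha> = (\<Sum>\<delta>\<in>simple_roots P. representation (simple_roots P) \<alpha> \<delta>)"

section \<open>Weyl groups\<close>

text \<open>Group elements are maps of the ambient space, multiplied by composition.\<close>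

definition weyl_group :: "'a::euclidean_space set \<Rightarrow> ('a \<Rightarrow> 'a) set" where
  "weyl_group \<Phi> = generate (BijGroup UNIV) (reflection ` \<Phi>)"

definition simple_reflections :: "'a::euclidean_space set \<Rightarrow> ('a \<Rightarrow> 'a) set" where
  "simple_reflections P = reflection ` simple_roots P"

definition reflections :: "'a::euclidean_space set \<Rightarrow> 'a set \<Rightarrow> ('a \<Rightarrow> 'a) set" where
  "reflections \<Phi> P =
     {w \<circ> s \<circ> inv_into UNIV w | w s. w \<in> weyl_group \<Phi> \<and> s \<in> simple_reflections P}"

definition len :: "'a::euclidean_space set \<Rightarrow> ('a \<Rightarrow> 'a) \<Rightarrow> nat" where
  "len P w = (LEAST n. \<exists>ss. set ss \<subseteq> simple_reflections P \<and> length ss = n \<and> foldr (\<circ>) ss id = w)"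

definition longest_element :: "'a::euclidean_space set \<Rightarrow> 'a set \<Rightarrow> ('a \<Rightarrow> 'a) \<Rightarrow> bool" where
  "longest_element \<Phi> P w\<^sub>o \<longleftrightarrow> w\<^sub>o \<in> weyl_group \<Phi> \<and> (\<forall>w\<in>weyl_group \<Phi>. len P w \<le> len P w\<^sub>o)"

definition positive_root :: "'a::euclidean_space set \<Rightarrow> ('a \<Rightarrow> 'a) \<Rightarrow> 'a" where
  "positive_root P \<tau> = (THE \<alpha>. \<alpha> \<in> P \<and> reflection \<alpha> = \<tau>)"

section \<open>Reflection orderings\<close>

definition reflection_subgroup :: "'a::euclidean_space set \<Rightarrow> 'a set \<Rightarrow> ('a \<Rightarrow> 'a) set \<Rightarrow> bool" where
  "reflection_subgroup \<Phi> P W' \<longleftrightarrow> (\<exists>R \<subseteq> reflections \<Phi> P. W' = generate (BijGroup UNIV) R)"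

definition subsystem :: "'a::euclidean_space set \<Rightarrow> ('a \<Rightarrow> 'a) set \<Rightarrow> 'a set" where
  "subsystem \<Phi> W' = {\<alpha> \<in> \<Phi>. reflection \<alpha> \<in> W'}"

definition canonical_generators ::
    "'a::euclidean_space set \<Rightarrow> 'a set \<Rightarrow> ('a \<Rightarrow> 'a) set \<Rightarrow> ('a \<Rightarrow> 'a) set" where
  "canonical_generators \<Phi> P W' = simple_reflections (subsystem \<Phi> W' \<inter> P)"

text \<open>If the dihedral subgroup \<open>W'\<close> contains \<open>m\<close> reflections, these are \<open>a (b a)\<^sup>i\<close> for
  \<open>i < m\<close>, that is \<open>a, aba, ababa, \<dots>, bab, b\<close>.\<close>

definition reflection_ordering ::
    "'a::euclidean_space set \<Rightarrow> 'a set \<Rightarrow> nat \<Rightarrow> (('a \<Rightarrow> 'a) \<Rightarrow> nat) \<Rightarrow> bool" where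
  "reflection_ordering \<Phi> P N \<phi> \<longleftrightarrow>
     bij_betw \<phi> (reflections \<Phi> P) {1..N} \<and>
     (\<forall>W' a b. reflection_subgroup \<Phi> P W' \<and> canonical_generators \<Phi> P W' = {a, b} \<and> a \<noteq> b \<longrightarrow>
        (let ls = map (\<lambda>i. \<phi> (a \<circ> (b \<circ> a) ^^ i)) [0..<card (reflections \<Phi> P \<inter> W')]
         in sorted_wrt (<) ls \<or> sorted_wrt (>) ls))"

section \<open>The digraph\<close>

definition bruhat_step :: "'a::euclidean_space set \<Rightarrow> ('a \<Rightarrow> 'a) \<Rightarrow> ('a \<Rightarrow> 'a) \<Rightarrow> bool" where
  "bruhat_step P u \<tau> \<longleftrightarrow>
     len P (\<tau> \<circ> u) = len P u + 1 \<or>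
     (int (len P (\<tau> \<circ> u)) = int (len P u) - int (len P \<tau>) \<and>
      real (len P \<tau>) = 2 * height P (positive_root P \<tau>) - 1)"

text \<open>The arc \<open>(u, \<tau>)\<close> leads from \<open>u\<close> to \<open>\<tau> u\<close>.\<close>

definition bruhat_digraph ::
    "'a::euclidean_space set \<Rightarrow> 'a set \<Rightarrow> ('a \<Rightarrow> 'a, ('a \<Rightarrow> 'a) \<times> ('a \<Rightarrow> 'a)) pre_digraph" where
  "bruhat_digraph \<Phi> P =
     \<lparr>verts = weyl_group \<Phi>,
      arcs = {(u, \<tau>). u \<in> weyl_group \<Phi> \<and> \<tau> \<in> reflections \<Phi> P \<and> bruhat_step P u \<tau>},
      tail = fst,
      head = (\<lambda>(u, \<tau>). \<tau> \<circ> u)\<rparr>"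

definition bruhat_path ::
    "'a::euclidean_space set \<Rightarrow> 'a set \<Rightarrow> ('a \<Rightarrow> 'a) \<Rightarrow> (('a \<Rightarrow> 'a) \<times> ('a \<Rightarrow> 'a)) list \<Rightarrow> ('a \<Rightarrow> 'a) \<Rightarrow> bool"
  where "bruhat_path \<Phi> P u p v \<longleftrightarrow> pre_digraph.awalk (bruhat_digraph \<Phi> P) u p v"

definition labels :: "(('a \<Rightarrow> 'a) \<Rightarrow> nat) \<Rightarrow> (('a \<Rightarrow> 'a) \<times> ('a \<Rightarrow> 'a)) list \<Rightarrow> nat list" where
  "labels \<phi> p = map (\<lambda>(u, \<tau>). \<phi> \<tau>) p"

definition path_dist :: "'a::euclidean_space set \<Rightarrow> 'a set \<Rightarrow> ('a \<Rightarrow> 'a) \<Rightarrow> ('a \<Rightarrow> 'a) \<Rightarrow> nat" where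
  "path_dist \<Phi> P u v = (LEAST n. \<exists>p. bruhat_path \<Phi> P u p v \<and> length p = n)"

definition shortest_path ::
    "'a::euclidean_space set \<Rightarrow> 'a set \<Rightarrow> ('a \<Rightarrow> 'a) \<Rightarrow> (('a \<Rightarrow> 'a) \<times> ('a \<Rightarrow> 'a)) list \<Rightarrow> ('a \<Rightarrow> 'a) \<Rightarrow> bool"
  where "shortest_path \<Phi> P u p v \<longleftrightarrow> bruhat_path \<Phi> P u p v \<and> length p = path_dist \<Phi> P u v"

definition lex_le :: "nat list \<Rightarrow> nat list \<Rightarrow> bool" where
  "lex_le xs ys \<longleftrightarrow> xs = ys \<or> (xs, ys) \<in> lexord {(i, j). i < j}"

section \<open>The operators\<close>

text \<open>For a commutative ring \<open>'r\<close>, the finitely supported functions \<open>'w \<Rightarrow>\<^sub>0 'r\<close> form the free module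
  on \<open>'w\<close>, and \<open>'r[W]\<close> consists of those supported on \<open>W\<close>. The case \<open>'r = 'k poly\<close> gives the
  extension of scalars of \<open>k[W]\<close> from \<open>k\<close> to \<open>k[\<epsilon>]\<close>.\<close>

definition scale :: "'r::comm_ring_1 \<Rightarrow> ('w \<Rightarrow>\<^sub>0 'r) \<Rightarrow> ('w \<Rightarrow>\<^sub>0 'r)" where
  "scale c x = Poly_Mapping.map ((*) c) x"

definition linear_extension ::
    "('w \<Rightarrow> ('v \<Rightarrow>\<^sub>0 'r::comm_ring_1)) \<Rightarrow> ('w \<Rightarrow>\<^sub>0 'r) \<Rightarrow> ('v \<Rightarrow>\<^sub>0 'r)" where
  "linear_extension f x = (\<Sum>w\<in>Poly_Mapping.keys x. scale (Poly_Mapping.lookup x w) (f w))"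

definition Q_op ::
    "'a::euclidean_space set \<Rightarrow> ('a \<Rightarrow> 'a) \<Rightarrow> (('a \<Rightarrow> 'a) \<Rightarrow>\<^sub>0 'r::comm_ring_1) \<Rightarrow> (('a \<Rightarrow> 'a) \<Rightarrow>\<^sub>0 'r)" where
  "Q_op P \<tau> =
     linear_extension (\<lambda>w. if bruhat_step P w \<tau> then Poly_Mapping.single (\<tau> \<circ> w) 1 else 0)"

definition eps :: "'k::field_char_0 poly" where
  "eps = [:0, 1:]"

definition R_op ::
    "'a::euclidean_space set \<Rightarrow> ('a \<Rightarrow> 'a) \<Rightarrow>
     (('a \<Rightarrow> 'a) \<Rightarrow>\<^sub>0 'k::field_char_0 poly) \<Rightarrow> (('a \<Rightarrow> 'a) \<Rightarrow>\<^sub>0 'k poly)" where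
  "R_op P \<tau> x = x + scale eps (Q_op P \<tau> x)"

end

theory Submission
  imports Defs
begin

text \<open>
  A step \<open>w \<mapsto> \<tau> w\<close> along the reflection in a positive root \<open>\<alpha>\<close> changes the length by at least \<open>1\<close> if
  \<open>w\<^sup>-\<^sup>1 \<alpha>\<close> is positive, and by at least \<open>1 - 2 ht \<alpha>\<close> if it is negative (lemma \<open>len_step_bound\<close>). The edges of the
  digraph are exactly the steps that attain these bounds (\<open>bruhat_step_iff\<close>). Hence, for a sequence of
  \<open>n\<close> steps from \<open>u\<close> to \<open>v\<close>, the difference of lengths is at least \<open>n - 2 h\<close>, where \<open>h\<close> is the total height of
  the roots of its downward steps, with equality if and only if all steps are edges. So a sequence of steps with the same
  end points, the same number of steps and the same \<open>h\<close> as a genuine path is itself a path. This principle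
  reduces every local question to the dihedral subgroups of the planes spanned by two roots. There are six
  possible lists of positive roots in such a plane, and for each of them a finite computation (\<open>rank2_checks\<close>) compares the paths
  whose labels increase with those whose labels decrease. It yields two facts about all cosets of these
  subgroups: the path-counting operators of the plane, multiplied in either order, agree
  (\<open>path_sum_dihedral_rev\<close>, the Yang--Baxter equation at \<open>\<epsilon> = 1\<close>), and two consecutive decreasing labels can be exchanged for
  two increasing ones of which the first is smaller (\<open>dihedral_exchange\<close>).

  Existence and minimality. Among all paths from \<open>u\<close> to \<open>v\<close> take a shortest one, and among those the lexicographically first.
  By the exchange property it has no descent, so it is increasing (\<open>minimal_path\<close>).

  Uniqueness. A reflection ordering lists the positive roots in the order in which they become inverted along a reduced word of
  the longest element (\<open>chain_of_ordering\<close>). Any two reduced words are connected by flips inside planes, so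
  by the Yang--Baxter equation the operator that counts increasing paths does not depend on the
  ordering (\<open>path_sum_chain\<close>). As the ordering may be chosen to begin, or to end, with any given simple
  reflection \<open>s\<close>, and as the factor of \<open>s\<close> does not see the difference between \<open>w\<close> and \<open>s w\<close>, the number of
  increasing paths from \<open>u\<close> to \<open>v\<close> is the same for all \<open>u\<close> and \<open>v\<close> (\<open>path_sum_delta_const\<close>). From the identity to the
  longest element there is only one, because such a path has at least \<open>N\<close> steps and must
  use every label (\<open>increasing_path_to_longest\<close>).

  Decreasing paths are increasing for the reversed ordering \<open>N + 1 - \<phi>\<close>. Expanding the product of the operators gives
  the sum of \<open>\<epsilon>\<close> to the number of steps over all decreasing paths from \<open>u\<close> (\<open>product_of_operators\<close>), which by
  the first two parts is the asserted formula.
\<close>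

section \<open>The dihedral digraphs\<close>

text \<open>The positive roots of a rank two root system with simple roots \<open>a\<close> and \<open>b\<close>, as coordinates with respect to \<open>a\<close> and
  \<open>b\<close>, in their angular order from \<open>a\<close> to \<open>b\<close>: types \<open>A\<^sub>1 \<times> A\<^sub>1\<close>, \<open>A\<^sub>2\<close>, and \<open>B\<^sub>2\<close> and \<open>G\<^sub>2\<close> with either root in the role
  of the long one.\<close>

definition dihedral_tables :: "(int \<times> int) list list" where
  "dihedral_tables =
     [[(1,0),(0,1)],
      [(1,0),(1,1),(0,1)],
      [(1,0),(1,1),(1,2),(0,1)], [(1,0),(2,1),(1,1),(0,1)],
      [(1,0),(1,1),(2,3),(1,2),(1,3),(0,1)], [(1,0),(3,1),(2,1),(3,2),(1,1),(0,1)]]"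

text \<open>An element of a coset of the dihedral group with \<open>m\<close> reflections is encoded by its chamber
  \<open>k\<close> modulo \<open>2 m\<close>. With the roots of the plane numbered cyclically, \<open>0,
  \<dots>, m - 1\<close> being the positive ones, \<open>k\<close> is the first of the \<open>m\<close>
  consecutive roots that are not inverted. Left multiplication by the reflection in root \<open>i\<close>
  takes \<open>k\<close> to \<open>2 i + 1 - k\<close>.\<close>

definition rot :: "int \<Rightarrow> int \<Rightarrow> int \<Rightarrow> int" where
  "rot m k i = (2 * i + 1 - k) mod (2 * m)"

definition ascent :: "int \<Rightarrow> int \<Rightarrow> int \<Rightarrow> bool" where
  "ascent m k i \<longleftrightarrow> (i - k) mod (2 * m) < m"

definition rank2_len :: "int \<Rightarrow> int \<Rightarrow> int" where
  "rank2_len m k = min k (2 * m - k)"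

definition drop_weight :: "(int \<times> int) list \<Rightarrow> int \<Rightarrow> int \<Rightarrow> int \<times> int" where
  "drop_weight T k i = (if ascent (int (length T)) k i then (0, 0) else T ! nat i)"

text \<open>The edge condition of the digraph of the dihedral group itself, where both simple roots have height
  \<open>1\<close>.\<close>

definition rank2_edge :: "(int \<times> int) list \<Rightarrow> int \<Rightarrow> int \<Rightarrow> bool" where
  "rank2_edge T k i \<longleftrightarrow>
     rank2_len (int (length T)) (rot (int (length T)) k i) + 2 * (fst (drop_weight T k i) + snd (drop_weight T k i))
       = rank2_len (int (length T)) k + 1"

text \<open>The product of the operators \<open>R\<close> at \<open>\<epsilon> = 1\<close>, acting on functions on the
  vertices instead of formal sums. Appending lists then composes operators, and the value at
  \<open>s\<close> is the sum of \<open>F\<close> over the end points of all paths from \<open>s\<close>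
  whose labels form a subsequence of the list.\<close>

fun path_sum :: "('s \<Rightarrow> 'i \<Rightarrow> 's) \<Rightarrow> ('s \<Rightarrow> 'i \<Rightarrow> bool) \<Rightarrow> 'i list \<Rightarrow> ('s \<Rightarrow> nat) \<Rightarrow> 's \<Rightarrow> nat" where
  "path_sum act edge [] F s = F s"
| "path_sum act edge (i # is) F s =
     path_sum act edge is F s + (if edge s i then path_sum act edge is F (act s i) else 0)"

lemma path_sum_append:
  "path_sum act edge (is @ js) F = path_sum act edge is (path_sum act edge js F)"
proof
  show "path_sum act edge (is @ js) F s = path_sum act edge is (path_sum act edge js F) s" for s
    by (induction "is" arbitrary: s) auto
qed

lemma path_sum_transfer:
  assumes "s \<in> S"
    and "\<And>s i. s \<in> S \<Longrightarrow> i \<in> set is \<Longrightarrow> act s i \<in> S"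
    and "\<And>s i. s \<in> S \<Longrightarrow> i \<in> set is \<Longrightarrow> h (act s i) = act' (h s) (r i)"
    and "\<And>s i. s \<in> S \<Longrightarrow> i \<in> set is \<Longrightarrow> edge s i \<longleftrightarrow> edge' (h s) (r i)"
  shows "path_sum act' edge' (map r is) F (h s) = path_sum act edge is (\<lambda>s. F (h s)) s"
  using assms
proof (induction "is" arbitrary: s)
  case (Cons i "is")
  have *: "path_sum act' edge' (map r is) F (h t) = path_sum act edge is (\<lambda>s. F (h s)) t" if "t \<in> S" for t
    by (rule Cons.IH) (use that Cons.prems in auto)
  show ?case
    using *[of s] *[of "act s i"] Cons.prems by auto
qed auto

text \<open>For each path from \<open>k\<close> with labels in the given order: its end, its number of steps, and the
  two coordinates of the sum of the roots of its downward steps.\<close>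

fun runs :: "(int \<times> int) list \<Rightarrow> int list \<Rightarrow> int \<Rightarrow> (int \<times> int \<times> int \<times> int) list" where
  "runs T [] k = [(k, 0, 0, 0)]"
| "runs T (i # is) k = runs T is k @
     (if rank2_edge T k i
      then map (\<lambda>(e, n, x, y). (e, n + 1, fst (drop_weight T k i) + x, snd (drop_weight T k i) + y))
             (runs T is (rot (int (length T)) k i))
      else [])"

definition runs_symmetric :: "(int \<times> int) list \<Rightarrow> bool" where
  "runs_symmetric T \<longleftrightarrow> (\<forall>k\<in>set [0..2 * int (length T) - 1].
     let up = runs T [0..int (length T) - 1] k; down = runs T (rev [0..int (length T) - 1]) k
     in distinct up \<and> distinct down \<and> set up = set down)"

text \<open>A step that is not an edge of the dihedral digraph is beaten by an increasing path between the same vertices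
  with more steps and no larger sum of roots.\<close>

definition nonedges_slack :: "(int \<times> int) list \<Rightarrow> bool" where
  "nonedges_slack T \<longleftrightarrow> (\<forall>k\<in>set [0..2 * int (length T)-1]. let rs = runs T [0..int (length T)-1] k in
     \<forall>i\<in>set [0..int (length T)-1]. 
     rank2_edge T k i \<or>
     (\<exists>(e, n, x, y)\<in>set rs.
        e = rot (int (length T)) k i \<and> 1 < n \<and> x \<le> fst (drop_weight T k i) \<and> y \<le> snd (drop_weight T k i)))"

definition descents_exchange :: "(int \<times> int) list \<Rightarrow> bool" where
  "descents_exchange T \<longleftrightarrow> (let m = int (length T) in
     \<forall>k\<in>set [0..2 * m-1]. \<forall>i\<in>set [0..m-1]. rank2_edge T k i \<longrightarrow> (\<forall>i'\<in>set [0..i-1].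
       rank2_edge T (rot m k i) i' \<longrightarrow>
       (\<exists>j\<in>set [0..i-1]. \<exists>j'\<in>set [j+1..m-1].
          rot m (rot m k j) j' = rot m (rot m k i) i' \<and>
          fst (drop_weight T k j) + fst (drop_weight T (rot m k j) j')
            = fst (drop_weight T k i) + fst (drop_weight T (rot m k i) i') \<and>
          snd (drop_weight T k j) + snd (drop_weight T (rot m k j) j')
            = snd (drop_weight T k i) + snd (drop_weight T (rot m k i) i'))))"

text \<open>The three facts of rank two on which everything rests: increasing and decreasing paths have the same
  invariants, the dihedral digraph has all the edges that a larger digraph can have on a coset, and descents
  can be exchanged without changing the sum of roots.\<close>

lemma rank2_checks:
  assumes "T \<in> set dihedral_tables"
  shows "runs_symmetric T" "nonedges_slack T" "descents_exchange T"
proof -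
  have "\<forall>T\<in>set dihedral_tables. runs_symmetric T \<and> nonedges_slack T \<and> descents_exchange T"
    by code_simp
  then show "runs_symmetric T" "nonedges_slack T" "descents_exchange T"
    using assms by auto
qed

lemma dihedral_table_facts:
  assumes T: "T \<in> set dihedral_tables"
  shows "T ! 0 = (1, 0)" "T ! (length T - 1) = (0, 1)" "length T \<ge> 2"
    and "\<And>i. i < length T \<Longrightarrow> fst (T ! i) \<ge> 0 \<and> snd (T ! i) \<ge> 0 \<and> fst (T ! i) + snd (T ! i) > 0"
    and "\<And>i j. i < j \<Longrightarrow> j < length T \<Longrightarrow> fst (T ! j) * snd (T ! i) < fst (T ! i) * snd (T ! j)"
proof -
  have "\<forall>T\<in>set dihedral_tables. T ! 0 = (1, 0) \<and> T ! (length T - 1) = (0, 1) \<and> length T \<ge> 2 \<and>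
    (\<forall>i\<in>set [0..<length T]. fst (T ! i) \<ge> 0 \<and> snd (T ! i) \<ge> 0 \<and> fst (T ! i) + snd (T ! i) > 0) \<and>
    (\<forall>j\<in>set [0..<length T]. \<forall>i\<in>set [0..<j]. fst (T ! j) * snd (T ! i) < fst (T ! i) * snd (T ! j))"
    by code_simp
  note * = this[rule_format, OF T]
  show "T ! 0 = (1, 0)" "T ! (length T - 1) = (0, 1)" "length T \<ge> 2"
    using * by auto
  show "fst (T ! i) \<ge> 0 \<and> snd (T ! i) \<ge> 0 \<and> fst (T ! i) + snd (T ! i) > 0" if "i < length T" for i
    using * that by auto
  show "fst (T ! j) * snd (T ! i) < fst (T ! i) * snd (T ! j)" if "i < j" "j < length T" for i j
    using * that by auto
qed

text \<open>The lengths \<open>L k\<close> of the elements of a coset inside a larger Weyl group, in which the two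
  simple roots of the plane have heights \<open>p\<close> and \<open>q\<close>. Only the lower bounds for
  length differences are assumed; the steps that attain them are the edges.\<close>

locale rank2_model =
  fixes T :: "(int \<times> int) list" and L :: "int \<Rightarrow> real" and p q :: real
  assumes table: "T \<in> set dihedral_tables"
    and p: "p \<ge> 1" and q: "q \<ge> 1"
    and L_step: "\<And>k i. k \<in> {0..<2 * int (length T)} \<Longrightarrow> i \<in> {0..<int (length T)} \<Longrightarrow>
        L (rot (int (length T)) k i) \<ge> L k + 1
          - 2 * (of_int (fst (drop_weight T k i)) * p + of_int (snd (drop_weight T k i)) * q)"
begin

abbreviation m :: int where "m \<equiv> int (length T)"

definition tight :: "int \<Rightarrow> int \<Rightarrow> bool" where
  "tight k i \<longleftrightarrow> L (rot m k i) = L k + 1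
     - 2 * (of_int (fst (drop_weight T k i)) * p + of_int (snd (drop_weight T k i)) * q)"

lemma m_pos: "m > 0"
  using dihedral_table_facts(3)[OF table] by linarith

lemma rot_range: "rot m k i \<in> {0..<2 * m}"
  using m_pos by (simp add: rot_def)

text \<open>The bounds of the single steps add up.\<close>

lemma runs_bound:
  assumes "(e, n, x, y) \<in> set (runs T is k)" "set is \<subseteq> {0..<m}" "k \<in> {0..<2 * m}"
  shows "L e \<ge> L k + of_int n - 2 * (of_int x * p + of_int y * q)"
  using assms
proof (induction "is" arbitrary: e n x y k)
  case (Cons i "is")
  show ?case
  proof (cases "(e, n, x, y) \<in> set (runs T is k)")
    case True
    then show ?thesis using Cons by auto
  next
    case False
    with Cons.prems(1) obtain n' x' y' where r: "(e, n', x', y') \<in> set (runs T is (rot m k i))"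
      and e: "n = n' + 1" "x = fst (drop_weight T k i) + x'" "y = snd (drop_weight T k i) + y'"
      by (auto split: if_splits)
    have "L e \<ge> L (rot m k i) + of_int n' - 2 * (of_int x' * p + of_int y' * q)"
      using Cons.IH[OF r _ rot_range] Cons.prems(2) by auto
    moreover have "L (rot m k i) \<ge> L k + 1
          - 2 * (of_int (fst (drop_weight T k i)) * p + of_int (snd (drop_weight T k i)) * q)"
      using L_step Cons.prems by auto
    ultimately show ?thesis by (simp add: e algebra_simps)
  qed
qed auto

text \<open>A tight step that is not an edge of the dihedral digraph would violate the bound for the longer path that
  \<open>nonedges_slack\<close> provides.\<close>

lemma tight_imp_edge:
  assumes k: "k \<in> {0..<2 * m}" and i: "i \<in> {0..<m}" and t: "tight k i"
  shows "rank2_edge T k i"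
proof (rule ccontr)
  assume "\<not> rank2_edge T k i"
  moreover have "k \<in> set [0..2 * m - 1]" "i \<in> set [0..m - 1]"
    using k i by auto
  ultimately obtain n x y where r: "(rot m k i, n, x, y) \<in> set (runs T [0..m - 1] k)" and
    n: "1 < n" and x: "x \<le> fst (drop_weight T k i)" and y: "y \<le> snd (drop_weight T k i)"
    using rank2_checks(2)[OF table] unfolding nonedges_slack_def Let_def by fast
  have "L (rot m k i) \<ge> L k + of_int n - 2 * (of_int x * p + of_int y * q)"
    by (rule runs_bound[OF r _ k]) auto
  moreover have "of_int x * p \<le> of_int (fst (drop_weight T k i)) * p"
    "of_int y * q \<le> of_int (snd (drop_weight T k i)) * q"
    using x y p q by (auto intro!: mult_right_mono)
  ultimately show False using t n unfolding tight_def by simp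
qed

text \<open>A path of the dihedral digraph consists of tight steps if and only if the bound for the whole path is
  attained, and that depends only on its end points, its number of steps and its sum of roots.\<close>

lemma path_sum_runs:
  assumes "set is \<subseteq> {0..<m}" "k \<in> {0..<2 * m}"
  shows "path_sum (rot m) tight is F k =
    (\<Sum>(e, n, x, y)\<leftarrow>runs T is k. if L e = L k + of_int n - 2 * (of_int x * p + of_int y * q) then F e else 0)"
  using assms
proof (induction "is" arbitrary: k)
  case (Cons i "is")
  define k' where "k' = rot m k i"
  define dx dy where "dx = fst (drop_weight T k i)" and "dy = snd (drop_weight T k i)"
  have k': "k' \<in> {0..<2 * m}" by (simp only: k'_def rot_range)
  have i: "i \<in> {0..<m}" and "is": "set is \<subseteq> {0..<m}" using Cons.prems by auto
  have step: "L k' \<ge> L k + 1 - 2 * (of_int dx * p + of_int dy * q)"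
    using L_step[OF Cons.prems(2) i] by (simp add: k'_def dx_def dy_def)
  have tight: "tight k i \<longleftrightarrow> L k' = L k + 1 - 2 * (of_int dx * p + of_int dy * q)"
    by (simp add: tight_def k'_def dx_def dy_def)
  have "(if tight k i then \<Sum>(e, n, x, y)\<leftarrow>runs T is k'.
            if L e = L k' + of_int n - 2 * (of_int x * p + of_int y * q) then F e else 0 else 0) =
    (if rank2_edge T k i then \<Sum>(e, n, x, y)\<leftarrow>runs T is k'.
            if L e = L k + of_int (n + 1) - 2 * (of_int (dx + x) * p + of_int (dy + y) * q) then F e else 0 else 0)"
    (is "?l = ?r")
  proof (cases "rank2_edge T k i")
    case False
    then show ?thesis using tight_imp_edge[OF Cons.prems(2) i] by auto
  next
    case True
    have "L e = L k + of_int (n + 1) - 2 * (of_int (dx + x) * p + of_int (dy + y) * q)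
       \<longleftrightarrow> tight k i \<and> L e = L k' + of_int n - 2 * (of_int x * p + of_int y * q)"
      if "(e, n, x, y) \<in> set (runs T is k')" for e n x y
      using runs_bound[OF that "is" k'] step unfolding tight by (auto simp: algebra_simps)
    then show ?thesis using True
      by (auto intro!: arg_cong[where f = sum_list] map_cong)
  qed
  moreover have "path_sum (rot m) tight (i # is) F k = path_sum (rot m) tight is F k
      + (if tight k i then path_sum (rot m) tight is F k' else 0)"
    by (simp add: k'_def)
  moreover have "(\<Sum>(e, n, x, y)\<leftarrow>runs T (i # is) k.
      if L e = L k + of_int n - 2 * (of_int x * p + of_int y * q) then F e else 0) =
    (\<Sum>(e, n, x, y)\<leftarrow>runs T is k.
      if L e = L k + of_int n - 2 * (of_int x * p + of_int y * q) then F e else 0) + ?r"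
    by (auto simp: k'_def dx_def dy_def o_def case_prod_unfold cong: if_cong)
  ultimately show ?case
    unfolding Cons.IH[OF "is" Cons.prems(2)] Cons.IH[OF "is" k'] by presburger
qed auto

lemma path_sum_rev:
  assumes "k \<in> {0..<2 * m}"
  shows "path_sum (rot m) tight [0..m - 1] F k = path_sum (rot m) tight (rev [0..m - 1]) F k"
proof -
  have "k \<in> set [0..2 * m - 1]" using assms by auto
  then have "distinct (runs T [0..m - 1] k)" "distinct (runs T (rev [0..m - 1]) k)"
    "set (runs T [0..m - 1] k) = set (runs T (rev [0..m - 1]) k)"
    using rank2_checks(1)[OF table] unfolding runs_symmetric_def Let_def by blast+
  moreover have "set [0..m - 1] \<subseteq> {0..<m}" "set (rev [0..m - 1]) \<subseteq> {0..<m}"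
    by auto
  ultimately show ?thesis
    using assms by (simp only: path_sum_runs sum_list_distinct_conv_sum_set)
qed

lemma tight_exchange:
  assumes k: "k \<in> {0..<2 * m}" and i: "i \<in> {0..<m}" and i': "0 \<le> i'" "i' < i"
    and t: "tight k i" "tight (rot m k i) i'"
  shows "\<exists>j j'. 0 \<le> j \<and> j < i \<and> j < j' \<and> j' < m \<and> tight k j \<and> tight (rot m k j) j' \<and>
    rot m (rot m k j) j' = rot m (rot m k i) i'"
proof -
  have "rank2_edge T k i" "rank2_edge T (rot m k i) i'"
    using tight_imp_edge[OF k i t(1)] tight_imp_edge[OF rot_range _ t(2)] i i' by auto
  moreover have "k \<in> set [0..2 * m - 1]" "i \<in> set [0..m - 1]" "i' \<in> set [0..i - 1]"
    using k i i' by auto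
  ultimately obtain j j' where j: "j \<in> set [0..i - 1]" "j' \<in> set [j + 1..m - 1]"
    and r: "rot m (rot m k j) j' = rot m (rot m k i) i'"
    and w: "fst (drop_weight T k j) + fst (drop_weight T (rot m k j) j')
            = fst (drop_weight T k i) + fst (drop_weight T (rot m k i) i')"
           "snd (drop_weight T k j) + snd (drop_weight T (rot m k j) j')
            = snd (drop_weight T k i) + snd (drop_weight T (rot m k i) i')"
    using rank2_checks(3)[OF table] unfolding descents_exchange_def Let_def by blast
  have w': "real_of_int (fst (drop_weight T k j)) = fst (drop_weight T k i) + fst (drop_weight T (rot m k i) i')
         - fst (drop_weight T (rot m k j) j')"
     "real_of_int (snd (drop_weight T k j)) = snd (drop_weight T k i) + snd (drop_weight T (rot m k i) i')
         - snd (drop_weight T (rot m k j) j')"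
    using w by linarith+
  have "L (rot m k j) \<ge> L k + 1
          - 2 * (of_int (fst (drop_weight T k j)) * p + of_int (snd (drop_weight T k j)) * q)"
    using L_step[OF k] j i by auto
  moreover have "L (rot m (rot m k j) j') \<ge> L (rot m k j) + 1
          - 2 * (of_int (fst (drop_weight T (rot m k j) j')) * p + of_int (snd (drop_weight T (rot m k j) j')) * q)"
    using L_step[OF rot_range] j by auto
  ultimately have "tight k j \<and> tight (rot m k j) j'"
    using t unfolding tight_def r by (simp add: w' algebra_simps)
  then show ?thesis using j i r by (intro exI[of _ j] exI[of _ j']) auto
qed

end

section \<open>Reflections and root systems\<close>

lemma linear_reflection: "linear (reflection \<alpha>)"
  by (rule linearI) (auto simp: reflection_def inner_add_left algebra_simps add_divide_distrib)

lemma reflection_add: "reflection \<alpha> (x + y) = reflection \<alpha> x + reflection \<alpha> y"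
  and reflection_diff: "reflection \<alpha> (x - y) = reflection \<alpha> x - reflection \<alpha> y"
  and reflection_scale: "reflection \<alpha> (c *\<^sub>R x) = c *\<^sub>R reflection \<alpha> x"
  and reflection_minus: "reflection \<alpha> (- x) = - reflection \<alpha> x"
  using linear_reflection[of \<alpha>]
  by (auto simp: linear_add linear_diff linear_scale linear_neg)

lemma reflection_self: "reflection \<alpha> \<alpha> = - \<alpha>"
  by (cases "\<alpha> = 0") (auto simp: reflection_def scaleR_2)

lemma reflection_uminus: "reflection (- \<alpha>) = reflection \<alpha>"
  by (auto simp: reflection_def fun_eq_iff)

lemma reflection_involution: "reflection \<alpha> (reflection \<alpha> x) = x"
proof (cases "\<alpha> = 0")
  case False
  have "reflection \<alpha> (reflection \<alpha> x) = reflection \<alpha> x - (2 * (x \<bullet> \<alpha>) / (\<alpha> \<bullet> \<alpha>)) *\<^sub>R reflection \<alpha> \<alpha>"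
    by (subst (2) reflection_def) (simp add: reflection_diff reflection_scale)
  then show ?thesis by (simp add: reflection_self) (simp add: reflection_def)
qed (auto simp: reflection_def)

lemma reflection_comp_self: "reflection \<alpha> \<circ> reflection \<alpha> = id"
  by (auto simp: reflection_involution)

lemma bij_reflection: "bij (reflection \<alpha>)"
  by (rule o_bij[OF reflection_comp_self reflection_comp_self])

lemma inv_reflection: "inv_into UNIV (reflection \<alpha>) = reflection \<alpha>"
  by (rule inv_unique_comp[OF reflection_comp_self reflection_comp_self])

lemma reflection_inner: "reflection \<alpha> x \<bullet> reflection \<alpha> y = x \<bullet> y"
proof (cases "\<alpha> = 0")
  case False
  then have "\<alpha> \<bullet> \<alpha> \<noteq> 0" by simp
  then show ?thesis
    by (simp add: reflection_def inner_diff_left inner_diff_right inner_commute field_simps)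
qed (auto simp: reflection_def)

lemma isometry_reflection:
  assumes "linear f" "\<And>x y. f x \<bullet> f y = x \<bullet> y"
  shows "f (reflection \<alpha> x) = reflection (f \<alpha>) (f x)"
  using assms(1) by (simp add: reflection_def linear_diff linear_scale assms(2))

lemma reflection_reflection:
  "reflection \<alpha> (reflection \<beta> x) = reflection (reflection \<alpha> \<beta>) (reflection \<alpha> x)"
  by (rule isometry_reflection[OF linear_reflection reflection_inner])

lemma reflection_conjugate: "reflection \<alpha> \<circ> reflection \<beta> \<circ> reflection \<alpha> = reflection (reflection \<alpha> \<beta>)"
proof
  show "(reflection \<alpha> \<circ> reflection \<beta> \<circ> reflection \<alpha>) x = reflection (reflection \<alpha> \<beta>) x" for x
    using reflection_reflection[of \<alpha> \<beta> "reflection \<alpha> x"] by (simp add: reflection_involution)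
qed

locale positive_roots =
  fixes \<Phi> P :: "'a::euclidean_space set"
  assumes rs: "root_system \<Phi>" and ps: "positive_system \<Phi> P"
begin

abbreviation \<Delta> :: "'a set" where "\<Delta> \<equiv> simple_roots P"
abbreviation W :: "('a \<Rightarrow> 'a) set" where "W \<equiv> weyl_group \<Phi>"

text \<open>A vector that defines the positive system.\<close>

definition pv :: 'a where
  "pv = (SOME \<gamma>. (\<forall>\<alpha>\<in>\<Phi>. \<gamma> \<bullet> \<alpha> \<noteq> 0) \<and> P = {\<alpha> \<in> \<Phi>. \<gamma> \<bullet> \<alpha> > 0})"

lemma pv: "\<And>\<alpha>. \<alpha> \<in> \<Phi> \<Longrightarrow> pv \<bullet> \<alpha> \<noteq> 0" "P = {\<alpha> \<in> \<Phi>. pv \<bullet> \<alpha> > 0}"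
  using someI_ex[OF ps[unfolded positive_system_def]] unfolding pv_def by blast+

lemma P_iff: "\<alpha> \<in> P \<longleftrightarrow> \<alpha> \<in> \<Phi> \<and> pv \<bullet> \<alpha> > 0"
  using pv(2) by blast

lemma P_pos: "\<alpha> \<in> P \<Longrightarrow> pv \<bullet> \<alpha> > 0"
  by (simp add: P_iff)

lemma P_root: "\<alpha> \<in> P \<Longrightarrow> \<alpha> \<in> \<Phi>"
  by (simp add: P_iff)

lemma finite_P: "finite P" and finite_\<Delta>: "finite \<Delta>" and \<Delta>_P: "\<delta> \<in> \<Delta> \<Longrightarrow> \<delta> \<in> P"
proof -
  have "finite \<Phi>" using rs by (simp add: root_system_def)
  then show "finite P" by (rule rev_finite_subset) (auto simp: P_iff)
  then show "finite \<Delta>" by (rule rev_finite_subset) (auto simp: simple_roots_def)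
  show "\<delta> \<in> \<Delta> \<Longrightarrow> \<delta> \<in> P" by (simp add: simple_roots_def)
qed

lemma root_nz: "\<alpha> \<in> \<Phi> \<Longrightarrow> \<alpha> \<noteq> 0"
  using rs by (auto simp: root_system_def)

lemma reflection_root: "\<alpha> \<in> \<Phi> \<Longrightarrow> \<beta> \<in> \<Phi> \<Longrightarrow> reflection \<alpha> \<beta> \<in> \<Phi>"
  using rs unfolding root_system_def by blast

lemma uminus_root: "- \<alpha> \<in> \<Phi> \<longleftrightarrow> \<alpha> \<in> \<Phi>"
  using reflection_root[of \<alpha> \<alpha>] reflection_root[of "-\<alpha>" "-\<alpha>"] by (auto simp: reflection_self)

lemma uminus_P: "\<alpha> \<in> \<Phi> \<Longrightarrow> - \<alpha> \<in> P \<longleftrightarrow> \<alpha> \<notin> P"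
  using pv(1)[of \<alpha>] by (auto simp: P_iff uminus_root)

lemma P_not_neg: "\<alpha> \<in> P \<Longrightarrow> - \<alpha> \<notin> P"
  by (auto simp: P_iff)

lemma reduced: "\<alpha> \<in> \<Phi> \<Longrightarrow> c *\<^sub>R \<alpha> \<in> \<Phi> \<Longrightarrow> c = 1 \<or> c = -1"
  using rs by (auto simp: root_system_def)

lemma reduced_pos: "\<alpha> \<in> P \<Longrightarrow> c *\<^sub>R \<alpha> \<in> P \<Longrightarrow> c = 1"
  using reduced[of \<alpha> c] P_not_neg[of \<alpha>] P_root by auto

lemma integral: "\<alpha> \<in> \<Phi> \<Longrightarrow> \<beta> \<in> \<Phi> \<Longrightarrow> 2 * (\<beta> \<bullet> \<alpha>) / (\<alpha> \<bullet> \<alpha>) \<in> \<int>"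
  using rs by (auto simp: root_system_def)

lemma positive_root_induct [consumes 1, case_names simple sum]:
  assumes "\<alpha> \<in> P"
    and "\<And>\<delta>. \<delta> \<in> \<Delta> \<Longrightarrow> Q \<delta>"
    and "\<And>\<beta> \<gamma>. \<beta> \<in> P \<Longrightarrow> \<gamma> \<in> P \<Longrightarrow> \<beta> + \<gamma> \<in> P \<Longrightarrow> Q \<beta> \<Longrightarrow> Q \<gamma> \<Longrightarrow> Q (\<beta> + \<gamma>)"
  shows "Q \<alpha>"
  using assms(1)
proof (induction "card {\<beta> \<in> P. pv \<bullet> \<beta> < pv \<bullet> \<alpha>}" arbitrary: \<alpha> rule: less_induct)
  case less
  have smaller: "card {\<beta>' \<in> P. pv \<bullet> \<beta>' < pv \<bullet> \<beta>} < card {\<beta> \<in> P. pv \<bullet> \<beta> < pv \<bullet> \<alpha>}"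
    if "\<beta> \<in> P" "pv \<bullet> \<beta> < pv \<bullet> \<alpha>" for \<beta>
    by (rule psubset_card_mono) (use finite_P that in auto)
  show ?case
  proof (cases "\<alpha> \<in> \<Delta>")
    case True
    then show ?thesis by (rule assms(2))
  next
    case False
    then obtain \<beta> \<gamma> where bg: "\<beta> \<in> P" "\<gamma> \<in> P" "\<alpha> = \<beta> + \<gamma>"
      using less.prems by (auto simp: simple_roots_def)
    have "pv \<bullet> \<beta> < pv \<bullet> \<alpha>" "pv \<bullet> \<gamma> < pv \<bullet> \<alpha>"
      using bg P_pos[of \<beta>] P_pos[of \<gamma>] by (auto simp: inner_add_right)
    then show ?thesis
      using less bg smaller assms(3) by blast
  qed
qed

text \<open>Roots that are not proportional are linearly independent, so the inequality is strict.\<close>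

lemma root_cauchy_schwarz:
  assumes a: "\<alpha> \<in> \<Phi>" and b: "\<beta> \<in> \<Phi>" and ne: "\<alpha> \<noteq> \<beta>" "\<alpha> \<noteq> - \<beta>"
  shows "(\<alpha> \<bullet> \<beta>) * (\<alpha> \<bullet> \<beta>) < (\<alpha> \<bullet> \<alpha>) * (\<beta> \<bullet> \<beta>)"
proof -
  define B c where "B = \<beta> \<bullet> \<beta>" and "c = \<alpha> \<bullet> \<beta>"
  have B: "B > 0" using root_nz[OF b] by (auto simp: B_def)
  define v where "v = B *\<^sub>R \<alpha> - c *\<^sub>R \<beta>"
  have vv: "v \<bullet> v = B * ((\<alpha> \<bullet> \<alpha>) * B - c * c)"
    by (simp add: v_def B_def c_def inner_diff_left inner_diff_right inner_commute algebra_simps)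
  have "v \<noteq> 0"
  proof
    assume "v = 0"
    then have "inverse B *\<^sub>R (B *\<^sub>R \<alpha>) = inverse B *\<^sub>R (c *\<^sub>R \<beta>)" by (simp add: v_def)
    then have "\<alpha> = (c / B) *\<^sub>R \<beta>" using B by (simp add: divide_inverse_commute)
    then show False using reduced[OF b, of "c / B"] a ne by auto
  qed
  then have "v \<bullet> v > 0" by simp
  then have "0 < (\<alpha> \<bullet> \<alpha>) * B - c * c" using B zero_less_mult_pos unfolding vv by blast
  then show ?thesis by (simp add: B_def c_def)
qed

lemma root_difference:
  assumes a: "\<alpha> \<in> \<Phi>" and b: "\<beta> \<in> \<Phi>" and ab: "\<alpha> \<bullet> \<beta> > 0" "\<alpha> \<noteq> \<beta>"
  shows "\<alpha> - \<beta> \<in> \<Phi>"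
proof -
  define A B c where "A = \<alpha> \<bullet> \<alpha>" and "B = \<beta> \<bullet> \<beta>" and "c = \<alpha> \<bullet> \<beta>"
  have pos: "A > 0" "B > 0" using root_nz[OF a] root_nz[OF b] by (auto simp: A_def B_def)
  have "\<alpha> \<noteq> - \<beta>"
  proof
    assume "\<alpha> = - \<beta>"
    then have "\<alpha> \<bullet> \<beta> = - (\<beta> \<bullet> \<beta>)" by simp
    then show False using ab(1) inner_ge_zero[of \<beta>] by linarith
  qed
  then have less: "c * c < A * B"
    using root_cauchy_schwarz[OF a b ab(2)] by (simp add: A_def B_def c_def)
  obtain m n where m: "2 * c / A = of_int m" and n: "2 * c / B = of_int n"
    using integral[OF a b] integral[OF b a] by (auto simp: Ints_def A_def B_def c_def inner_commute)
  have mn: "m > 0" "n > 0"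
    using pos ab m n by (metis c_def divide_pos_pos mult_pos_pos of_int_0_less_iff zero_less_numeral)+
  have "of_int m * of_int n = (4 * (c * c) / (A * B) :: real)"
    by (simp flip: m n)
  also have "\<dots> < 4" using less pos by (simp add: divide_less_eq)
  finally have "real_of_int (m * n) < real_of_int 4" by simp
  then have "m * n < 4" by (simp only: of_int_less_iff)
  \<comment> \<open>The Cartan integers are positive and their product is less than \<open>4\<close>, so one of them is \<open>1\<close>.\<close>
  moreover have "m * n \<ge> 2 * 2" if "m \<noteq> 1" "n \<noteq> 1"
    by (rule mult_mono) (use that mn in auto)
  ultimately have "m = 1 \<or> n = 1" by auto
  then show ?thesis
  proof
    assume "m = 1"
    moreover have "reflection \<alpha> \<beta> = \<beta> - (2 * c / A) *\<^sub>R \<alpha>"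
      by (simp add: reflection_def A_def c_def inner_commute)
    ultimately have "reflection \<alpha> \<beta> = \<beta> - \<alpha>" by (simp add: m)
    then show ?thesis using reflection_root[OF a b] uminus_root[of "\<alpha> - \<beta>"] by simp
  next
    assume "n = 1"
    moreover have "reflection \<beta> \<alpha> = \<alpha> - (2 * c / B) *\<^sub>R \<beta>"
      by (simp add: reflection_def B_def c_def inner_commute)
    ultimately have "reflection \<beta> \<alpha> = \<alpha> - \<beta>" by (simp add: n)
    then show ?thesis using reflection_root[OF b a] by simp
  qed
qed

lemma simple_obtuse:
  assumes d: "\<delta> \<in> \<Delta>" "\<delta>' \<in> \<Delta>" "\<delta> \<noteq> \<delta>'"
  shows "\<delta> \<bullet> \<delta>' \<le> 0"
proof (rule ccontr)
  assume "\<not> \<delta> \<bullet> \<delta>' \<le> 0"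
  then have r: "\<delta> - \<delta>' \<in> \<Phi>" using root_difference[of \<delta> \<delta>'] d \<Delta>_P P_root by simp
  show False
  proof (cases "\<delta> - \<delta>' \<in> P")
    case True
    then have "\<exists>\<beta>\<in>P. \<exists>\<gamma>\<in>P. \<delta> = \<beta> + \<gamma>"
      using d \<Delta>_P by (intro bexI[of _ \<delta>'] bexI[of _ "\<delta> - \<delta>'"]) auto
    then show False using d by (simp add: simple_roots_def)
  next
    case False
    then have "\<delta>' - \<delta> \<in> P" using uminus_P[OF r] by simp
    then have "\<exists>\<beta>\<in>P. \<exists>\<gamma>\<in>P. \<delta>' = \<beta> + \<gamma>"
      using d \<Delta>_P by (intro bexI[of _ \<delta>] bexI[of _ "\<delta>' - \<delta>"]) auto
    then show False using d by (simp add: simple_roots_def)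
  qed
qed

text \<open>The common value \<open>v\<close> of both sides has \<open>v \<bullet> v \<le> 0\<close> because distinct
  simple roots form obtuse angles. So \<open>v = 0\<close>, which is impossible for a nonempty sum of
  vectors in an open half space.\<close>

lemma obtuse_half_space_vanish:
  assumes "A \<subseteq> \<Delta>" "B \<subseteq> \<Delta>" "A \<inter> B = {}" and "\<And>x. x \<in> A \<Longrightarrow> f x > (0::real)" "\<And>x. x \<in> B \<Longrightarrow> g x > 0"
    and eq: "(\<Sum>x\<in>A. f x *\<^sub>R x) = (\<Sum>x\<in>B. g x *\<^sub>R x)"
  shows "A = {}"
proof (rule ccontr)
  define v where "v = (\<Sum>x\<in>A. f x *\<^sub>R x)"
  have fin: "finite A" "finite B" using assms(1,2) finite_\<Delta> finite_subset by auto
  have "v \<bullet> v = (\<Sum>x\<in>A. f x *\<^sub>R x) \<bullet> (\<Sum>y\<in>B. g y *\<^sub>R y)"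
    unfolding v_def by (simp only: eq)
  also have "\<dots> = (\<Sum>x\<in>A. \<Sum>y\<in>B. f x * (g y * (x \<bullet> y)))"
    by (simp only: inner_sum_left inner_sum_right inner_scaleR_left inner_scaleR_right sum_distrib_left,
        subst sum.swap) (simp add: ac_simps)
  also have "\<dots> \<le> 0"
  proof (intro sum_nonpos)
    fix x y assume x: "x \<in> A" and y: "y \<in> B"
    then have "x \<bullet> y \<le> 0" using assms(1,2,3) by (intro simple_obtuse) auto
    then show "f x * (g y * (x \<bullet> y)) \<le> 0"
      using assms(4)[OF x] assms(5)[OF y] by (simp add: mult_le_0_iff)
  qed
  finally have "v = 0" by (metis inner_eq_zero_iff inner_ge_zero order_antisym)
  assume "A \<noteq> {}"
  then have "(\<Sum>x\<in>A. f x * (pv \<bullet> x)) > 0"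
    using fin assms by (intro sum_pos mult_pos_pos P_pos \<Delta>_P) auto
  also have "(\<Sum>x\<in>A. f x * (pv \<bullet> x)) = pv \<bullet> v"
    by (simp add: v_def inner_sum_right)
  finally show False using \<open>v = 0\<close> by simp
qed

lemma independent_\<Delta>: "independent \<Delta>"
proof
  assume "dependent \<Delta>"
  then obtain u where u: "\<exists>v\<in>\<Delta>. u v \<noteq> 0" "(\<Sum>v\<in>\<Delta>. u v *\<^sub>R v) = 0"
    using real_vector.dependent_finite[OF finite_\<Delta>] by auto
  define A B where "A = {v\<in>\<Delta>. u v > 0}" and "B = {v\<in>\<Delta>. u v < 0}"
  have "(\<Sum>v\<in>\<Delta>. u v *\<^sub>R v) = (\<Sum>v\<in>A \<union> B. u v *\<^sub>R v)"
    using finite_\<Delta> by (intro sum.mono_neutral_right) (auto simp: A_def B_def)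
  also have "\<dots> = (\<Sum>v\<in>A. u v *\<^sub>R v) + (\<Sum>v\<in>B. u v *\<^sub>R v)"
    using finite_\<Delta> by (intro sum.union_disjoint) (auto simp: A_def B_def)
  finally have eq: "(\<Sum>v\<in>A. u v *\<^sub>R v) = (\<Sum>v\<in>B. (- u v) *\<^sub>R v)"
    using u(2) by (simp add: sum_negf eq_neg_iff_add_eq_0)
  have "A = {}"
    by (rule obtuse_half_space_vanish[OF _ _ _ _ _ eq]) (auto simp: A_def B_def)
  moreover have "B = {}"
    by (rule obtuse_half_space_vanish[OF _ _ _ _ _ eq[symmetric]]) (auto simp: A_def B_def)
  ultimately show False using u(1) by (auto simp: A_def B_def) (metis less_linear)
qed

abbreviation rep :: "'a \<Rightarrow> 'a \<Rightarrow> real" where "rep \<equiv> representation \<Delta>"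

lemma P_span: "\<alpha> \<in> P \<Longrightarrow> \<alpha> \<in> span \<Delta>"
  by (induction \<alpha> rule: positive_root_induct) (auto intro: span_base span_add)

lemma root_span: "\<alpha> \<in> \<Phi> \<Longrightarrow> \<alpha> \<in> span \<Delta>"
  using P_span[of \<alpha>] P_span[of "-\<alpha>"] uminus_P[of \<alpha>] span_neg[of "-\<alpha>"] by fastforce

lemmas rep_add = real_vector.representation_add[OF independent_\<Delta>]
lemmas rep_scale = real_vector.representation_scale[OF independent_\<Delta>]
lemmas rep_neg = real_vector.representation_neg[OF independent_\<Delta>]
lemmas rep_basis = real_vector.representation_basis[OF independent_\<Delta>]

lemma rep_nonneg: "\<alpha> \<in> P \<Longrightarrow> rep \<alpha> \<delta> \<ge> 0"
  by (induction \<alpha> rule: positive_root_induct) (auto simp: rep_add P_span rep_basis)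

lemma rep_sum: "\<alpha> \<in> \<Phi> \<Longrightarrow> (\<Sum>\<delta>\<in>\<Delta>. rep \<alpha> \<delta> *\<^sub>R \<delta>) = \<alpha>"
  using real_vector.sum_representation_eq[OF independent_\<Delta> root_span finite_\<Delta>] by simp

text \<open>The coefficients of a root with respect to the simple roots all have the same sign.\<close>

lemma positive_if_coefficient:
  assumes "\<alpha> \<in> \<Phi>" "rep \<alpha> \<delta> > 0"
  shows "\<alpha> \<in> P"
proof (rule ccontr)
  assume "\<alpha> \<notin> P"
  then have "- \<alpha> \<in> P" using uminus_P assms by simp
  from rep_nonneg[OF this, of \<delta>] show False
    using assms root_span by (simp add: rep_neg)
qed

text \<open>The reflection in \<open>\<delta>\<close> changes only the coefficient of \<open>\<delta>\<close>, and a
  positive root other than \<open>\<delta>\<close> has some other positive coefficient.\<close>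

lemma simple_reflection_permutes:
  assumes d: "\<delta> \<in> \<Delta>" and a: "\<alpha> \<in> P" "\<alpha> \<noteq> \<delta>"
  shows "reflection \<delta> \<alpha> \<in> P"
proof -
  have "\<exists>\<delta>'\<in>\<Delta>. \<delta>' \<noteq> \<delta> \<and> rep \<alpha> \<delta>' \<noteq> 0"
  proof (rule ccontr)
    assume "\<not> ?thesis"
    then have "(\<Sum>\<delta>'\<in>\<Delta>. rep \<alpha> \<delta>' *\<^sub>R \<delta>') = (\<Sum>\<delta>'\<in>{\<delta>}. rep \<alpha> \<delta>' *\<^sub>R \<delta>')"
      using finite_\<Delta> d by (intro sum.mono_neutral_right) auto
    then have "\<alpha> = rep \<alpha> \<delta> *\<^sub>R \<delta>" using rep_sum a P_root by simp
    then show False using reduced_pos[of \<delta> "rep \<alpha> \<delta>"] a d \<Delta>_P by simp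
  qed
  then obtain \<delta>' where d': "\<delta>' \<in> \<Delta>" "\<delta>' \<noteq> \<delta>" "rep \<alpha> \<delta>' > 0"
    using rep_nonneg[OF a(1)] by (metis order_le_less)
  define c where "c = 2 * (\<alpha> \<bullet> \<delta>) / (\<delta> \<bullet> \<delta>)"
  have "rep (reflection \<delta> \<alpha>) = rep (\<alpha> + (- c) *\<^sub>R \<delta>)"
    by (simp add: reflection_def c_def)
  also have "\<dots> = (\<lambda>b. rep \<alpha> b + (- c) * rep \<delta> b)"
    using a P_span span_scale[OF P_span[OF \<Delta>_P[OF d]], of "-c"] P_span[OF \<Delta>_P[OF d]]
    by (simp only: rep_add rep_scale)
  finally have "rep (reflection \<delta> \<alpha>) \<delta>' > 0" using d' d by (simp add: rep_basis)
  then show "reflection \<delta> \<alpha> \<in> P"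
    using positive_if_coefficient reflection_root d a \<Delta>_P P_root by blast
qed

lemma simple_reflection_positive_iff:
  assumes d: "\<delta> \<in> \<Delta>" and a: "\<alpha> \<in> \<Phi>"
  shows "reflection \<delta> \<alpha> \<in> P \<longleftrightarrow> (\<alpha> \<in> P \<and> \<alpha> \<noteq> \<delta>) \<or> \<alpha> = - \<delta>"
proof (cases "\<alpha> \<in> P")
  case True
  then show ?thesis
    using simple_reflection_permutes[OF d True] d \<Delta>_P P_not_neg[of \<delta>] P_not_neg[of \<alpha>] 
    by (cases "\<alpha> = \<delta>") (auto simp: reflection_self)
next
  case False
  then have "-\<alpha> \<in> P" using uminus_P a by simp
  then show ?thesis
    using simple_reflection_permutes[OF d, of "-\<alpha>"] False d \<Delta>_P P_not_neg[of "reflection \<delta> \<alpha>"]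
    by (cases "-\<alpha> = \<delta>") (auto simp: reflection_self reflection_minus reflection_uminus)
qed

subsection \<open>Heights\<close>

lemma height_add: "\<alpha> \<in> span \<Delta> \<Longrightarrow> \<beta> \<in> span \<Delta> \<Longrightarrow> height P (\<alpha> + \<beta>) = height P \<alpha> + height P \<beta>"
  by (simp add: height_def rep_add sum.distrib)

lemma height_scale: "\<alpha> \<in> span \<Delta> \<Longrightarrow> height P (c *\<^sub>R \<alpha>) = c * height P \<alpha>"
  by (simp add: height_def rep_scale sum_distrib_left)

lemma height_simple: "\<delta> \<in> \<Delta> \<Longrightarrow> height P \<delta> = 1"
  using finite_\<Delta> by (simp add: height_def rep_basis sum.delta if_distrib cong: if_cong)

lemma height_ge_1: "\<alpha> \<in> P \<Longrightarrow> height P \<alpha> \<ge> 1"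
  by (induction \<alpha> rule: positive_root_induct) (auto simp: height_simple height_add P_span)

text \<open>Induction on the height: a positive root that is not simple has positive inner product with some simple root
  \<open>\<delta>\<close>, and reflecting in \<open>\<delta>\<close> lowers its height by a positive
  integer.\<close>

lemma root_height_induct [consumes 1, case_names simple reflect]:
  assumes "\<alpha> \<in> P"
    and simple: "\<And>\<delta>. \<delta> \<in> \<Delta> \<Longrightarrow> Q \<delta>"
    and refl: "\<And>\<beta> \<delta>. \<beta> \<in> P \<Longrightarrow> \<delta> \<in> \<Delta> \<Longrightarrow> reflection \<delta> \<beta> \<in> P \<Longrightarrow>
        height P \<beta> + 1 \<le> height P (reflection \<delta> \<beta>) \<Longrightarrow> Q \<beta> \<Longrightarrow> Q (reflection \<delta> \<beta>)"
  shows "Q \<alpha>"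
  using assms(1)
proof (induction "card {\<beta> \<in> P. height P \<beta> < height P \<alpha>}" arbitrary: \<alpha> rule: less_induct)
  case less
  show ?case
  proof (cases "\<alpha> \<in> \<Delta>")
    case True
    then show ?thesis by (rule simple)
  next
    case False
    have "\<exists>\<delta>\<in>\<Delta>. \<alpha> \<bullet> \<delta> > 0"
    proof (rule ccontr)
      assume *: "\<not> ?thesis"
      have "\<alpha> \<bullet> \<alpha> = (\<Sum>\<delta>\<in>\<Delta>. rep \<alpha> \<delta> * (\<alpha> \<bullet> \<delta>))"
        by (subst (2) rep_sum[symmetric]) (use less.prems P_root in \<open>auto simp: inner_sum_right\<close>)
      also have "\<dots> \<le> 0"
        using * rep_nonneg[OF less.prems] by (intro sum_nonpos) (auto simp: mult_le_0_iff not_less)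
      finally have "\<alpha> = 0" by (metis inner_eq_zero_iff inner_ge_zero order_antisym)
      then show False using root_nz[OF P_root[OF less.prems]] by simp
    qed
    then obtain \<delta> where d: "\<delta> \<in> \<Delta>" "\<alpha> \<bullet> \<delta> > 0" by auto
    define n where "n = 2 * (\<alpha> \<bullet> \<delta>) / (\<delta> \<bullet> \<delta>)"
    have dP: "\<delta> \<in> P" "\<delta> \<in> \<Phi>" using d \<Delta>_P P_root by auto
    have "n \<in> \<int>" unfolding n_def using integral dP P_root less.prems by blast
    moreover have "n > 0" using d root_nz[OF dP(2)] by (simp add: n_def)
    ultimately have n: "n \<ge> 1" by (auto simp: Ints_def)
    define \<beta> where "\<beta> = reflection \<delta> \<alpha>"
    have ba: "reflection \<delta> \<beta> = \<alpha>" by (simp add: \<beta>_def reflection_involution)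
    have b: "\<beta> \<in> P" using simple_reflection_permutes[OF d(1) less.prems] False d by (auto simp: \<beta>_def)
    have "\<beta> = \<alpha> + (- n) *\<^sub>R \<delta>" by (simp add: \<beta>_def reflection_def n_def)
    then have hb: "height P \<beta> = height P \<alpha> - n"
      using height_add[OF P_span[OF less.prems] span_scale[OF P_span[OF dP(1)], of "-n"]]
        height_scale[OF P_span[OF dP(1)], of "-n"] height_simple[OF d(1)] by simp
    have lt: "height P \<beta> < height P \<alpha>" using hb n by simp
    have "card {\<gamma> \<in> P. height P \<gamma> < height P \<beta>} < card {\<gamma> \<in> P. height P \<gamma> < height P \<alpha>}"
      by (rule psubset_card_mono) (use finite_P b lt in auto)
    then have "Q \<beta>" using less.hyps b by blast
    then show ?thesis using refl[OF b d(1)] less.prems hb n by (simp add: ba)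
  qed
qed

end

section \<open>The Weyl group and its length function\<close>

fun word_map :: "('a \<Rightarrow> 'a) list \<Rightarrow> 'a \<Rightarrow> 'a" where
  "word_map [] = id"
| "word_map (t # ts) = t \<circ> word_map ts"

lemma foldr_word_map: "foldr (\<circ>) ts id = word_map ts"
proof (induction ts)
  case (Cons t ts)
  then show ?case by (simp only: foldr.simps o_apply word_map.simps)
qed (simp only: foldr.simps word_map.simps id_apply)

abbreviation winv :: "('a \<Rightarrow> 'a) \<Rightarrow> 'a \<Rightarrow> 'a" where
  "winv \<equiv> inv_into UNIV"

lemma word_map_append: "word_map (ts @ us) = word_map ts \<circ> word_map us"
  by (induction ts) auto

lemma bij_word_map: "set ts \<subseteq> reflection ` X \<Longrightarrow> bij (word_map ts)"
  by (induction ts) (auto intro!: bij_comp bij_reflection)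

lemma Bij_UNIV: "Bij UNIV = {f. bij f}"
  by (auto simp: Bij_def extensional_def)

lemma mult_BijGroup_UNIV: "bij f \<Longrightarrow> bij g \<Longrightarrow> f \<otimes>\<^bsub>BijGroup UNIV\<^esub> g = f \<circ> g"
  by (auto simp: BijGroup_def Bij_UNIV compose_def fun_eq_iff)

lemma one_BijGroup_UNIV: "\<one>\<^bsub>BijGroup UNIV\<^esub> = id"
  by (auto simp: BijGroup_def)

lemma step_back: "reflection \<alpha> \<circ> (reflection \<alpha> \<circ> w) = w"
  by (rule ext) (simp add: reflection_involution)

lemma generate_reflections:
  "generate (BijGroup UNIV) (reflection ` X) = {word_map ts |ts. set ts \<subseteq> reflection ` X}"
proof (intro subset_antisym subsetI)
  fix h assume "h \<in> generate (BijGroup UNIV) (reflection ` X)"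
  then have "\<exists>ts. set ts \<subseteq> reflection ` X \<and> h = word_map ts"
  proof (induction rule: generate.induct)
    case one
    then show ?case by (intro exI[of _ "[]"]) (simp add: one_BijGroup_UNIV)
  next
    case (incl h)
    then show ?case by (intro exI[of _ "[h]"]) simp
  next
    case (inv h)
    then obtain x where "x \<in> X" "h = reflection x" by auto
    with inv show ?case
      by (intro exI[of _ "[h]"]) (simp add: inv_BijGroup Bij_UNIV bij_reflection inv_reflection)
  next
    case (eng h1 h2)
    then obtain ts us where "set ts \<subseteq> reflection ` X" "h1 = word_map ts" "set us \<subseteq> reflection ` X" "h2 = word_map us"
      by auto
    then show ?case
      by (intro exI[of _ "ts @ us"]) (simp add: mult_BijGroup_UNIV bij_word_map word_map_append)
  qed
  then show "h \<in> {word_map ts |ts. set ts \<subseteq> reflection ` X}" by auto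
next
  fix h assume "h \<in> {word_map ts |ts. set ts \<subseteq> reflection ` X}"
  then obtain ts where ts: "set ts \<subseteq> reflection ` X" "h = word_map ts" by auto
  have "word_map ts \<in> generate (BijGroup UNIV) (reflection ` X)"
    using ts(1)
  proof (induction ts)
    case Nil
    then show ?case using generate.one[of "BijGroup UNIV" "reflection ` X"] unfolding one_BijGroup_UNIV word_map.simps by blast
  next
    case (Cons t ts)
    then have t: "t \<in> reflection ` X" and ts: "set ts \<subseteq> reflection ` X" by auto
    have "t \<otimes>\<^bsub>BijGroup UNIV\<^esub> word_map ts \<in> generate (BijGroup UNIV) (reflection ` X)"
      by (rule generate.eng[OF generate.incl[OF t] Cons.IH[OF ts]])
    moreover have "bij t" using t bij_reflection by auto
    ultimately show ?case
      by (simp only: mult_BijGroup_UNIV bij_word_map[OF ts] word_map.simps)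
  qed
  then show "h \<in> generate (BijGroup UNIV) (reflection ` X)" using ts by simp
qed

context positive_roots
begin

lemma W_eq: "W = {word_map ts |ts. set ts \<subseteq> reflection ` \<Phi>}"
  unfolding weyl_group_def by (rule generate_reflections)

lemma W_id: "id \<in> W"
  unfolding W_eq by (intro CollectI exI[of _ "[]"]) simp

lemma W_comp: "v \<in> W \<Longrightarrow> w \<in> W \<Longrightarrow> v \<circ> w \<in> W"
  unfolding W_eq by (auto simp flip: word_map_append) (metis le_sup_iff set_append)

lemma W_reflection: "\<alpha> \<in> \<Phi> \<Longrightarrow> reflection \<alpha> \<in> W"
  unfolding W_eq by (intro CollectI exI[of _ "[reflection \<alpha>]"]) simp

lemma W_step: "\<alpha> \<in> \<Phi> \<Longrightarrow> w \<in> W \<Longrightarrow> reflection \<alpha> \<circ> w \<in> W"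
  by (intro W_comp W_reflection)

lemma W_induct [consumes 1, case_names id step]:
  assumes "w \<in> W" and "Q id" and "\<And>\<alpha> w. \<alpha> \<in> \<Phi> \<Longrightarrow> w \<in> W \<Longrightarrow> Q w \<Longrightarrow> Q (reflection \<alpha> \<circ> w)"
  shows "Q w"
proof -
  obtain ts where ts: "set ts \<subseteq> reflection ` \<Phi>" "w = word_map ts" using assms(1) W_eq by auto
  have "word_map ts \<in> W \<and> Q (word_map ts)"
    using ts(1) by (induction ts) (use assms(2,3) W_id W_step in auto)
  then show ?thesis using ts by simp
qed

lemma W_linear: "w \<in> W \<Longrightarrow> linear w"
  by (erule W_induct, rule linear_id, rule linear_compose, assumption, rule linear_reflection)

lemma W_inner: "w \<in> W \<Longrightarrow> w x \<bullet> w y = x \<bullet> y"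
  by (erule W_induct) (auto simp: reflection_inner)

lemma W_bij: "w \<in> W \<Longrightarrow> bij w"
  by (erule W_induct, rule bij_id, rule bij_comp, assumption, rule bij_reflection)

lemma W_root: "w \<in> W \<Longrightarrow> \<alpha> \<in> \<Phi> \<Longrightarrow> w \<alpha> \<in> \<Phi>"
  by (erule W_induct) (auto intro: reflection_root)

lemma winv_left: "w \<in> W \<Longrightarrow> winv w (w x) = x"
  by (rule inv_f_f[OF bij_is_inj[OF W_bij]])

lemma winv_right: "w \<in> W \<Longrightarrow> w (winv w x) = x"
  by (rule surj_f_inv_f[OF bij_is_surj[OF W_bij]])

lemma winv_comp: "v \<in> W \<Longrightarrow> w \<in> W \<Longrightarrow> winv (v \<circ> w) = winv w \<circ> winv v"
  by (rule o_inv_distrib) (use W_bij in auto)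

lemma W_winv: "w \<in> W \<Longrightarrow> winv w \<in> W"
proof (erule W_induct)
  show "winv id \<in> W" by (simp only: inv_id W_id)
  show "winv (reflection \<alpha> \<circ> v) \<in> W" if "\<alpha> \<in> \<Phi>" "v \<in> W" "winv v \<in> W" for \<alpha> v
    using that by (simp only: winv_comp W_reflection inv_reflection W_comp)
qed

lemma winv_step: "\<alpha> \<in> \<Phi> \<Longrightarrow> w \<in> W \<Longrightarrow> winv (reflection \<alpha> \<circ> w) x = winv w (reflection \<alpha> x)"
  by (simp add: winv_comp W_reflection inv_reflection)

lemma W_neg: "w \<in> W \<Longrightarrow> w (- x) = - w x"
  by (rule linear_neg[OF W_linear])

lemma W_add: "w \<in> W \<Longrightarrow> w (x + y) = w x + w y"
  by (rule linear_add[OF W_linear])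

lemma W_scale: "w \<in> W \<Longrightarrow> w (c *\<^sub>R x) = c *\<^sub>R w x"
  by (rule linear_scale[OF W_linear])

lemma W_conj: "w \<in> W \<Longrightarrow> w (reflection \<alpha> x) = reflection (w \<alpha>) (w x)"
  by (rule isometry_reflection) (auto simp: W_linear W_inner)

lemma W_comp_reflection: "w \<in> W \<Longrightarrow> w \<circ> reflection \<alpha> = reflection (w \<alpha>) \<circ> w"
  by (auto simp: W_conj)

lemma winv_conj: "w \<in> W \<Longrightarrow> winv w (reflection (w \<alpha>) x) = reflection \<alpha> (winv w x)"
  by (simp only: W_conj[OF W_winv] winv_left)

lemma word_map_W: "set ts \<subseteq> reflection ` \<Delta> \<Longrightarrow> word_map ts \<in> W"
  using \<Delta>_P P_root unfolding W_eq by blast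

text \<open>A positive root that is not simple is conjugated to one of smaller height by a simple reflection. This
  conjugation costs two letters and the height drops by at least \<open>1\<close>.\<close>

lemma reflection_word:
  "\<alpha> \<in> P \<Longrightarrow> \<exists>ts. set ts \<subseteq> reflection ` \<Delta> \<and> word_map ts = reflection \<alpha> \<and> real (length ts) \<le> 2 * height P \<alpha> - 1"
proof (induction \<alpha> rule: root_height_induct)
  case (simple \<delta>)
  then show ?case by (intro exI[of _ "[reflection \<delta>]"]) (auto simp: height_simple)
next
  case (reflect \<beta> \<delta>)
  then obtain ts where ts: "set ts \<subseteq> reflection ` \<Delta>" "word_map ts = reflection \<beta>" "real (length ts) \<le> 2 * height P \<beta> - 1"
    by auto
  have "word_map (reflection \<delta> # ts @ [reflection \<delta>]) = reflection (reflection \<delta> \<beta>)"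
    using reflection_conjugate[of \<delta> \<beta>] ts(2) word_map_append[of ts "[reflection \<delta>]"] by (simp add: comp_assoc)
  then show ?case
    using ts reflect by (intro exI[of _ "reflection \<delta> # ts @ [reflection \<delta>]"]) auto
qed

lemma reflections_eq: "reflections \<Phi> P = reflection ` P"
proof (intro subset_antisym subsetI)
  fix t assume "t \<in> reflections \<Phi> P"
  then obtain w \<delta> where w: "w \<in> W" "\<delta> \<in> \<Delta>" "t = w \<circ> reflection \<delta> \<circ> winv w"
    by (auto simp: reflections_def simple_reflections_def)
  have t: "t = reflection (w \<delta>)"
    using w by (auto simp: W_conj winv_right)
  have "w \<delta> \<in> P \<or> - w \<delta> \<in> P"
    using uminus_P[OF W_root[OF w(1) P_root[OF \<Delta>_P[OF w(2)]]]] by blast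
  then show "t \<in> reflection ` P"
    using t reflection_uminus[of "w \<delta>"] by (metis imageI)
next
  have "\<exists>w\<in>W. \<exists>\<delta>\<in>\<Delta>. \<alpha> = w \<delta>" if "\<alpha> \<in> P" for \<alpha> :: 'a
    using that
  proof (induction \<alpha> rule: root_height_induct)
    case (simple \<delta>)
    then show ?case using W_id by (intro bexI[of _ id] bexI[of _ \<delta>]) auto
  next
    case (reflect \<beta> \<delta>)
    then obtain w \<delta>' where w: "w \<in> W" "\<delta>' \<in> \<Delta>" "\<beta> = w \<delta>'" by auto
    then show ?case
      using reflect \<Delta>_P P_root W_step by (intro bexI[of _ "reflection \<delta> \<circ> w"] bexI[of _ \<delta>']) auto
  qed
  moreover fix t assume "t \<in> reflection ` P"
  ultimately obtain w \<delta> where w: "w \<in> W" "\<delta> \<in> \<Delta>" "t = reflection (w \<delta>)" by fast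
  then have "t = w \<circ> reflection \<delta> \<circ> winv w"
    by (auto simp: W_conj winv_right)
  then show "t \<in> reflections \<Phi> P"
    using w by (auto simp: reflections_def simple_reflections_def)
qed

lemma W_word:
  assumes "w \<in> W" shows "\<exists>ts. set ts \<subseteq> reflection ` \<Delta> \<and> word_map ts = w"
  using assms
proof (induction w rule: W_induct)
  case id
  then show ?case by (intro exI[of _ "[]"]) auto
next
  case (step \<alpha> w)
  define \<beta> where "\<beta> = (if \<alpha> \<in> P then \<alpha> else - \<alpha>)"
  have "\<beta> \<in> P" "reflection \<beta> = reflection \<alpha>"
    using step uminus_P by (auto simp: \<beta>_def reflection_uminus)
  then obtain us where "set us \<subseteq> reflection ` \<Delta>" "word_map us = reflection \<alpha>"
    using reflection_word[of \<beta>] by auto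
  moreover obtain ts where "set ts \<subseteq> reflection ` \<Delta>" "word_map ts = w" using step by auto
  ultimately show ?case by (intro exI[of _ "us @ ts"]) (simp add: word_map_append)
qed

lemma len_le: "set ts \<subseteq> reflection ` \<Delta> \<Longrightarrow> word_map ts = w \<Longrightarrow> len P w \<le> length ts"
  unfolding len_def foldr_word_map simple_reflections_def by (rule Least_le) auto

lemma len_word:
  assumes "w \<in> W"
  obtains ts where "set ts \<subseteq> reflection ` \<Delta>" "word_map ts = w" "length ts = len P w"
proof -
  obtain ts where ts: "set ts \<subseteq> reflection ` \<Delta>" "word_map ts = w" using W_word[OF assms] by auto
  have "\<exists>ss. set ss \<subseteq> simple_reflections P \<and> length ss = len P w \<and> word_map ss = w"
    unfolding len_def foldr_word_map by (rule LeastI) (use ts in \<open>auto simp: simple_reflections_def\<close>)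
  then show ?thesis using that by (auto simp: simple_reflections_def)
qed

lemma len_comp:
  assumes "v \<in> W" "w \<in> W"
  shows "len P (v \<circ> w) \<le> len P v + len P w"
proof -
  obtain ts us where "set ts \<subseteq> reflection ` \<Delta>" "word_map ts = v" "length ts = len P v"
    "set us \<subseteq> reflection ` \<Delta>" "word_map us = w" "length us = len P w"
    using len_word[OF assms(1)] len_word[OF assms(2)] by metis
  then show ?thesis using len_le[of "ts @ us" "v \<circ> w"] by (simp add: word_map_append)
qed

lemma len_reflection: "\<alpha> \<in> P \<Longrightarrow> real (len P (reflection \<alpha>)) \<le> 2 * height P \<alpha> - 1"
  using reflection_word[of \<alpha>] len_le by (metis of_nat_le_iff order_trans)

text \<open>While the letters of the word act on \<open>\<alpha>\<close> one after the other, it becomes negative at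
  some letter. Immediately before, it is the simple root of that letter, and deleting the letter gives
  \<open>\<tau>\<^sub>\<alpha> w\<close>.\<close>

lemma exchange:
  assumes "set ts \<subseteq> reflection ` \<Delta>" "\<alpha> \<in> P" "winv (word_map ts) \<alpha> \<notin> P"
  shows "\<exists>us. set us \<subseteq> reflection ` \<Delta> \<and> word_map us = reflection \<alpha> \<circ> word_map ts \<and> length us < length ts"
  using assms
proof (induction ts arbitrary: \<alpha>)
  case Nil
  then show ?case by (simp add: inv_id)
next
  case (Cons t ts)
  then obtain \<delta> where d: "\<delta> \<in> \<Delta>" "t = reflection \<delta>" and ts: "set ts \<subseteq> reflection ` \<Delta>" by auto
  show ?case
  proof (cases "\<alpha> = \<delta>")
    case True
    then show ?thesis using ts d by (intro exI[of _ ts]) (auto simp: reflection_involution)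
  next
    case False
    have "reflection \<delta> \<alpha> \<in> P" using simple_reflection_permutes d Cons.prems(2) False by blast
    moreover have "winv (word_map ts) (reflection \<delta> \<alpha>) \<notin> P"
      using Cons.prems(3) unfolding d word_map.simps winv_step[OF P_root[OF \<Delta>_P[OF d(1)]] word_map_W[OF ts]] .
    ultimately obtain us where us: "set us \<subseteq> reflection ` \<Delta>" "length us < length ts"
      "word_map us = reflection (reflection \<delta> \<alpha>) \<circ> word_map ts"
      using Cons.IH[OF ts] by meson
    have "reflection \<delta> (reflection (reflection \<delta> \<alpha>) x) = reflection \<alpha> (reflection \<delta> x)" for x
      using reflection_reflection[of \<delta> "reflection \<delta> \<alpha>" x] by (simp add: reflection_involution)
    then have "word_map (t # us) = reflection \<alpha> \<circ> word_map (t # ts)"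
      using us(3) by (auto simp: d)
    then show ?thesis using us d by (intro exI[of _ "t # us"]) auto
  qed
qed

lemma len_descent:
  assumes "w \<in> W" "\<alpha> \<in> P" "winv w \<alpha> \<notin> P"
  shows "len P (reflection \<alpha> \<circ> w) < len P w"
proof -
  obtain ts where ts: "set ts \<subseteq> reflection ` \<Delta>" "word_map ts = w" "length ts = len P w"
    using len_word[OF assms(1)] .
  have "winv (word_map ts) \<alpha> \<notin> P" unfolding ts(2) by (rule assms(3))
  from exchange[OF ts(1) assms(2) this] obtain us where us: "set us \<subseteq> reflection ` \<Delta>"
    "word_map us = reflection \<alpha> \<circ> w" "length us < length ts"
    unfolding ts(2) by blast
  from len_le[OF us(1,2)] us(3) show ?thesis unfolding ts(3) by linarith
qed

lemma len_ascent:
  assumes "w \<in> W" "\<alpha> \<in> P" "winv w \<alpha> \<in> P"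
  shows "len P w < len P (reflection \<alpha> \<circ> w)"
proof -
  have a: "\<alpha> \<in> \<Phi>" using assms P_root by blast
  have "winv (reflection \<alpha> \<circ> w) \<alpha> \<notin> P"
    using assms a P_not_neg[of "winv w \<alpha>"] W_neg[OF W_winv, of w \<alpha>]
    by (simp add: winv_step reflection_self)
  from len_descent[OF W_step[OF a assms(1)] assms(2) this]
  show ?thesis by (simp add: step_back)
qed

text \<open>Otherwise the first letter of a shortest word of \<open>w\<close> is a simple reflection that makes
  \<open>w\<close> shorter, so that \<open>w\<^sup>-\<^sup>1\<close> inverts its root.\<close>

lemma W_eq_id:
  assumes w: "w \<in> W" and pos: "\<And>\<alpha>. \<alpha> \<in> P \<Longrightarrow> winv w \<alpha> \<in> P"
  shows "w = id"
proof -
  obtain ts where ts: "set ts \<subseteq> reflection ` \<Delta>" "word_map ts = w" "length ts = len P w"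
    using len_word[OF w] .
  show ?thesis
  proof (cases ts)
    case (Cons t us)
    then obtain \<delta> where d: "\<delta> \<in> \<Delta>" "t = reflection \<delta>" using ts by auto
    have "reflection \<delta> \<circ> w = word_map us"
      using ts(2) Cons d by (auto simp: reflection_involution)
    then have "len P (reflection \<delta> \<circ> w) < len P w"
      using len_le[of us] ts Cons by auto
    moreover have "len P w < len P (reflection \<delta> \<circ> w)"
      using len_ascent[OF w] pos d \<Delta>_P by blast
    ultimately show ?thesis by simp
  qed (use ts in simp)
qed

subsection \<open>Edges of the digraph\<close>

text \<open>The height of the root of a downward step, and \<open>0\<close> for an upward one. With it both kinds of
  edges obey the same formula, and the bound below is what makes an edge an extremal step.\<close>

definition height_drop :: "('a \<Rightarrow> 'a) \<Rightarrow> 'a \<Rightarrow> real" where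
  "height_drop w \<alpha> = (if winv w \<alpha> \<in> P then 0 else height P \<alpha>)"

lemma len_step_bound:
  assumes "w \<in> W" "\<alpha> \<in> P"
  shows "real (len P (reflection \<alpha> \<circ> w)) \<ge> real (len P w) + 1 - 2 * height_drop w \<alpha>"
proof (cases "winv w \<alpha> \<in> P")
  case True
  then show ?thesis using len_ascent[OF assms True] by (simp add: height_drop_def)
next
  case False
  have a: "\<alpha> \<in> \<Phi>" using assms P_root by blast
  have "len P (reflection \<alpha> \<circ> (reflection \<alpha> \<circ> w)) \<le> len P (reflection \<alpha>) + len P (reflection \<alpha> \<circ> w)"
    using assms a by (intro len_comp W_reflection W_step)
  then have "real (len P w) \<le> real (len P (reflection \<alpha>)) + real (len P (reflection \<alpha> \<circ> w))"
    unfolding step_back by linarith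
  then show ?thesis using len_reflection[OF assms(2)] False by (simp add: height_drop_def)
qed

lemma reflection_inj: "\<alpha> \<in> P \<Longrightarrow> \<beta> \<in> P \<Longrightarrow> reflection \<alpha> = reflection \<beta> \<Longrightarrow> \<alpha> = \<beta>"
proof -
  assume a: "\<alpha> \<in> P" and b: "\<beta> \<in> P" and eq: "reflection \<alpha> = reflection \<beta>"
  define c where "c = 2 * (\<alpha> \<bullet> \<beta>) / (\<beta> \<bullet> \<beta>)"
  have "- \<alpha> = \<alpha> - c *\<^sub>R \<beta>"
    using reflection_self[of \<alpha>] unfolding eq by (simp add: reflection_def c_def)
  then have "2 *\<^sub>R \<alpha> = c *\<^sub>R \<beta>" by (simp add: scaleR_2 algebra_simps)
  then have "(1/2) *\<^sub>R (2 *\<^sub>R \<alpha>) = (1/2) *\<^sub>R (c *\<^sub>R \<beta>)" by simp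
  then have "\<alpha> = (c / 2) *\<^sub>R \<beta>" by simp
  then show "\<alpha> = \<beta>" using reduced_pos[OF b, of "c / 2"] a by simp
qed

lemma positive_root_reflection: "\<alpha> \<in> P \<Longrightarrow> positive_root P (reflection \<alpha>) = \<alpha>"
  unfolding positive_root_def by (rule the_equality) (auto intro: reflection_inj)

text \<open>For a downward step, attaining the bound forces \<open>\<ell>(\<tau>) = 2 ht \<alpha> - 1\<close>, since
  \<open>\<ell>(w) - \<ell>(\<tau> w) \<le> \<ell>(\<tau>) \<le> 2 ht \<alpha> - 1\<close>.\<close>

lemma bruhat_step_iff:
  assumes "w \<in> W" "\<alpha> \<in> P"
  shows "bruhat_step P w (reflection \<alpha>) \<longleftrightarrow>
    real (len P (reflection \<alpha> \<circ> w)) = real (len P w) + 1 - 2 * height_drop w \<alpha>"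
proof -
  have a: "\<alpha> \<in> \<Phi>" using assms P_root by blast
  show ?thesis
  proof (cases "winv w \<alpha> \<in> P")
    case True
    then have "len P w < len P (reflection \<alpha> \<circ> w)" using len_ascent assms by blast
    then show ?thesis using True by (auto simp: bruhat_step_def height_drop_def)
  next
    case False
    have "len P (reflection \<alpha> \<circ> w) < len P w" using len_descent[OF assms False] .
    moreover have "real (len P w) \<le> real (len P (reflection \<alpha>)) + real (len P (reflection \<alpha> \<circ> w))"
      using len_comp[OF W_reflection[OF a] W_step[OF a assms(1)]]
      by (simp add: step_back)
    ultimately show ?thesis
      using False len_reflection[OF assms(2)] assms(2)
      by (auto simp: bruhat_step_def height_drop_def positive_root_reflection)
  qed
qed

lemma simple_edge: "w \<in> W \<Longrightarrow> \<delta> \<in> \<Delta> \<Longrightarrow> bruhat_step P w (reflection \<delta>)"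
proof -
  assume w: "w \<in> W" and d: "\<delta> \<in> \<Delta>"
  have dP: "\<delta> \<in> P" "\<delta> \<in> \<Phi>" using d \<Delta>_P P_root by auto
  have 1: "len P (reflection \<delta>) \<le> 1" using len_le[of "[reflection \<delta>]"] d by auto
  show ?thesis
  proof (cases "winv w \<delta> \<in> P")
    case True
    have "len P (reflection \<delta> \<circ> w) \<le> 1 + len P w"
      using len_comp[OF W_reflection[OF dP(2)] w] 1 by linarith
    then show ?thesis using len_ascent[OF w dP(1) True] by (simp add: bruhat_step_def)
  next
    case False
    have "len P w \<le> 1 + len P (reflection \<delta> \<circ> w)"
      using len_comp[OF W_reflection[OF dP(2)] W_step[OF dP(2) w]] 1
      by (simp add: step_back)
    then show ?thesis
      using len_descent[OF w dP(1) False] bruhat_step_iff[OF w dP(1)] False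
      by (simp add: height_drop_def height_simple d)
  qed
qed

end

section \<open>Rank two subsystems\<close>

text \<open>The product of the two Cartan integers is \<open>4 cos\<^sup>2\<close> of the angle, hence less than
  \<open>4\<close>, and they vanish together. The last two conclusions describe how the two simple
  reflections permute the listed roots.\<close>

lemma table_of_cartan_integers:
  fixes n1 n2 :: int
  assumes "n1 \<le> 0" "n2 \<le> 0" "n1 = 0 \<longleftrightarrow> n2 = 0" "n1 * n2 < 4"
  obtains T where "T \<in> set dihedral_tables"
    "\<And>j. 0 < j \<Longrightarrow> j < length T \<Longrightarrow> T ! (length T - j) = (- fst (T ! j) - n1 * snd (T ! j), snd (T ! j))"
    "\<And>j. j + 1 < length T \<Longrightarrow> T ! (length T - 2 - j) = (fst (T ! j), - snd (T ! j) - n2 * fst (T ! j))"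
proof -
  have "n1 = 0 \<or> n1 = -1 \<or> n1 = -2 \<or> n1 = -3"
  proof (rule ccontr)
    assume *: "\<not> ?thesis"
    then have "- n1 \<ge> 4" "- n2 \<ge> 1" using assms by linarith+
    then have "(- n1) * (- n2) \<ge> 4 * 1" by (intro mult_mono) auto
    then show False using assms by simp
  qed
  moreover have "n2 = 0 \<or> n2 = -1 \<or> n2 = -2 \<or> n2 = -3"
  proof (rule ccontr)
    assume *: "\<not> ?thesis"
    then have "- n2 \<ge> 4" "- n1 \<ge> 1" using assms by linarith+
    then have "(- n1) * (- n2) \<ge> 1 * 4" by (intro mult_mono) auto
    then show False using assms by simp
  qed
  ultimately have "(n1, n2) \<in> {(0,0), (-1,-1), (-1,-2), (-2,-1), (-1,-3), (-3,-1)}"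
    using assms by auto
  then have "\<exists>T\<in>set dihedral_tables.
     (\<forall>j\<in>set [1..<length T]. T ! (length T - j) = (- fst (T ! j) - n1 * snd (T ! j), snd (T ! j))) \<and>
     (\<forall>j\<in>set [0..<length T - 1]. T ! (length T - 2 - j) = (fst (T ! j), - snd (T ! j) - n2 * fst (T ! j)))"
    (is "?Q n1 n2")
  proof -
    have "?Q 0 0" "?Q (-1) (-1)" "?Q (-1) (-2)" "?Q (-2) (-1)" "?Q (-1) (-3)" "?Q (-3) (-1)"
      by code_simp+
    then show "(n1, n2) \<in> {(0,0), (-1,-1), (-1,-2), (-2,-1), (-1,-3), (-3,-1)} \<Longrightarrow> ?Q n1 n2"
      by (elim insertE emptyE) (simp_all only: prod.inject)
  qed
  then show ?thesis using that by auto
qed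

lemma antiperiodic_shift:
  fixes g :: "int \<Rightarrow> 'a::real_vector"
  assumes "\<And>i. g (i + m) = - g i"
  shows "g (i + m * k) = (if even k then g i else - g i)"
proof -
  have plus: "g (i + m * int n) = (if even n then g i else - g i)" for n i
  proof (induction n)
    case (Suc n)
    have "g (i + m * int (Suc n)) = - g (i + m * int n)"
      using assms[of "i + m * int n"] by (simp add: algebra_simps)
    then show ?case using Suc by simp
  qed simp
  show ?thesis
  proof (cases "k \<ge> 0")
    case True
    then show ?thesis using plus[of i "nat k"] by (simp add: even_nat_iff)
  next
    case False
    then show ?thesis using plus[of "i + m * k" "nat (- k)"] by (simp add: even_nat_iff split: if_splits)
  qed
qed

lemma int_const:
  fixes f :: "int \<Rightarrow> 'b"
  assumes "\<And>k. f (k + 1) = f k"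
  shows "f k = f 0"
proof (induction k rule: int_induct[where k = 0])
  case (step1 i)
  then show ?case using assms by simp
next
  case (step2 i)
  then show ?case using assms[of "i - 1"] by simp
qed simp

context positive_roots
begin

text \<open>The roots \<open>g i\<close> of a plane, numbered cyclically by all integers: \<open>g 0\<close> and
  \<open>g (m - 1)\<close> are its simple roots, and \<open>m\<close> steps lead to the opposite root. In
  this numbering a reflection is the map \<open>j \<mapsto> 2 i - j + m\<close>.\<close>

definition dihedral :: "(int \<times> int) list \<Rightarrow> (int \<Rightarrow> 'a) \<Rightarrow> bool" where
  "dihedral T g \<longleftrightarrow> T \<in> set dihedral_tables \<and>
     (\<forall>i\<in>{0..<int (length T)}. g i \<in> P) \<and>
     (\<forall>i. g (i + int (length T)) = - g i) \<and>
     (\<forall>i j. reflection (g i) (g j) = - g (2 * i - j)) \<and>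
     (\<forall>i\<in>{0..<int (length T)}.
        g i = of_int (fst (T ! nat i)) *\<^sub>R g 0 + of_int (snd (T ! nat i)) *\<^sub>R g (int (length T) - 1))"

lemma dihedralD:
  assumes "dihedral T g"
  shows "T \<in> set dihedral_tables" "\<And>i. 0 \<le> i \<Longrightarrow> i < int (length T) \<Longrightarrow> g i \<in> P"
    "\<And>i. g (i + int (length T)) = - g i" "\<And>i j. reflection (g i) (g j) = - g (2 * i - j)"
    "\<And>i. 0 \<le> i \<Longrightarrow> i < int (length T) \<Longrightarrow> g i = of_int (fst (T ! nat i)) *\<^sub>R g 0
        + of_int (snd (T ! nat i)) *\<^sub>R g (int (length T) - 1)"
  using assms unfolding dihedral_def by auto

text \<open>The formula for the reflections is checked on the table for the two simple ones. It extends to the others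
  because the rotation \<open>s\<^sub>a s\<^sub>b\<close> takes \<open>g j\<close> to \<open>g (j +
  2)\<close>.\<close>

lemma dihedral_exists:
  assumes a: "a \<in> \<Delta>" and b: "b \<in> \<Delta>" and ab: "a \<noteq> b"
  shows "\<exists>T g. dihedral T g \<and> g 0 = a \<and> g (int (length T) - 1) = b"
proof -
  have aP: "a \<in> P" "a \<in> \<Phi>" and bP: "b \<in> P" "b \<in> \<Phi>" using a b \<Delta>_P P_root by auto
  have pos: "a \<bullet> a > 0" "b \<bullet> b > 0" using root_nz aP bP by auto
  obtain n1 n2 where n1: "2 * (b \<bullet> a) / (a \<bullet> a) = of_int n1" and n2: "2 * (a \<bullet> b) / (b \<bullet> b) = of_int n2"
    using integral[OF aP(2) bP(2)] integral[OF bP(2) aP(2)] by (auto simp: Ints_def)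
  have ob: "a \<bullet> b \<le> 0" by (rule simple_obtuse[OF a b ab])
  have 1: "n1 \<le> 0" "n2 \<le> 0"
  proof -
    have "(of_int n1 :: real) \<le> 0" unfolding n1[symmetric] using ob pos by (simp add: inner_commute divide_le_0_iff)
    then show "n1 \<le> 0" by simp
    have "(of_int n2 :: real) \<le> 0" unfolding n2[symmetric] using ob pos by (simp add: divide_le_0_iff)
    then show "n2 \<le> 0" by simp
  qed
  have 2: "n1 = 0 \<longleftrightarrow> n2 = 0"
  proof -
    have "n1 = 0 \<longleftrightarrow> (of_int n1 :: real) = 0" by simp
    also have "\<dots> \<longleftrightarrow> a \<bullet> b = 0" unfolding n1[symmetric] using pos by (auto simp: inner_commute)
    also have "\<dots> \<longleftrightarrow> (of_int n2 :: real) = 0" unfolding n2[symmetric] using pos by auto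
    finally show ?thesis by simp
  qed
  have 3: "n1 * n2 < 4"
  proof -
    have "a \<noteq> - b" using aP bP P_not_neg by auto
    then have less: "(a \<bullet> b) * (a \<bullet> b) < (a \<bullet> a) * (b \<bullet> b)"
      using root_cauchy_schwarz[OF aP(2) bP(2) ab] by simp
    have "(of_int n1 * of_int n2 :: real) = 4 * ((a \<bullet> b) * (a \<bullet> b)) / ((a \<bullet> a) * (b \<bullet> b))"
      by (simp flip: n1 n2 add: inner_commute)
    also have "\<dots> < 4" using less pos by (simp add: divide_less_eq)
    finally have "real_of_int (n1 * n2) < real_of_int 4" by simp
    then show ?thesis by (simp only: of_int_less_iff)
  qed
  obtain T where T: "T \<in> set dihedral_tables" and
    Ta: "\<And>j. 0 < j \<Longrightarrow> j < length T \<Longrightarrow> T ! (length T - j) = (- fst (T ! j) - n1 * snd (T ! j), snd (T ! j))" and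
    Tb: "\<And>j. j + 1 < length T \<Longrightarrow> T ! (length T - 2 - j) = (fst (T ! j), - snd (T ! j) - n2 * fst (T ! j))"
    using table_of_cartan_integers[OF 1 2 3] by metis
  note tab = dihedral_table_facts[OF T]
  define m where "m = int (length T)"
  have m: "m \<ge> 2" using tab by (simp add: m_def)
  define v where "v i = (of_int (fst (T ! nat i)) *\<^sub>R a + of_int (snd (T ! nat i)) *\<^sub>R b)" for i :: int
  define g where "g j = (if even (j div m) then v (j mod m) else - v (j mod m))" for j :: int
  have v0: "v 0 = a" "v (m - 1) = b"
    using tab by (auto simp: v_def m_def nat_diff_distrib)
  have g_eq: "g (k * m + r) = (if even k then v r else - v r)" if "0 \<le> r" "r < m" for k r
    using that m by (simp add: g_def)
  have g_v: "g r = v r" if "0 \<le> r" "r < m" for r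
    using g_eq[OF that, of 0] by simp
  have anti: "g (i + m) = - g i" for i
    using m by (simp add: g_def)
  have sa: "reflection a b = b - of_int n1 *\<^sub>R a" and sb: "reflection b a = a - of_int n2 *\<^sub>R b"
    by (simp_all add: reflection_def n1 n2)
  have va: "reflection a (v r) = v (m - r)" if "0 < r" "r < m" for r
  proof -
    have "nat (m - r) = length T - nat r" "0 < nat r" "nat r < length T" using that by (auto simp: m_def)
    then have "T ! nat (m - r) = (- fst (T ! nat r) - n1 * snd (T ! nat r), snd (T ! nat r))"
      using Ta[of "nat r"] by simp
    then show ?thesis
      by (simp add: v_def reflection_add reflection_scale reflection_self sa algebra_simps)
  qed
  have vb: "reflection b (v r) = v (m - 2 - r)" if "0 \<le> r" "r < m - 1" for r
  proof -
    have "nat (m - 2 - r) = length T - 2 - nat r" "nat r + 1 < length T" using that by (auto simp: m_def)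
    then have "T ! nat (m - 2 - r) = (fst (T ! nat r), - snd (T ! nat r) - n2 * fst (T ! nat r))"
      using Tb[of "nat r"] by simp
    then show ?thesis
      by (simp add: v_def reflection_add reflection_scale reflection_self sb algebra_simps)
  qed
  have ga: "reflection a (g j) = - g (- j)" for j
  proof -
    define k r where "k = j div m" and "r = j mod m"
    have j: "j = k * m + r" and r: "0 \<le> r" "r < m" using m by (auto simp: k_def r_def)
    have gj: "g j = (if even k then v r else - v r)" using g_eq[OF r] j by simp
    show ?thesis
    proof (cases "r = 0")
      case True
      have "- j = (- k) * m + 0" using j True by simp
      then have "g (- j) = (if even k then v 0 else - v 0)" using g_eq[of 0 "- k"] m by simp
      then show ?thesis using gj True by (simp add: v0 reflection_self reflection_minus)
    next
      case False
      have "- j = (- k - 1) * m + (m - r)" using j by (simp add: algebra_simps)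
      then have "g (- j) = (if even k then - v (m - r) else v (m - r))"
        using g_eq[of "m - r" "- k - 1"] r False by simp
      then show ?thesis using gj va[of r] r False by (simp add: reflection_minus)
    qed
  qed
  have gb: "reflection b (g j) = - g (- 2 - j)" for j
  proof -
    define k r where "k = j div m" and "r = j mod m"
    have j: "j = k * m + r" and r: "0 \<le> r" "r < m" using m by (auto simp: k_def r_def)
    have gj: "g j = (if even k then v r else - v r)" using g_eq[OF r] j by simp
    show ?thesis
    proof (cases "r = m - 1")
      case True
      have e: "- 2 - j = (- k - 2) * m + (m - 1)" unfolding j True by algebra
      have "g (- 2 - j) = (if even (- k - 2) then v (m - 1) else - v (m - 1))"
        unfolding e by (rule g_eq) (use m in auto)
      then show ?thesis using gj True by (simp add: v0 reflection_self reflection_minus)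
    next
      case False
      have e: "- 2 - j = (- k - 1) * m + (m - 2 - r)" unfolding j by algebra
      have "g (- 2 - j) = (if even (- k - 1) then v (m - 2 - r) else - v (m - 2 - r))"
        unfolding e by (rule g_eq) (use r False in auto)
      then show ?thesis using gj vb[of r] r False by (simp add: reflection_minus)
    qed
  qed
  define R where "R x = reflection a (reflection b x)" for x
  have R: "R (g j) = g (j + 2)" for j
    by (simp add: R_def ga gb reflection_minus add.commute)
  have R_refl: "reflection (R u) (R x) = R (reflection u x)" for u x
    by (simp add: R_def reflection_reflection[of a] reflection_reflection[of b])
  have R_neg: "R (- x) = - R x" for x by (simp add: R_def reflection_minus)
  have g0: "g 0 = a" "g (- 1) = - b"
    using g_v[of 0] anti[of "-1"] g_v[of "m - 1"] m v0 by auto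
  have nonneg: "g (int n - 1) \<in> \<Phi> \<and> (\<forall>j. reflection (g (int n - 1)) (g j) = - g (2 * (int n - 1) - j))" for n
  proof (induction n rule: induct_nat_012)
    case 0
    then show ?case using bP gb by (simp add: g0 uminus_root reflection_uminus)
  next
    case 1
    then show ?case using aP ga by (simp add: g0)
  next
    case (ge2 n)
    have e: "int (Suc (Suc n)) - 1 = int n - 1 + 2" by simp
    have "R (g (int n - 1)) \<in> \<Phi>" using ge2 aP bP by (simp add: R_def reflection_root)
    moreover have "reflection (g (int n - 1 + 2)) (g j) = - g (2 * (int n - 1 + 2) - j)" for j
    proof -
      have "reflection (g (int n - 1 + 2)) (g j) = reflection (R (g (int n - 1))) (R (g (j - 2)))"
        unfolding R by simp
      also have "\<dots> = R (- g (2 * (int n - 1) - (j - 2)))" unfolding R_refl using ge2 by simp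
      also have "\<dots> = - g (2 * (int n - 1) - (j - 2) + 2)" by (simp only: R_neg R)
      finally show ?thesis by (simp add: algebra_simps)
    qed
    ultimately show ?case unfolding e R by blast
  qed
  have refl: "reflection (g i) (g j) = - g (2 * i - j)" for i j
  proof -
    define i' where "i' = i mod m"
    have i': "i' \<ge> 0" "i = i' + m * (i div m)" using m by (auto simp: i'_def)
    have "reflection (g i) = reflection (g i')"
      using antiperiodic_shift[of g m i' "i div m"] anti i'(2) by (auto simp: reflection_uminus)
    moreover have "g (2 * i - j) = g (2 * i' - j)"
    proof -
      have e: "2 * i - j = (2 * i' - j) + m * (2 * (i div m))" using i'(2) by algebra
      show ?thesis unfolding e using antiperiodic_shift[of g m "2 * i' - j" "2 * (i div m)", OF anti] by simp
    qed
    moreover have "reflection (g i') (g j) = - g (2 * i' - j)"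
      using nonneg[of "nat (i' + 1)"] i'(1) by simp
    ultimately show ?thesis by simp
  qed
  have gP: "g i \<in> P" if i: "0 \<le> i" "i < m" for i :: int
  proof -
    have "g i \<in> \<Phi>" using nonneg[of "nat (i + 1)"] i by simp
    moreover have "pv \<bullet> g i > 0"
    proof -
      have "nat i < length T" using i by (simp add: m_def)
      from tab(4)[OF this] have xy: "fst (T ! nat i) \<ge> 0" "snd (T ! nat i) \<ge> 0" "fst (T ! nat i) > 0 \<or> snd (T ! nat i) > 0"
        by auto
      have "pv \<bullet> g i = of_int (fst (T ! nat i)) * (pv \<bullet> a) + of_int (snd (T ! nat i)) * (pv \<bullet> b)"
        by (simp add: g_v[OF i] v_def inner_add_right)
      moreover have "0 \<le> of_int (fst (T ! nat i)) * (pv \<bullet> a)" "0 \<le> of_int (snd (T ! nat i)) * (pv \<bullet> b)"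
        "0 < fst (T ! nat i) \<Longrightarrow> 0 < of_int (fst (T ! nat i)) * (pv \<bullet> a)"
        "0 < snd (T ! nat i) \<Longrightarrow> 0 < of_int (snd (T ! nat i)) * (pv \<bullet> b)"
        using xy P_pos[OF aP(1)] P_pos[OF bP(1)] by auto
      ultimately show ?thesis using xy(3) by (auto intro: add_pos_nonneg add_nonneg_pos)
    qed
    ultimately show ?thesis by (simp add: P_iff)
  qed
  have "dihedral T g"
    unfolding dihedral_def m_def[symmetric] using T gP anti refl g_v v0 m by (auto simp: v_def)
  moreover have "g (int (length T) - 1) = b" unfolding m_def[symmetric] using g_v[of "m - 1"] v0 m by simp
  ultimately show ?thesis using g0(1) by blast
qed

lemma simple_pair_independent:
  assumes a: "a \<in> \<Delta>" and b: "b \<in> \<Delta>" and ab: "a \<noteq> b" and eq: "x *\<^sub>R a + y *\<^sub>R b = x' *\<^sub>R a + y' *\<^sub>R b"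
  shows "x = x' \<and> y = y'"
proof -
  have s: "c *\<^sub>R a \<in> span \<Delta>" "c *\<^sub>R b \<in> span \<Delta>" "a \<in> span \<Delta>" "b \<in> span \<Delta>" for c
    using a b by (auto intro: span_base span_scale)
  have "rep (x *\<^sub>R a + y *\<^sub>R b) = (\<lambda>\<delta>. x * rep a \<delta> + y * rep b \<delta>)" for x y
    using s by (simp only: rep_add rep_scale)
  then have "x * rep a \<delta> + y * rep b \<delta> = x' * rep a \<delta> + y' * rep b \<delta>" for \<delta>
    using eq by metis
  from this[of a] this[of b] show ?thesis using ab by (simp add: rep_basis a b)
qed

text \<open>The rotation \<open>s\<^sub>a s\<^sub>b\<close> has finite order on the plane and fixes only
  \<open>0\<close> there. The orbit of a positive root that is not listed would consist of positive roots,
  and the sum over the orbit would be a nonzero fixed vector.\<close>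

lemma dihedral_complete:
  assumes D: "dihedral T g" and a: "g 0 \<in> \<Delta>" and b: "g (int (length T) - 1) \<in> \<Delta>"
    and ne: "g 0 \<noteq> g (int (length T) - 1)" and plane: "P \<subseteq> span {g 0, g (int (length T) - 1)}"
  shows "P = g ` {0..<int (length T)}"
proof
  define m where "m = int (length T)"
  define a b where "a = g 0" and "b = g (m - 1)"
  note D' = dihedralD[OF D, folded m_def]
  note tab = dihedral_table_facts[OF D'(1)]
  have m: "m \<ge> 2" using tab(3) by (simp add: m_def)
  have aD: "a \<in> \<Delta>" and bD: "b \<in> \<Delta>" using a b by (simp_all add: a_def b_def m_def)
  have pl: "P \<subseteq> span {a, b}" using plane by (simp add: a_def b_def m_def)
  show "g ` {0..<int (length T)} \<subseteq> P" using D'(2) by (auto simp: m_def)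
  have g1: "g (- 1) = - b" using D'(3)[of "-1"] by (simp add: b_def algebra_simps)
  have ga: "reflection a (g j) = - g (- j)" for j using D'(4)[of 0 j] by (simp add: a_def)
  have gb: "reflection b (g j) = - g (- 2 - j)" for j
    using D'(4)[of "-1" j] by (simp add: g1 reflection_uminus)
  define R where "R x = reflection a (reflection b x)" for x
  have R_app: "R x = reflection a (reflection b x)" for x by (simp add: R_def)
  have Rg: "R (g j) = g (j + 2)" for j by (simp add: R_def ga gb reflection_minus add.commute)
  have lin: "linear R"
    unfolding R_def using linear_compose[OF linear_reflection linear_reflection] by (simp add: o_def)
  have Rn: "(R ^^ n) (g j) = g (j + 2 * int n)" for n j
    by (induction n) (simp_all add: Rg algebra_simps)
  have linn: "linear (R ^^ n)" for n
  proof (induction n)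
    case 0
    show ?case unfolding funpow.simps by (rule linear_id)
  next
    case (Suc n)
    show ?case unfolding funpow.simps by (rule linear_compose[OF Suc lin])
  qed
  have period: "g (j + 2 * m) = g j" for j
    using D'(3)[of j] D'(3)[of "j + m"] by (simp add: algebra_simps)
  have Rm: "(R ^^ nat m) x = x" if "x \<in> span {a, b}" for x
  proof -
    have "(R ^^ nat m) x = id x"
    proof (rule linear_eq_on_span[OF linn linear_id _ that])
      show "(R ^^ nat m) y = id y" if "y \<in> {a, b}" for y
        using that Rn[of "nat m"] period m by (auto simp: a_def b_def)
    qed
    then show ?thesis by simp
  qed
  have ab: "a \<noteq> b" using ne by (simp add: a_def b_def m_def)
  show "P \<subseteq> g ` {0..<int (length T)}"
  proof (rule ccontr)
    assume "\<not> ?thesis"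
    then obtain \<gamma> where \<gamma>: "\<gamma> \<in> P" "\<gamma> \<notin> g ` {0..<m}" by (auto simp: m_def)
    have listed: "g j \<in> P \<Longrightarrow> g j \<in> g ` {0..<m}" for j
    proof -
      assume P: "g j \<in> P"
      have e: "j = j mod m + m * (j div m)" by simp
      have r: "0 \<le> j mod m" "j mod m < m" using m by auto
      have "g j = (if even (j div m) then g (j mod m) else - g (j mod m))"
        by (subst e, rule antiperiodic_shift) (rule D'(3))
      then have "g j = g (j mod m)" using P P_not_neg[OF D'(2)[OF r]] by (auto split: if_splits)
      then show ?thesis using r by auto
    qed
    have step: "reflection (g k) u \<in> P \<and> reflection (g k) u \<notin> range g"
      if u: "u \<in> P" "u \<notin> range g" and k: "g k \<in> \<Delta>" for u k
    proof
      have "u \<noteq> g k" using u by auto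
      then show "reflection (g k) u \<in> P" using simple_reflection_permutes[OF k u(1)] by simp
      show "reflection (g k) u \<notin> range g"
      proof
        assume "reflection (g k) u \<in> range g"
        then obtain j where "reflection (g k) u = g j" by auto
        then have "u = - g (2 * k - j)" using D'(4)[of k j] reflection_involution[of "g k" u] by simp
        then have "u = g (2 * k - j + m)" using D'(3)[of "2 * k - j"] by simp
        then show False using u by simp
      qed
    qed
    have orbit: "(R ^^ n) \<gamma> \<in> P \<and> (R ^^ n) \<gamma> \<notin> range g" for n
    proof (induction n)
      case 0
      then show ?case using \<gamma> listed by auto
    next
      case (Suc n)
      have "(R ^^ Suc n) \<gamma> = reflection a (reflection b ((R ^^ n) \<gamma>))"
        unfolding funpow.simps o_apply by (rule R_app)
      then show ?case using Suc step[of "(R ^^ n) \<gamma>" "m - 1"] step[of "reflection b ((R ^^ n) \<gamma>)" 0] aD bD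
        by (simp add: a_def b_def)
    qed
    \<comment> \<open>The number of roots in the plane is \<open>2 m\<close> and the rotation shifts indices by \<open>2\<close>, so its order divides \<open>m\<close>.\<close>
    define S where "S = (\<Sum>n<nat m. (R ^^ n) \<gamma>)"
    have "pv \<bullet> S > 0"
      unfolding S_def inner_sum_right using m orbit P_pos by (intro sum_pos) (auto simp: lessThan_empty_iff)
    have "R (\<Sum>n<k. (R ^^ n) \<gamma>) + \<gamma> = (\<Sum>n<k. (R ^^ n) \<gamma>) + (R ^^ k) \<gamma>" for k
    proof (induction k)
      case 0
      show ?case by (simp add: linear_0[OF lin])
    next
      case (Suc k)
      have "R (\<Sum>n<Suc k. (R ^^ n) \<gamma>) + \<gamma> = (R (\<Sum>n<k. (R ^^ n) \<gamma>) + \<gamma>) + (R ^^ Suc k) \<gamma>"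
        by (simp add: linear_add[OF lin])
      then show ?case unfolding Suc by simp
    qed
    from this[of "nat m"] have "R S + \<gamma> = S + \<gamma>"
      using Rm pl \<gamma>(1) unfolding S_def[symmetric] by auto
    then have "R S = S" by (rule add_right_imp_eq)
    then have eq: "reflection b S = reflection a S"
      using reflection_involution[of a "reflection b S"] by (simp add: R_def)
    define c c' where "c = 2 * (S \<bullet> b) / (b \<bullet> b)" and "c' = 2 * (S \<bullet> a) / (a \<bullet> a)"
    have "c *\<^sub>R b = c' *\<^sub>R a" using eq by (simp add: reflection_def c_def c'_def)
    then have "c' *\<^sub>R a + 0 *\<^sub>R b = 0 *\<^sub>R a + c *\<^sub>R b" by simp
    from simple_pair_independent[OF aD bD ab this] have "c = 0 \<and> c' = 0" by simp
    then have "S \<bullet> a = 0" "S \<bullet> b = 0"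
      using root_nz[OF P_root[OF \<Delta>_P[OF aD]]] root_nz[OF P_root[OF \<Delta>_P[OF bD]]] by (auto simp: c_def c'_def)
    have "S \<in> span {a, b}" unfolding S_def using orbit pl by (intro span_sum) auto
    have "S \<bullet> S = 0"
    proof -
      have "x \<bullet> S = 0" if "x \<in> span {a, b}" for x
        using that by (induction rule: span_induct_alt) (auto simp: inner_add_left inner_add_right \<open>S \<bullet> a = 0\<close> \<open>S \<bullet> b = 0\<close> inner_commute[of _ S])
      then show ?thesis using \<open>S \<in> span {a, b}\<close> by blast
    qed
    then show False using \<open>pv \<bullet> S > 0\<close> by simp
  qed
qed

end

lemma root_system_Int_span:
  assumes "root_system \<Phi>"
  shows "root_system (\<Phi> \<inter> span B)"
proof -
  have closed: "reflection \<alpha> \<beta> \<in> \<Phi> \<inter> span B" if "\<alpha> \<in> \<Phi> \<inter> span B" "\<beta> \<in> \<Phi> \<inter> span B" for \<alpha> \<beta>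
  proof
    show "reflection \<alpha> \<beta> \<in> \<Phi>" using assms that unfolding root_system_def by blast
    show "reflection \<alpha> \<beta> \<in> span B" using that by (auto simp: reflection_def intro!: span_diff span_scale)
  qed
  have "reflection \<alpha> ` (\<Phi> \<inter> span B) = \<Phi> \<inter> span B" if "\<alpha> \<in> \<Phi> \<inter> span B" for \<alpha>
  proof
    show "reflection \<alpha> ` (\<Phi> \<inter> span B) \<subseteq> \<Phi> \<inter> span B" using closed that by blast
    show "\<Phi> \<inter> span B \<subseteq> reflection \<alpha> ` (\<Phi> \<inter> span B)"
    proof
      fix \<beta> assume "\<beta> \<in> \<Phi> \<inter> span B"
      then show "\<beta> \<in> reflection \<alpha> ` (\<Phi> \<inter> span B)"
        using closed[OF that] by (intro image_eqI[of _ _ "reflection \<alpha> \<beta>"]) (auto simp: reflection_involution)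
    qed
  qed
  then show ?thesis using assms unfolding root_system_def by auto
qed

context positive_roots
begin

lemma P_Int_span: "positive_roots (\<Phi> \<inter> span B) (P \<inter> span B)"
proof
  show "root_system (\<Phi> \<inter> span B)" by (rule root_system_Int_span[OF rs])
  show "positive_system (\<Phi> \<inter> span B) (P \<inter> span B)"
    unfolding positive_system_def using pv by (intro exI[of _ pv]) auto
qed

lemma P_parallel: "\<alpha> \<in> P \<Longrightarrow> \<beta> \<in> P \<Longrightarrow> \<beta> = c *\<^sub>R \<alpha> \<Longrightarrow> \<beta> = \<alpha>"
  using reduced_pos[of \<alpha> c] by auto

lemma dihedral_length: "dihedral T g \<Longrightarrow> int (length T) \<ge> 2"
  using dihedral_table_facts(3)[OF dihedralD(1)] by force

text \<open>Equal simple roots would give \<open>g 0 = g (-2)\<close>, a root whose negative \<open>g (m - 2)\<close> is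
  positive.\<close>

lemma dihedral_ends_distinct:
  assumes D: "dihedral T g" shows "g 0 \<noteq> g (int (length T) - 1)"
proof
  define m where "m = int (length T)"
  note D' = dihedralD[OF D, folded m_def]
  have m: "m \<ge> 2" using dihedral_length[OF D] by (simp add: m_def)
  assume eq: "g 0 = g (int (length T) - 1)"
  then have "g (- 1) = - g 0" using D'(3)[of "-1"] by (simp add: m_def)
  then have "reflection (g 0) (g 0) = reflection (g (- 1)) (g 0)" by (simp add: reflection_uminus)
  then have "g 0 = g (- 2)" using D'(4)[of 0 0] D'(4)[of "-1" 0] by simp
  moreover have "- g (- 2) = g (m - 2)" using D'(3)[of "-2"] by (simp add: algebra_simps)
  ultimately show False using P_not_neg[OF D'(2)[of 0]] D'(2)[of "m - 2"] m by auto
qed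

text \<open>The simple roots of the rank two system cut out by the plane span it, so there are two of them, and their
  Cartan integers select the table.\<close>

lemma dihedral_plane:
  assumes a: "\<alpha> \<in> P" and b: "\<beta> \<in> P" and ne: "\<alpha> \<noteq> \<beta>"
  obtains T g where "dihedral T g" "P \<inter> span {\<alpha>, \<beta>} = g ` {0..<int (length T)}"
    "simple_roots (P \<inter> span {\<alpha>, \<beta>}) = {g 0, g (int (length T) - 1)}"
proof -
  define V where "V = span {\<alpha>, \<beta>}"
  interpret E: positive_roots "\<Phi> \<inter> V" "P \<inter> V" unfolding V_def by (rule P_Int_span)
  have ab: "\<alpha> \<in> P \<inter> V" "\<beta> \<in> P \<inter> V" using a b by (auto simp: V_def intro: span_base)
  have sub: "simple_roots (P \<inter> V) \<subseteq> P \<inter> V" using E.\<Delta>_P by auto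
  have "\<exists>x y. x \<in> simple_roots (P \<inter> V) \<and> y \<in> simple_roots (P \<inter> V) \<and> x \<noteq> y"
  proof (rule ccontr)
    assume *: "\<not> ?thesis"
    have "simple_roots (P \<inter> V) \<noteq> {}" using E.P_span[OF ab(1)] E.root_nz[OF E.P_root[OF ab(1)]] by auto
    then obtain x where "x \<in> simple_roots (P \<inter> V)" by auto
    then have x: "simple_roots (P \<inter> V) = {x}" using * by blast
    then have "x \<in> P" using sub by auto
    obtain c where "\<alpha> = c *\<^sub>R x" using E.P_span[OF ab(1)] by (auto simp: x span_singleton)
    then have "\<alpha> = x" using P_parallel[OF \<open>x \<in> P\<close> a] by blast
    obtain c' where "\<beta> = c' *\<^sub>R x" using E.P_span[OF ab(2)] by (auto simp: x span_singleton)
    then have "\<beta> = x" using P_parallel[OF \<open>x \<in> P\<close> b] by blast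
    then show False using \<open>\<alpha> = x\<close> ne by simp
  qed
  then obtain x y where xy: "x \<in> simple_roots (P \<inter> V)" "y \<in> simple_roots (P \<inter> V)" "x \<noteq> y" by blast
  obtain T g where D: "E.dihedral T g" and g: "g 0 = x" "g (int (length T) - 1) = y"
    using E.dihedral_exists[OF xy] by blast
  have ind: "independent {x, y}" using independent_mono[OF E.independent_\<Delta>] xy by auto
  have "{x, y} \<subseteq> V" using xy sub by auto
  have V: "V \<subseteq> span {x, y}"
  proof (rule card_ge_dim_independent[OF \<open>{x, y} \<subseteq> V\<close> ind])
    have "dim V \<le> card {\<alpha>, \<beta>}" unfolding V_def dim_span by (rule dim_le_card') simp
    then show "dim V \<le> card {x, y}" using xy ne by simp
  qed
  have simple: "simple_roots (P \<inter> V) = {x, y}"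
  proof (rule ccontr)
    assume "simple_roots (P \<inter> V) \<noteq> {x, y}"
    then obtain z where z: "z \<in> simple_roots (P \<inter> V)" "z \<noteq> x" "z \<noteq> y" using xy by auto
    have "z \<in> span {x, y}" using z sub V by auto
    moreover have "span {x, y} \<subseteq> span (simple_roots (P \<inter> V) - {z})"
      using z xy by (intro span_mono) auto
    ultimately show False using E.independent_\<Delta> z by (auto simp: dependent_def)
  qed
  have "P \<inter> V = g ` {0..<int (length T)}"
    by (rule E.dihedral_complete[OF D]) (use xy g V in auto)
  moreover have "dihedral T g"
    using D unfolding E.dihedral_def dihedral_def by auto
  ultimately show ?thesis using that simple g unfolding V_def by metis
qed

lemma dihedral_periodic:
  assumes D: "dihedral T g"
  shows "g (i + int (length T) * k) = (if even k then g i else - g i)"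
  by (rule antiperiodic_shift) (rule dihedralD(3)[OF D])

lemma dihedral_reflection_periodic:
  assumes D: "dihedral T g"
  shows "reflection (g (i + int (length T) * k)) = reflection (g i)"
  by (simp add: dihedral_periodic[OF D] reflection_uminus)

lemma dihedral_root: "dihedral T g \<Longrightarrow> g i \<in> \<Phi>"
proof -
  assume D: "dihedral T g"
  have e: "i = i mod int (length T) + int (length T) * (i div int (length T))" by simp
  have "int (length T) > 0" using dihedral_length[OF D] by linarith
  then have "g (i mod int (length T)) \<in> \<Phi>"
    by (intro P_root dihedralD(2)[OF D] pos_mod_sign pos_mod_bound)
  then show "g i \<in> \<Phi>"
    using dihedral_periodic[OF D, of "i mod int (length T)" "i div int (length T)"] uminus_root
    by (auto split: if_splits)
qed

text \<open>It suffices to shift both indices by one. The products of neighbours \<open>\<tau>\<^sub>i\<^sub>+\<^sub>1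
  \<tau>\<^sub>i\<close> all agree because \<open>\<tau>\<^sub>i\<close> conjugates
  \<open>\<tau>\<^sub>i\<^sub>-\<^sub>1\<close> into \<open>\<tau>\<^sub>i\<^sub>+\<^sub>1\<close>, and
  \<open>\<tau>\<^sub>i \<tau>\<^sub>j\<close> is compared with \<open>\<tau>\<^sub>i\<^sub>+\<^sub>1
  \<tau>\<^sub>j\<^sub>+\<^sub>1\<close> through two such products.\<close>

lemma dihedral_rotation:
  assumes D: "dihedral T g"
  shows "reflection (g i) \<circ> reflection (g j) = reflection (g (i + k)) \<circ> reflection (g (j + k))"
proof -
  note D4 = dihedralD(4)[OF D]
  have conj: "reflection (g i) \<circ> reflection (g j) \<circ> reflection (g i) = reflection (g (2 * i - j))" for i j
    using reflection_conjugate[of "g i" "g j"] by (simp add: D4 reflection_uminus)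
  have next_eq: "reflection (g (i + 1)) (reflection (g i) x) = reflection (g i) (reflection (g (i - 1)) x)" for i x
  proof -
    have "2 * i - (i - 1) = i + 1" by simp
    then have "reflection (g (i + 1)) = reflection (g i) \<circ> reflection (g (i - 1)) \<circ> reflection (g i)"
      using conj[of i "i - 1"] by metis
    then show ?thesis by (simp add: reflection_involution)
  qed
  have const: "reflection (g (i + 1)) (reflection (g i) x) = reflection (g (j + 1)) (reflection (g j) x)" for i j x
  proof -
    have "(\<lambda>i. reflection (g (i + 1)) (reflection (g i) x)) i = (\<lambda>i. reflection (g (i + 1)) (reflection (g i) x)) 0" for i
      by (rule int_const) (use next_eq[of "_ + 1"] in simp)
    then show ?thesis by metis
  qed
  have shift: "reflection (g (i + 1)) (reflection (g (j + 1)) x) = reflection (g i) (reflection (g j) x)" for i j x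
  proof -
    have "reflection (g i) (reflection (g (i + 1)) (reflection (g (j + 1)) x))
        = reflection (g i) (reflection (g (i + 1)) (reflection (g (j + 1)) (reflection (g j) (reflection (g j) x))))"
      by (simp only: reflection_involution)
    also have "\<dots> = reflection (g i) (reflection (g (i + 1)) (reflection (g (i + 1)) (reflection (g i) (reflection (g j) x))))"
      by (simp only: const[of j "reflection (g j) x" i])
    also have "\<dots> = reflection (g j) x" by (simp only: reflection_involution)
    finally show ?thesis by (metis reflection_involution)
  qed
  have "(\<lambda>k. reflection (g (i + k)) (reflection (g (j + k)) x)) k = (\<lambda>k. reflection (g (i + k)) (reflection (g (j + k)) x)) 0" for x
    by (rule int_const) (use shift[of "i + _" "j + _"] in \<open>simp add: add.assoc\<close>)
  then show ?thesis by (auto simp: fun_eq_iff)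
qed

subsection \<open>Cosets of a dihedral subgroup\<close>

text \<open>The connection with the encoding of cosets by residues: \<open>w\<^sup>-\<^sup>1\<close> keeps the root with
  index \<open>j\<close> positive exactly if \<open>j\<close> is one of the \<open>m\<close> indices from
  \<open>k\<close> on.\<close>

definition chamber :: "(int \<times> int) list \<Rightarrow> (int \<Rightarrow> 'a) \<Rightarrow> ('a \<Rightarrow> 'a) \<Rightarrow> int \<Rightarrow> bool" where
  "chamber T g w k \<longleftrightarrow> (\<forall>j. winv w (g j) \<in> P \<longleftrightarrow> ascent (int (length T)) k j)"

lemma ascent_shift:
  assumes "m > 0" shows "ascent m k (j + m) \<longleftrightarrow> \<not> ascent m k j"
proof -
  define r where "r = (j - k) mod (2 * m)"
  have r: "0 \<le> r" "r < 2 * m" using assms by (auto simp: r_def)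
  have "(j + m - k) mod (2 * m) = (r + m) mod (2 * m)"
    unfolding r_def by (simp add: mod_simps algebra_simps)
  also have "\<dots> = (if r < m then r + m else r - m)"
  proof (cases "r < m")
    case False
    have "(r + m) mod (2 * m) = (r - m + 2 * m) mod (2 * m)" by (simp add: algebra_simps)
    also have "\<dots> = (r - m) mod (2 * m)" by (rule mod_add_self2)
    finally show ?thesis using False r by simp
  qed (use r in simp)
  finally show ?thesis using r by (auto simp: ascent_def r_def[symmetric] split: if_splits)
qed

lemma chamber_step:
  assumes D: "dihedral T g" and w: "w \<in> W" and c: "chamber T g w k"
  shows "chamber T g (reflection (g i) \<circ> w) (2 * i + 1 - k)"
  unfolding chamber_def
proof
  fix j
  define m where "m = int (length T)"
  have m: "m > 0" using dihedral_length[OF D] unfolding m_def by linarith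
  define x where "x = 2 * i - j - k"
  have "winv (reflection (g i) \<circ> w) (g j) = - winv w (g (2 * i - j))"
    by (simp add: winv_step[OF dihedral_root[OF D] w] dihedralD(4)[OF D] W_neg[OF W_winv[OF w]])
  moreover have "winv w (g (2 * i - j)) \<in> \<Phi>" using W_root[OF W_winv[OF w] dihedral_root[OF D]] .
  ultimately have "winv (reflection (g i) \<circ> w) (g j) \<in> P \<longleftrightarrow> \<not> x mod (2 * m) < m"
    using c uminus_P by (simp add: chamber_def ascent_def x_def m_def)
  also have "\<dots> \<longleftrightarrow> (- x - 1) mod (2 * m) < m"
  proof -
    have "- x - 1 = 2 * m - 1 - x mod (2 * m) + (2 * m) * (- (x div (2 * m)) - 1)"
      using mult_div_mod_eq[of "2 * m" x] by (simp add: algebra_simps)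
    then have "(- x - 1) mod (2 * m) = (2 * m - 1 - x mod (2 * m)) mod (2 * m)"
      by (metis mod_mult_self2)
    also have "\<dots> = 2 * m - 1 - x mod (2 * m)"
      using m pos_mod_bound[of "2 * m" x] pos_mod_sign[of "2 * m" x] by (intro mod_pos_pos_trivial) linarith+
    finally show ?thesis by auto
  qed
  also have "\<dots> \<longleftrightarrow> ascent m (2 * i + 1 - k) j"
    by (simp add: ascent_def x_def algebra_simps)
  finally show "winv (reflection (g i) \<circ> w) (g j) \<in> P \<longleftrightarrow> ascent (int (length T)) (2 * i + 1 - k) j"
    by (simp add: m_def)
qed

end

lemma prefix_cut:
  fixes m :: nat
  assumes "\<And>i j. i < j \<Longrightarrow> j < m \<Longrightarrow> Q j \<Longrightarrow> Q i"
  shows "\<exists>k\<le>m. \<forall>i<m. Q i \<longleftrightarrow> i < k"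
proof -
  define k where "k = (LEAST k. k = m \<or> \<not> Q k)"
  have k: "k = m \<or> \<not> Q k"
    unfolding k_def by (rule LeastI[of "\<lambda>k. k = m \<or> \<not> Q k" m]) simp
  have le: "k \<le> m" unfolding k_def by (rule Least_le) simp
  have less: "Q i" if "i < k" for i
    using not_less_Least[OF that[unfolded k_def]] by simp
  have "Q i \<longleftrightarrow> i < k" if i: "i < m" for i
  proof
    assume "Q i"
    show "i < k"
    proof (rule ccontr)
      assume "\<not> i < k"
      then have "k < m" "k = i \<or> k < i" using i by auto
      then show False using k \<open>Q i\<close> assms[of k i] i by auto
    qed
  qed (rule less)
  then show ?thesis using le by blast
qed

context positive_roots
begin

text \<open>The slopes of the listed roots increase, so a linear functional that is positive on the first root changes
  sign at most once along the list.\<close>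

lemma dihedral_sign_pattern:
  assumes D: "dihedral T g" and f: "linear f" and nz: "\<And>i. f (g i) \<noteq> (0::real)" and pos: "f (g 0) > 0"
  shows "\<exists>k\<le>length T. \<forall>i<length T. f (g (int i)) > 0 \<longleftrightarrow> i < k"
proof (rule prefix_cut)
  note tab = dihedral_table_facts[OF dihedralD(1)[OF D]]
  define p q where "p = f (g 0)" and "q = f (g (int (length T) - 1))"
  define x y where "x i = real_of_int (fst (T ! i))" and "y i = real_of_int (snd (T ! i))" for i
  have val: "f (g (int i)) = x i * p + y i * q" if "i < length T" for i
  proof -
    have "f (g (int i)) = f (x i *\<^sub>R g 0 + y i *\<^sub>R g (int (length T) - 1))"
      using dihedralD(5)[OF D, of "int i"] that by (simp add: x_def y_def)
    then show ?thesis using f by (simp add: linear_add linear_scale p_def q_def)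
  qed
  have xy: "x i \<ge> 0" "y i \<ge> 0" if "i < length T" for i
    using tab(4)[OF that] by (simp_all add: x_def y_def)
  fix i j assume ij: "i < j" "j < length T" and j: "f (g (int j)) > 0"
  show "f (g (int i)) > 0"
  proof (rule ccontr)
    assume "\<not> f (g (int i)) > 0"
    then have neg: "x i * p + y i * q < 0" using nz[of "int i"] val[of i] ij by simp
    have "x i * p \<ge> 0" using xy(1)[of i] ij pos by (simp add: p_def)
    then have yi: "y i > 0" using neg xy(2)[of i] ij by (cases "y i = 0") auto
    have "real_of_int (fst (T ! j) * snd (T ! i)) < real_of_int (fst (T ! i) * snd (T ! j))"
      using tab(5)[OF ij] by (simp only: of_int_less_iff)
    then have slope: "x j * y i < x i * y j" by (simp add: x_def y_def)
    have "y i * (x j * p + y j * q) = (x j * y i) * p + y i * y j * q" by (simp add: algebra_simps)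
    also have "\<dots> \<le> (x i * y j) * p + y i * y j * q"
      using slope pos by (intro add_right_mono mult_right_mono) (auto simp: p_def)
    also have "\<dots> = y j * (x i * p + y i * q)" by (simp add: algebra_simps)
    also have "\<dots> \<le> 0" using xy(2)[OF ij(2)] neg by (simp add: mult_nonneg_nonpos)
    finally have "x j * p + y j * q \<le> 0" using yi by (simp add: mult_le_0_iff)
    then show False using j val[OF ij(2)] by simp
  qed
qed

text \<open>By the sign pattern of \<open>v \<mapsto> pv \<bullet> w\<^sup>-\<^sup>1 v\<close>, the kept positive roots
  of the plane form an initial or a final section of the list; the opposite roots complete it to
  \<open>m\<close> consecutive ones.\<close>

lemma chamber_exists:
  assumes D: "dihedral T g" and w: "w \<in> W"
  shows "\<exists>k. chamber T g w k"
proof -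
  define m where "m = int (length T)"
  have m: "m > 0" using dihedral_length[OF D] unfolding m_def by linarith
  define f where "f v = pv \<bullet> winv w v" for v
  have root: "winv w (g i) \<in> \<Phi>" for i using W_root[OF W_winv[OF w] dihedral_root[OF D]] .
  have P: "winv w (g i) \<in> P \<longleftrightarrow> f (g i) > 0" for i using root by (simp add: P_iff f_def)
  have nz: "f (g i) \<noteq> 0" for i using pv(1)[OF root] by (simp add: f_def)
  have lin: "linear f"
    unfolding f_def by (rule linearI) (simp_all add: W_add[OF W_winv[OF w]] W_scale[OF W_winv[OF w]] inner_add_right)
  have anti: "f (g (i + m)) = - f (g i)" for i
    using dihedralD(3)[OF D] lin by (simp add: m_def linear_neg)
  have extend: "chamber T g w k" if *: "\<And>i. 0 \<le> i \<Longrightarrow> i < m \<Longrightarrow> f (g i) > 0 \<longleftrightarrow> ascent m k i" for k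
    unfolding chamber_def
  proof
    fix j
    have shift: "(f (g (i + m)) > 0 \<longleftrightarrow> ascent m k (i + m)) \<longleftrightarrow> (f (g i) > 0 \<longleftrightarrow> ascent m k i)" for i
      using anti[of i] nz[of i] ascent_shift[OF m, of k i] by linarith
    have "(\<lambda>n. f (g (j mod m + m * n)) > 0 \<longleftrightarrow> ascent m k (j mod m + m * n)) n
      = (\<lambda>n. f (g (j mod m + m * n)) > 0 \<longleftrightarrow> ascent m k (j mod m + m * n)) 0" for n
      by (rule int_const) (use shift[of "j mod m + m * _"] in \<open>simp add: algebra_simps\<close>)
    from this[of "j div m"] have "(f (g j) > 0 \<longleftrightarrow> ascent m k j) \<longleftrightarrow> (f (g (j mod m)) > 0 \<longleftrightarrow> ascent m k (j mod m))"
      by simp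
    then show "winv w (g j) \<in> P \<longleftrightarrow> ascent (int (length T)) k j"
      using *[of "j mod m"] m by (simp add: P m_def)
  qed
  show ?thesis
  proof (cases "f (g 0) > 0")
    case True
    obtain k where k: "k \<le> length T" "\<forall>i<length T. f (g (int i)) > 0 \<longleftrightarrow> i < k"
      using dihedral_sign_pattern[OF D lin nz True] by blast
    have "chamber T g w (int k - m)"
    proof (rule extend)
      fix i :: int assume i: "0 \<le> i" "i < m"
      have "(i - (int k - m)) mod (2 * m) = i - (int k - m)"
        using i k(1) by (intro mod_pos_pos_trivial) (auto simp: m_def)
      then show "f (g i) > 0 \<longleftrightarrow> ascent m (int k - m) i"
        using k(2)[rule_format, of "nat i"] i by (auto simp: ascent_def m_def)
    qed
    then show ?thesis by blast
  next
    case False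
    have "- f (g 0) > 0" using nz[of 0] False by linarith
    moreover have "linear (\<lambda>v. - f v)" by (rule linear_compose_neg[OF lin])
    ultimately have "\<exists>k\<le>length T. \<forall>i<length T. - f (g (int i)) > 0 \<longleftrightarrow> i < k"
      using dihedral_sign_pattern[OF D, of "\<lambda>v. - f v"] nz by simp
    then obtain k where k: "k \<le> length T" "\<forall>i<length T. - f (g (int i)) > 0 \<longleftrightarrow> i < k" by blast
    have "chamber T g w (int k)"
    proof (rule extend)
      fix i :: int assume i: "0 \<le> i" "i < m"
      have *: "f (g i) > 0 \<longleftrightarrow> \<not> i < int k"
      proof -
        have "- f (g i) > 0 \<longleftrightarrow> i < int k"
          using k(2)[rule_format, of "nat i"] i by (simp add: m_def zless_nat_conj zless_nat_eq_int_zless nat_less_iff)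
        then show ?thesis using nz[of i] by linarith
      qed
      have "(i - int k) mod (2 * m) < m \<longleftrightarrow> \<not> i < int k"
      proof (cases "i < int k")
        case True
        have "(i - int k) mod (2 * m) = (i - int k + 2 * m) mod (2 * m)" by simp
        also have "\<dots> = i - int k + 2 * m"
          using i k(1) True by (intro mod_pos_pos_trivial) (auto simp: m_def)
        finally show ?thesis using True i k(1) by (simp add: m_def)
      next
        case False
        then show ?thesis using i by (subst mod_pos_pos_trivial) auto
      qed
      then show "f (g i) > 0 \<longleftrightarrow> ascent m (int k) i" using * by (simp add: ascent_def)
    qed
    then show ?thesis by blast
  qed
qed

text \<open>Start from the element \<open>e\<close> of the coset with chamber \<open>0\<close>. The elements with odd
  chamber \<open>2 i + 1\<close> are \<open>\<tau>\<^sub>i e\<close>, and those with even chamber \<open>2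
  i\<close> are \<open>\<tau>\<^sub>i \<tau>\<^sub>0 e\<close>.\<close>

lemma coset_parametrisation:
  assumes D: "dihedral T g" and u: "u \<in> W"
  obtains E k where "k \<in> {0..<2 * int (length T)}" "E k = u" "\<And>k. E k \<in> W"
    "\<And>k i. E (rot (int (length T)) k i) = reflection (g i) \<circ> E k" "\<And>k. chamber T g (E k) k"
proof -
  define m where "m = int (length T)"
  have m: "m > 0" using dihedral_length[OF D] unfolding m_def by linarith
  note root = dihedral_root[OF D]
  obtain k0 where k0: "chamber T g u k0" using chamber_exists[OF D u] by blast
  have "\<exists>e\<in>W. chamber T g e 0 \<and>
     u = (if odd k0 then reflection (g (k0 div 2)) \<circ> e else reflection (g (k0 div 2)) \<circ> (reflection (g 0) \<circ> e))"
  proof (cases "odd k0")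
    case True
    define e where "e = reflection (g (k0 div 2)) \<circ> u"
    have "2 * (k0 div 2) + 1 - k0 = 0" using True by presburger
    then have "chamber T g e 0" using chamber_step[OF D u k0, of "k0 div 2"] by (simp add: e_def)
    moreover have "e \<in> W" by (simp add: e_def W_step root u)
    moreover have "u = reflection (g (k0 div 2)) \<circ> e" by (simp add: e_def step_back)
    ultimately show ?thesis using True by auto
  next
    case False
    define e1 where "e1 = reflection (g (k0 div 2)) \<circ> u"
    define e where "e = reflection (g 0) \<circ> e1"
    have e1: "e1 \<in> W" by (simp add: e1_def W_step root u)
    have "2 * (k0 div 2) + 1 - k0 = 1" using False by presburger
    then have "chamber T g e1 1" using chamber_step[OF D u k0, of "k0 div 2"] by (simp add: e1_def)
    then have "chamber T g e 0" using chamber_step[OF D e1, of 1 0] by (simp add: e_def)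
    moreover have "e \<in> W" by (simp add: e_def W_step root e1)
    moreover have "u = reflection (g (k0 div 2)) \<circ> (reflection (g 0) \<circ> e)"
      by (simp add: e_def e1_def step_back)
    ultimately show ?thesis using False by auto
  qed
  then obtain e where e: "e \<in> W" "chamber T g e 0" and u_e: "u =
     (if odd k0 then reflection (g (k0 div 2)) \<circ> e else reflection (g (k0 div 2)) \<circ> (reflection (g 0) \<circ> e))"
    by blast
  define E where "E k = (if odd k then reflection (g (k div 2)) \<circ> e
     else reflection (g (k div 2)) \<circ> (reflection (g 0) \<circ> e))" for k
  have E_even: "E (2 * x) = reflection (g x) \<circ> (reflection (g 0) \<circ> e)"
    and E_odd: "E (2 * x + 1) = reflection (g x) \<circ> e" for x
    by (simp_all add: E_def)
  have EW: "E k \<in> W" for k by (simp add: E_def W_step root e)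
  have period: "E (k + 2 * m * n) = E k" for k n
  proof -
    have "(k + 2 * m * n) div 2 = k div 2 + m * n"
      using div_mult_self2[of 2 k "m * n"] by (simp add: mult.assoc)
    then show ?thesis
      using dihedral_reflection_periodic[OF D, of "k div 2" n] by (simp add: E_def m_def)
  qed
  have E_mod: "E (k mod (2 * m)) = E k" for k
    using period[of "k mod (2 * m)" "k div (2 * m)"] by simp
  have rotate: "reflection (g i) \<circ> reflection (g j) = reflection (g (i - j)) \<circ> reflection (g 0)" for i j
    using dihedral_rotation[OF D, of i j "- j"] by simp
  have step: "E (2 * i + 1 - k) = reflection (g i) \<circ> E k" for i k
  proof (cases "odd k")
    case True
    define j where "j = k div 2"
    have k: "k = 2 * j + 1" using True by (simp add: j_def)
    have "2 * i + 1 - k = 2 * (i - j)" by (simp add: k)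
    then have "E (2 * i + 1 - k) = reflection (g (i - j)) \<circ> (reflection (g 0) \<circ> e)" by (simp only: E_even)
    also have "\<dots> = reflection (g i) \<circ> (reflection (g j) \<circ> e)"
      using rotate[of i j] by (simp flip: comp_assoc)
    also have "\<dots> = reflection (g i) \<circ> E k" using True by (simp add: E_def j_def)
    finally show ?thesis .
  next
    case False
    define j where "j = k div 2"
    have k: "k = 2 * j" using False by (simp add: j_def)
    have "2 * i + 1 - k = 2 * (i - j) + 1" by (simp add: k)
    then have "E (2 * i + 1 - k) = reflection (g (i - j)) \<circ> e" by (simp only: E_odd)
    also have "\<dots> = (reflection (g (i - j)) \<circ> reflection (g 0)) \<circ> (reflection (g 0) \<circ> e)"
      by (simp add: comp_assoc step_back)
    also have "\<dots> = reflection (g i) \<circ> (reflection (g j) \<circ> (reflection (g 0) \<circ> e))"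
      unfolding rotate[of i j, symmetric] by (simp add: comp_assoc)
    also have "\<dots> = reflection (g i) \<circ> E k" using False by (simp add: E_def j_def)
    finally show ?thesis .
  qed
  have E0: "E 0 = e" by (simp add: E_def step_back)
  have chamber_E: "chamber T g (E k) k" for k
  proof (cases "odd k")
    case True
    then have "2 * (k div 2) + 1 - 0 = k" by presburger
    then show ?thesis using chamber_step[OF D e, of "k div 2"] True by (simp add: E_def)
  next
    case False
    have c1: "chamber T g (reflection (g 0) \<circ> e) 1" using chamber_step[OF D e, of 0] by simp
    from False have "2 * (k div 2) + 1 - 1 = k" by presburger
    then show ?thesis using chamber_step[OF D _ c1, of "k div 2"] False by (simp add: E_def W_step root e)
  qed
  show ?thesis
  proof (rule that[of "k0 mod (2 * m)" E])
    show "k0 mod (2 * m) \<in> {0..<2 * int (length T)}" using m by (simp add: m_def)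
    show "E (k0 mod (2 * m)) = u" unfolding E_mod by (simp add: E_def u_e)
    show "E (rot (int (length T)) k i) = reflection (g i) \<circ> E k" for k i
      unfolding rot_def m_def[symmetric] E_mod step by simp
  qed (rule EW, rule chamber_E)
qed

text \<open>Paths multiply on the left, but the function that walks along a list of roots takes the vertex first.\<close>

definition act :: "('a \<Rightarrow> 'a) \<Rightarrow> 'a \<Rightarrow> 'a \<Rightarrow> 'a" where
  "act w \<alpha> = reflection \<alpha> \<circ> w"

lemma W_act: "\<alpha> \<in> \<Phi> \<Longrightarrow> w \<in> W \<Longrightarrow> act w \<alpha> \<in> W"
  unfolding act_def by (rule W_step)

lemma act_act: "act (act w \<alpha>) \<alpha> = w"
  unfolding act_def by (rule step_back)

abbreviation edge :: "('a \<Rightarrow> 'a) \<Rightarrow> 'a \<Rightarrow> bool" where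
  "edge w \<alpha> \<equiv> bruhat_step P w (reflection \<alpha>)"

lemma coset_model:
  assumes D: "dihedral T g"
    and EW: "\<And>k. E k \<in> W" and step: "\<And>k i. E (rot (int (length T)) k i) = reflection (g i) \<circ> E k"
    and ch: "\<And>k. chamber T g (E k) k"
  defines "L \<equiv> \<lambda>k. real (len P (E k))"
    and "p \<equiv> height P (g 0)" and "q \<equiv> height P (g (int (length T) - 1))"
  shows "rank2_model T L p q"
    and "\<And>k i. 0 \<le> i \<Longrightarrow> i < int (length T) \<Longrightarrow> rank2_model.tight T L p q k i \<longleftrightarrow> edge (E k) (g i)"
proof -
  define m where "m = int (length T)"
  have m: "m \<ge> 2" using dihedral_length[OF D] unfolding m_def .
  note D' = dihedralD[OF D, folded m_def]
  have gP: "g 0 \<in> P" "g (m - 1) \<in> P" using D'(2) m by auto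
  have height_drop: "height_drop (E k) (g i) = of_int (fst (drop_weight T k i)) * p + of_int (snd (drop_weight T k i)) * q"
    if i: "0 \<le> i" "i < m" for k i
  proof (cases "ascent m k i")
    case True
    then show ?thesis using ch[of k] by (simp add: height_drop_def drop_weight_def chamber_def m_def)
  next
    case False
    have "height P (g i) = of_int (fst (T ! nat i)) * p + of_int (snd (T ! nat i)) * q"
      unfolding D'(5)[OF i] p_def q_def m_def[symmetric]
      using P_span[OF gP(1)] P_span[OF gP(2)] by (simp add: height_add height_scale span_scale)
    then show ?thesis using ch[of k] False by (simp add: height_drop_def drop_weight_def chamber_def m_def)
  qed
  show M: "rank2_model T L p q"
  proof
    show "T \<in> set dihedral_tables" by (rule D'(1))
    show "p \<ge> 1" "q \<ge> 1" using height_ge_1 gP by (simp_all add: p_def q_def m_def)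
    show "L (rot (int (length T)) k i) \<ge> L k + 1
          - 2 * (of_int (fst (drop_weight T k i)) * p + of_int (snd (drop_weight T k i)) * q)"
      if "k \<in> {0..<2 * int (length T)}" "i \<in> {0..<int (length T)}" for k i
      using len_step_bound[OF EW D'(2), of i k] height_drop[of i k] that by (simp add: L_def step m_def)
  qed
  show "rank2_model.tight T L p q k i \<longleftrightarrow> edge (E k) (g i)" if "0 \<le> i" "i < int (length T)" for k i
    unfolding rank2_model.tight_def[OF M]
    using bruhat_step_iff[OF EW D'(2), of i k] height_drop[of i k] that by (simp add: L_def step m_def)
qed

text \<open>The Yang--Baxter equation at \<open>\<epsilon> = 1\<close>, transported from the model along the
  parametrisation of the coset.\<close>

lemma path_sum_dihedral_rev:
  assumes D: "dihedral T g" and u: "u \<in> W"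
  shows "path_sum act edge (map g [0..int (length T) - 1]) F u =
    path_sum act edge (map g (rev [0..int (length T) - 1])) F u"
proof -
  obtain E k where k: "k \<in> {0..<2 * int (length T)}" "E k = u" and E: "\<And>k. E k \<in> W"
    "\<And>k i. E (rot (int (length T)) k i) = reflection (g i) \<circ> E k" "\<And>k. chamber T g (E k) k"
    by (rule coset_parametrisation[OF D u], rule that)
  interpret rank2_model T "\<lambda>k. real (len P (E k))" "height P (g 0)" "height P (g (int (length T) - 1))"
    by (rule coset_model(1)[OF D E])
  have "path_sum act edge (map g is) F (E k) = path_sum (rot m) tight is (\<lambda>k. F (E k)) k"
    if "set is \<subseteq> {0..<m}" for "is"
    by (rule path_sum_transfer[of k "{0..<2 * m}" "is" "rot m" E])
      (use that k(1) rot_range coset_model(2)[OF D E] E(2) in \<open>auto simp: act_def\<close>)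
  moreover have "set [0..m - 1] \<subseteq> {0..<m}" "set (rev [0..m - 1]) \<subseteq> {0..<m}" by auto
  ultimately show ?thesis
    using path_sum_rev[OF k(1)] unfolding k(2)[symmetric] by metis
qed

lemma dihedral_exchange:
  assumes D: "dihedral T g" and u: "u \<in> W" and i: "0 \<le> i'" "i' < i" "i < int (length T)"
    and e: "edge u (g i)" "edge (act u (g i)) (g i')"
  shows "\<exists>j j'. 0 \<le> j \<and> j < i \<and> j < j' \<and> j' < int (length T) \<and> edge u (g j) \<and> edge (act u (g j)) (g j') \<and>
    act (act u (g j)) (g j') = act (act u (g i)) (g i')"
proof -
  obtain E k where k: "k \<in> {0..<2 * int (length T)}" "E k = u" and E: "\<And>k. E k \<in> W"
    "\<And>k i. E (rot (int (length T)) k i) = reflection (g i) \<circ> E k" "\<And>k. chamber T g (E k) k"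
    by (rule coset_parametrisation[OF D u], rule that)
  interpret rank2_model T "\<lambda>k. real (len P (E k))" "height P (g 0)" "height P (g (int (length T) - 1))"
    by (rule coset_model(1)[OF D E])
  note tight = coset_model(2)[OF D E]
  have "tight k i" "tight (rot m k i) i'" using e i tight E(2) k(2) by (auto simp: act_def)
  then obtain j j' where j: "0 \<le> j" "j < i" "j < j'" "j' < m" "tight k j" "tight (rot m k j) j'"
    "rot m (rot m k j) j' = rot m (rot m k i) i'"
    using tight_exchange[OF k(1), of i i'] i by auto
  have "E (rot m (rot m k j) j') = E (rot m (rot m k i) i')" by (simp only: j(7))
  then have "act (act u (g j)) (g j') = act (act u (g i)) (g i')" by (simp add: E(2) k(2) act_def)
  moreover have "edge u (g j)" "edge (act u (g j)) (g j')" using j i tight E(2) k(2) by (auto simp: act_def)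
  ultimately show ?thesis using j by blast
qed

end

section \<open>Independence of the reflection ordering\<close>

lemma rev_upto_0: "rev [0..m - 1] = map (\<lambda>i. m - 1 - i) [0..m - 1]"
proof (rule nth_equalityI)
  fix i assume "i < length (rev [0..m - 1])"
  then have "i < nat m" by simp
  then have "int (nat m - Suc i) = m - 1 - int i" "[0..m - 1] ! i = int i" by (auto simp: nth_upto)
  then show "rev [0..m - 1] ! i = map (\<lambda>i. m - 1 - i) [0..m - 1] ! i"
    using \<open>i < nat m\<close> by (simp add: rev_nth nth_upto)
qed simp

context positive_roots
begin

text \<open>The roots \<open>\<beta>\<close> with \<open>\<ell>(\<tau>\<^sub>\<beta> w) < \<ell>(w)\<close>.\<close>

definition inversions :: "('a \<Rightarrow> 'a) \<Rightarrow> 'a set" where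
  "inversions w = {\<beta> \<in> P. winv w \<beta> \<notin> P}"

text \<open>A reduced word of \<open>w\<close>, recorded by the roots that become inverted one after the other. The list
  enumerates the inversions of \<open>w\<close>.\<close>

inductive chain :: "('a \<Rightarrow> 'a) \<Rightarrow> 'a list \<Rightarrow> bool" where
  chain_Nil: "chain id []"
| chain_snoc: "chain w xs \<Longrightarrow> \<delta> \<in> \<Delta> \<Longrightarrow> w \<delta> \<in> P \<Longrightarrow> chain (w \<circ> reflection \<delta>) (xs @ [w \<delta>])"

lemma finite_inversions: "finite (inversions w)"
  using finite_P by (simp add: inversions_def)

lemma inversions_id: "inversions id = {}"
  by (auto simp: inversions_def inv_id)

lemma simple_root: "\<delta> \<in> \<Delta> \<Longrightarrow> \<delta> \<in> \<Phi>"
  using \<Delta>_P P_root by blast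

lemma winv_comp_reflection:
  assumes "w \<in> W" "\<delta> \<in> \<Phi>"
  shows "winv (w \<circ> reflection \<delta>) x = reflection \<delta> (winv w x)"
  using assms by (simp add: winv_comp W_reflection inv_reflection)

lemma inversions_snoc:
  assumes w: "w \<in> W" and d: "\<delta> \<in> \<Delta>" and p: "w \<delta> \<in> P"
  shows "inversions (w \<circ> reflection \<delta>) = insert (w \<delta>) (inversions w)" "w \<delta> \<notin> inversions w"
proof -
  have dR: "\<delta> \<in> \<Phi>" using simple_root[OF d] .
  have "\<beta> \<in> inversions (w \<circ> reflection \<delta>) \<longleftrightarrow> \<beta> = w \<delta> \<or> \<beta> \<in> inversions w" for \<beta>
  proof (cases "\<beta> \<in> P")
    case True
    define x where "x = winv w \<beta>"
    have x: "x \<in> \<Phi>" unfolding x_def by (rule W_root[OF W_winv[OF w] P_root[OF True]])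
    have wx: "w x = \<beta>" by (simp add: x_def winv_right[OF w])
    have "x \<noteq> - \<delta>" using wx W_neg[OF w, of \<delta>] P_not_neg[OF p] True by auto
    moreover have "x = \<delta> \<longleftrightarrow> \<beta> = w \<delta>" using wx winv_left[OF w] by (auto simp: x_def)
    ultimately show ?thesis
      using True simple_reflection_positive_iff[OF d x]
      by (auto simp: inversions_def winv_comp_reflection[OF w dR] x_def[symmetric])
  qed (use p in \<open>auto simp: inversions_def\<close>)
  then show "inversions (w \<circ> reflection \<delta>) = insert (w \<delta>) (inversions w)" by blast
  show "w \<delta> \<notin> inversions w"
    using \<Delta>_P[OF d] by (simp add: inversions_def winv_left[OF w])
qed

lemma chain_W: "chain w xs \<Longrightarrow> w \<in> W"
  by (erule chain.induct, rule W_id, rule W_comp, assumption, rule W_reflection, erule simple_root)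

lemma chain_inversions: "chain w xs \<Longrightarrow> set xs = inversions w \<and> distinct xs"
proof (erule chain.induct)
  show "set [] = inversions id \<and> distinct []" unfolding inversions_id by simp
  show "set (xs @ [w \<delta>]) = inversions (w \<circ> reflection \<delta>) \<and> distinct (xs @ [w \<delta>])"
    if "chain w xs" "set xs = inversions w \<and> distinct xs" "\<delta> \<in> \<Delta>" "w \<delta> \<in> P" for w xs \<delta>
    using inversions_snoc[OF chain_W[OF that(1)] that(3,4)] that(2) by simp
qed

lemma chain_snocD:
  assumes "chain w (xs @ [\<beta>])"
  shows "chain (reflection \<beta> \<circ> w) xs" "\<beta> \<in> P" "\<beta> \<notin> inversions (reflection \<beta> \<circ> w)"
    "inversions w = insert \<beta> (inversions (reflection \<beta> \<circ> w))" "\<exists>\<delta>\<in>\<Delta>. \<beta> = - w \<delta>"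
proof -
  obtain v \<delta> where v: "chain v xs" "\<delta> \<in> \<Delta>" "v \<delta> \<in> P" "w = v \<circ> reflection \<delta>" "\<beta> = v \<delta>"
    using assms by (cases rule: chain.cases) auto
  have vW: "v \<in> W" using chain_W[OF v(1)] .
  have wv: "reflection \<beta> \<circ> w = v"
    using W_comp_reflection[OF vW, of \<delta>] by (simp add: v step_back)
  show "chain (reflection \<beta> \<circ> w) xs" "\<beta> \<in> P" using v wv by auto
  show "\<beta> \<notin> inversions (reflection \<beta> \<circ> w)" "inversions w = insert \<beta> (inversions (reflection \<beta> \<circ> w))"
    unfolding wv using inversions_snoc[OF vW v(2,3)] v by auto
  show "\<exists>\<delta>\<in>\<Delta>. \<beta> = - w \<delta>"
    using v W_neg[OF vW] by (intro bexI[of _ \<delta>]) (auto simp: reflection_self)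
qed

text \<open>If the inversions agree, then \<open>v\<^sup>-\<^sup>1 w\<close> maps positive roots to positive roots.\<close>

lemma inversions_inj:
  assumes v: "v \<in> W" and w: "w \<in> W" and eq: "inversions v = inversions w"
  shows "v = w"
proof -
  have winv2: "winv (winv w \<circ> v) = winv v \<circ> w"
    using winv_comp[OF W_winv[OF w] v] W_bij[OF w] by (simp add: inv_inv_eq)
  have "winv v (w \<alpha>) \<in> P" if \<alpha>: "\<alpha> \<in> P" for \<alpha>
  proof (cases "w \<alpha> \<in> P")
    case True
    then have "w \<alpha> \<notin> inversions w" using \<alpha> by (simp add: inversions_def winv_left[OF w])
    then show ?thesis using True unfolding eq[symmetric] by (simp add: inversions_def)
  next
    case False
    have r: "w \<alpha> \<in> \<Phi>" using W_root[OF w P_root[OF \<alpha>]] .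
    then have n: "- w \<alpha> \<in> P" using False uminus_P by simp
    have "winv w (- w \<alpha>) = - \<alpha>" by (simp add: W_neg[OF W_winv[OF w]] winv_left[OF w])
    then have "- w \<alpha> \<in> inversions w" using n P_not_neg[OF \<alpha>] by (simp add: inversions_def)
    then have "winv v (- w \<alpha>) \<notin> P" unfolding eq[symmetric] by (simp add: inversions_def)
    then show ?thesis
      using uminus_P[OF W_root[OF W_winv[OF v] r]] by (simp add: W_neg[OF W_winv[OF v]])
  qed
  then have "winv w \<circ> v = id"
    using W_eq_id[OF W_comp[OF W_winv[OF w] v]] by (simp add: winv2)
  then have "winv w (v x) = x" for x by (simp add: fun_eq_iff)
  then have "v x = w x" for x using winv_right[OF w, of "v x"] by metis
  then show ?thesis by blast
qed

lemma exists_simple_descent: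
  assumes w: "w \<in> W" and ne: "w \<noteq> id"
  shows "\<exists>\<delta>\<in>\<Delta>. w \<delta> \<notin> P"
proof (rule ccontr)
  assume *: "\<not> ?thesis"
  have "w \<alpha> \<in> P" if "\<alpha> \<in> P" for \<alpha>
    using that
  proof (induction \<alpha> rule: positive_root_induct)
    case (sum \<beta> \<gamma>)
    then have "w \<beta> + w \<gamma> \<in> \<Phi>" using W_root[OF w P_root[OF sum(3)]] by (simp add: W_add[OF w])
    then show ?case using sum by (simp add: W_add[OF w] P_iff inner_add_right add_pos_pos)
  qed (use * in auto)
  then have "winv w = id"
    using W_eq_id[OF W_winv[OF w]] W_bij[OF w] by (simp add: inv_inv_eq)
  then show False using ne winv_left[OF w] by (auto simp: fun_eq_iff)
qed

lemma exists_simple_ascent: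
  assumes w: "w \<in> W" and ne: "inversions w \<noteq> P"
  shows "\<exists>\<delta>\<in>\<Delta>. w \<delta> \<in> P"
proof (rule ccontr)
  assume *: "\<not> ?thesis"
  have neg: "- w \<alpha> \<in> P" if "\<alpha> \<in> P" for \<alpha>
    using that
  proof (induction \<alpha> rule: positive_root_induct)
    case (simple \<delta>)
    then show ?case using * uminus_P[OF W_root[OF w simple_root[OF simple]]] by auto
  next
    case (sum \<beta> \<gamma>)
    then have "- w (\<beta> + \<gamma>) \<in> \<Phi>" using W_root[OF w P_root[OF sum(3)]] uminus_root by blast
    then show ?case using P_pos[OF sum(4)] P_pos[OF sum(5)] by (simp add: W_add[OF w] P_iff inner_diff_right inner_add_right)
  qed
  have "winv w \<beta> \<notin> P" if "\<beta> \<in> P" for \<beta>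
    using neg[of "winv w \<beta>"] P_not_neg[OF that] by (auto simp: winv_right[OF w])
  then show False using ne by (auto simp: inversions_def)
qed

lemma chain_exists: "w \<in> W \<Longrightarrow> \<exists>xs. chain w xs"
proof (induction "card (inversions w)" arbitrary: w rule: less_induct)
  case less
  show ?case
  proof (cases "w = id")
    case True
    then show ?thesis using chain_Nil by blast
  next
    case False
    obtain \<delta> where d: "\<delta> \<in> \<Delta>" "w \<delta> \<notin> P" using exists_simple_descent[OF less.prems False] by blast
    define v where "v = w \<circ> reflection \<delta>"
    have v: "v \<in> W" using less.prems d by (simp add: v_def W_comp W_reflection simple_root)
    have vw: "v \<circ> reflection \<delta> = w" by (simp add: v_def comp_assoc reflection_comp_self)
    have "w \<delta> \<in> \<Phi>" using W_root[OF less.prems simple_root[OF d(1)]] .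
    then have vd: "v \<delta> \<in> P" using d uminus_P by (simp add: v_def reflection_self W_neg[OF less.prems])
    have "card (inversions v) < card (inversions w)"
      using inversions_snoc[OF v d(1) vd] finite_inversions[of v] by (simp add: vw)
    then obtain xs where "chain v xs" using less.hyps v by blast
    then show ?thesis using chain_snoc[of v _ \<delta>] d(1) vd unfolding vw by blast
  qed
qed

lemma chain_extend: "chain w xs \<Longrightarrow> \<exists>w' ys. chain w' (xs @ ys) \<and> inversions w' = P"
proof (induction "card (P - inversions w)" arbitrary: w xs rule: less_induct)
  case less
  have w: "w \<in> W" using chain_W[OF less.prems] .
  show ?case
  proof (cases "inversions w = P")
    case True
    then show ?thesis using less.prems by (intro exI[of _ w] exI[of _ "[]"]) simp
  next
    case False
    obtain \<delta> where d: "\<delta> \<in> \<Delta>" "w \<delta> \<in> P" using exists_simple_ascent[OF w False] by blast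
    have c: "chain (w \<circ> reflection \<delta>) (xs @ [w \<delta>])" by (rule chain_snoc[OF less.prems d])
    have "P - inversions (w \<circ> reflection \<delta>) \<subset> P - inversions w"
      using inversions_snoc[OF w d] d by auto
    then have "card (P - inversions (w \<circ> reflection \<delta>)) < card (P - inversions w)"
      using finite_P by (intro psubset_card_mono) auto
    then show ?thesis using less.hyps[OF _ c] by auto
  qed
qed

lemma path_sum_cong:
  assumes "\<And>w. w \<in> W \<Longrightarrow> F w = G w" and "set xs \<subseteq> \<Phi>" and "u \<in> W"
  shows "path_sum act edge xs F u = path_sum act edge xs G u"
  using assms(2,3)
proof (induction xs arbitrary: u)
  case (Cons x xs)
  then show ?case using W_act[of x u] by simp
qed (simp add: assms(1))

lemma tables_reverse: "T \<in> set dihedral_tables \<Longrightarrow> map prod.swap (rev T) \<in> set dihedral_tables"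
  by (auto simp: dihedral_tables_def)

text \<open>Interchanging the two simple roots of a plane.\<close>

lemma dihedral_reverse:
  assumes D: "dihedral T g"
  shows "dihedral (map prod.swap (rev T)) (\<lambda>i. g (int (length T) - 1 - i))"
proof -
  define m where "m = int (length T)"
  note D' = dihedralD[OF D, folded m_def]
  show ?thesis
    unfolding dihedral_def length_map length_rev m_def[symmetric]
  proof (intro conjI ballI allI)
    show "map prod.swap (rev T) \<in> set dihedral_tables" by (rule tables_reverse[OF D'(1)])
    show "g (m - 1 - i) \<in> P" if "i \<in> {0..<m}" for i using D'(2) that by auto
    show "g (m - 1 - (i + m)) = - g (m - 1 - i)" for i
      using D'(3)[of "m - 1 - (i + m)"] by (simp add: algebra_simps)
    show "reflection (g (m - 1 - i)) (g (m - 1 - j)) = - g (m - 1 - (2 * i - j))" for i j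
      unfolding D'(4) by (simp add: algebra_simps)
    fix i assume i: "i \<in> {0..<m}"
    have "rev T ! nat i = T ! nat (m - 1 - i)"
      using i by (subst rev_nth) (auto simp: m_def nat_diff_distrib' intro!: arg_cong[where f = "(!) T"])
    moreover have "nat i < length (rev T)" using i by (auto simp: m_def)
    ultimately have "map prod.swap (rev T) ! nat i = prod.swap (T ! nat (m - 1 - i))"
      by (simp only: nth_map)
    then show "g (m - 1 - i) = of_int (fst (map prod.swap (rev T) ! nat i)) *\<^sub>R g (m - 1 - 0)
       + of_int (snd (map prod.swap (rev T) ! nat i)) *\<^sub>R g (m - 1 - (m - 1))"
      using D'(5)[of "m - 1 - i"] i by (simp add: add.commute)
  qed
qed

lemma dihedral_negative:
  assumes D: "dihedral T g" and w: "w \<in> W" and neg: "w (g 0) \<notin> P" "w (g (int (length T) - 1)) \<notin> P"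
  shows "dihedral T (\<lambda>i. - w (g i))"
proof -
  define m where "m = int (length T)"
  have m: "m \<ge> 2" using dihedral_length[OF D] by (simp add: m_def)
  note D' = dihedralD[OF D, folded m_def]
  have comb: "- w (g i) = of_int (fst (T ! nat i)) *\<^sub>R (- w (g 0)) + of_int (snd (T ! nat i)) *\<^sub>R (- w (g (m - 1)))"
    if "0 \<le> i" "i < m" for i
    by (subst D'(5)[OF that]) (simp add: W_add[OF w] W_scale[OF w])
  have root: "- w (g i) \<in> \<Phi>" for i using W_root[OF w dihedral_root[OF D]] uminus_root by blast
  have ends: "pv \<bullet> (- w (g 0)) > 0" "pv \<bullet> (- w (g (m - 1))) > 0"
    using neg unfolding m_def[symmetric]
    by (auto simp only: uminus_P[OF W_root[OF w dihedral_root[OF D]]] intro!: P_pos)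
  have pos: "pv \<bullet> (- w (g i)) > 0" if i: "0 \<le> i" "i < m" for i
  proof -
    have "nat i < length T" using i by (simp add: m_def)
    note xy = dihedral_table_facts(4)[OF D'(1) this]
    have "pv \<bullet> (- w (g i)) = of_int (fst (T ! nat i)) * (pv \<bullet> (- w (g 0)))
        + of_int (snd (T ! nat i)) * (pv \<bullet> (- w (g (m - 1))))"
      by (subst comb[OF i]) (simp only: inner_add_right inner_scaleR_right)
    moreover have "0 \<le> of_int (fst (T ! nat i)) * (pv \<bullet> (- w (g 0)))"
      "0 \<le> of_int (snd (T ! nat i)) * (pv \<bullet> (- w (g (m - 1))))"
      using xy ends by (intro mult_nonneg_nonneg; simp)+
    moreover have "0 < of_int (fst (T ! nat i)) * (pv \<bullet> (- w (g 0))) \<or>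
      0 < of_int (snd (T ! nat i)) * (pv \<bullet> (- w (g (m - 1))))"
    proof -
      have "fst (T ! nat i) > 0 \<or> snd (T ! nat i) > 0" using xy by linarith
      then show ?thesis using ends by (metis mult_pos_pos of_int_0_less_iff)
    qed
    ultimately show ?thesis by linarith
  qed
  show ?thesis
    unfolding dihedral_def m_def[symmetric]
  proof (intro conjI ballI allI)
    show "- w (g i) \<in> P" if "i \<in> {0..<m}" for i using root pos that by (simp add: P_iff)
    show "- w (g (i + m)) = - (- w (g i))" for i by (simp add: D'(3) W_neg[OF w])
    show "reflection (- w (g i)) (- w (g j)) = - (- w (g (2 * i - j)))" for i j
      by (simp add: reflection_uminus reflection_minus D'(4) W_neg[OF w] flip: W_conj[OF w])
    show "- w (g i) = of_int (fst (T ! nat i)) *\<^sub>R (- w (g 0)) + of_int (snd (T ! nat i)) *\<^sub>R (- w (g (m - 1)))"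
      if "i \<in> {0..<m}" for i by (rule comb) (use that in auto)
  qed (rule D'(1))
qed

text \<open>If \<open>w\<close> makes both simple roots of the plane negative, then a chain of \<open>w\<close> can end
  with all positive roots of the image of the plane. Going down from \<open>w\<close>, the roots \<open>- w
  (g 0), - w (g 1), \<dots>\<close> are removed one by one; the invariant of the induction says that each of
  them comes from one of the two simple roots, alternately.\<close>

lemma chain_dihedral_end:
  assumes D: "dihedral T g" and w: "w \<in> W" and simple: "g 0 \<in> \<Delta>" "g (int (length T) - 1) \<in> \<Delta>"
    and D': "dihedral T (\<lambda>i. - w (g i))"
  shows "\<exists>x\<in>W. inversions x = inversions w - (\<lambda>i. - w (g i)) ` {0..<int (length T)} \<and>
    (\<forall>ys. chain x ys \<longrightarrow> chain w (ys @ map (\<lambda>i. - w (g i)) (rev [0..int (length T) - 1])))"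
proof -
  define m where "m = int (length T)"
  define \<zeta> where "\<zeta> i = - w (g i)" for i
  have zP: "\<zeta> i \<in> P" if "0 \<le> i" "i < m" for i
    using dihedralD(2)[OF D'] that by (simp add: \<zeta>_def m_def)
  have "\<exists>x\<in>W. inversions x = inversions w - \<zeta> ` {0..<int n} \<and>
      (\<forall>ys. chain x ys \<longrightarrow> chain w (ys @ map \<zeta> (rev [0..int n - 1]))) \<and>
      winv x (w (g (int n))) \<in> {g 0, g (m - 1)} \<and> - winv x (w (g (int n - 1))) \<in> {g 0, g (m - 1)}"
    if "n \<le> length T" for n
    using that
  proof (induction n)
    case 0
    have "- g (- 1) = g (m - 1)" using dihedralD(3)[OF D, of "-1"] by (simp add: m_def)
    then show ?case using w by (intro bexI[of _ w]) (auto simp: winv_left)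
  next
    case (Suc n)
    then obtain x where x: "x \<in> W" "inversions x = inversions w - \<zeta> ` {0..<int n}"
      and ch: "\<And>ys. chain x ys \<Longrightarrow> chain w (ys @ map \<zeta> (rev [0..int n - 1]))"
      and A: "winv x (w (g (int n))) \<in> {g 0, g (m - 1)}" and B: "- winv x (w (g (int n - 1))) \<in> {g 0, g (m - 1)}"
      by auto
    define \<sigma> where "\<sigma> = winv x (w (g (int n)))"
    have \<sigma>: "\<sigma> \<in> \<Delta>" using A simple by (auto simp: \<sigma>_def m_def)
    have x\<sigma>: "x \<sigma> = - \<zeta> (int n)" by (simp add: \<sigma>_def winv_right[OF x(1)] \<zeta>_def)
    define y where "y = x \<circ> reflection \<sigma>"
    have y: "y \<in> W" using x \<sigma> by (simp add: y_def W_comp W_reflection simple_root)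
    have yx: "y \<circ> reflection \<sigma> = x" by (simp add: y_def comp_assoc reflection_comp_self)
    have n: "int n < m" using Suc.prems by (simp add: m_def)
    have y\<sigma>: "y \<sigma> = \<zeta> (int n)" by (simp add: y_def reflection_self W_neg[OF x(1)] x\<sigma>)
    then have y\<sigma>P: "y \<sigma> \<in> P" using zP n by simp
    note inv = inversions_snoc[OF y \<sigma> y\<sigma>P, unfolded yx y\<sigma>]
    have invy: "inversions y = inversions w - \<zeta> ` {0..<int (Suc n)}"
    proof -
      have "{0..<int (Suc n)} = insert (int n) {0..<int n}" by auto
      then show ?thesis using inv x(2) by auto
    qed
    have z: "winv y (w (g i)) = winv x (w (- g (2 * int n - i)))" for i
    proof -
      have "reflection \<sigma> (winv x (w (g i))) = winv x (reflection (x \<sigma>) (w (g i)))"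
        using winv_conj[OF x(1), of \<sigma> "w (g i)"] by simp
      also have "\<dots> = winv x (w (reflection (g (int n)) (g i)))"
        by (simp add: x\<sigma> \<zeta>_def W_conj[OF w])
      finally show ?thesis
        by (simp add: y_def winv_comp_reflection[OF x(1) simple_root[OF \<sigma>]] dihedralD(4)[OF D])
    qed
    have "winv y (w (g (int (Suc n)))) = - winv x (w (g (int n - 1)))"
    proof -
      have "2 * int n - int (Suc n) = int n - 1" by simp
      then show ?thesis unfolding z by (simp add: W_neg[OF w] W_neg[OF W_winv[OF x(1)]])
    qed
    moreover have "- winv y (w (g (int (Suc n) - 1))) = winv x (w (g (int n)))"
      unfolding z by (simp add: W_neg[OF w] W_neg[OF W_winv[OF x(1)]])
    moreover have "chain w (ys @ map \<zeta> (rev [0..int (Suc n) - 1]))" if "chain y ys" for ys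
    proof -
      have "chain x (ys @ [\<zeta> (int n)])"
        using chain_snoc[OF that \<sigma> y\<sigma>P] by (simp only: yx y\<sigma>)
      moreover have "[0..int (Suc n) - 1] = [0..int n - 1] @ [int n]"
        using upto_rec2[of 0 "int n"] by simp
      ultimately show ?thesis using ch by fastforce
    qed
    ultimately show ?case using y invy A B by (intro bexI[of _ y]) auto
  qed
  from this[of "length T"] obtain x where "x \<in> W" "inversions x = inversions w - \<zeta> ` {0..<int (length T)}"
    "\<forall>ys. chain x ys \<longrightarrow> chain w (ys @ map \<zeta> (rev [0..int (length T) - 1]))" by blast
  moreover have "(\<lambda>i. - w (g i)) = \<zeta>" by (simp add: \<zeta>_def fun_eq_iff)
  ultimately show ?thesis by metis
qed

lemma dihedral_reverse_image:
  "(\<lambda>i. g (m - 1 - i)) ` {0..<m} = g ` {0..<m}" for m :: int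
proof -
  have "(\<lambda>i. m - 1 - i) ` {0..<m} = {0..<m}"
  proof (intro subset_antisym subsetI)
    fix i assume "i \<in> {0..<m}"
    then show "i \<in> (\<lambda>i. m - 1 - i) ` {0..<m}" by (intro image_eqI[of _ _ "m - 1 - i"]) auto
  qed auto
  then show ?thesis by (metis image_image)
qed

lemma chain_card_less:
  assumes "chain w (xs @ [\<beta>])"
  shows "card (inversions (reflection \<beta> \<circ> w)) < card (inversions w)"
  unfolding chain_snocD(4)[OF assms] card_insert_disjoint[OF finite_inversions chain_snocD(3)[OF assms]]
  by simp

text \<open>Two chains that end with the same root are compared by induction. If the last roots differ, both chains are
  compared with chains that end with all positive roots of the plane of these two roots. In this plane the
  two orders are possible, and they have the same effect by the Yang--Baxter equation. They continue the
  same element \<open>x\<close>, because its inversions are determined.\<close>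

lemma path_sum_chain:
  "chain w xs \<Longrightarrow> chain w ys \<Longrightarrow> u \<in> W \<Longrightarrow> path_sum act edge xs F u = path_sum act edge ys F u"
proof (induction "card (inversions w)" arbitrary: w xs ys u F rule: less_induct)
  case less
  have w: "w \<in> W" using chain_W[OF less.prems(1)] .
  have same: "path_sum act edge (xs @ [\<beta>]) F u = path_sum act edge (ys @ [\<beta>]) F u"
    if "chain w (xs @ [\<beta>])" "chain w (ys @ [\<beta>])" for xs ys \<beta>
    unfolding path_sum_append
    by (rule less.hyps[OF chain_card_less[OF that(1)] chain_snocD(1)[OF that(1)] chain_snocD(1)[OF that(2)] less.prems(3)])
  show ?case
  proof (cases "xs = [] \<or> ys = []")
    case True
    have "set xs = set ys"
      using chain_inversions[OF less.prems(1)] chain_inversions[OF less.prems(2)] by simp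
    then have "xs = [] \<and> ys = []" using True by (metis set_empty)
    then show ?thesis by simp
  next
    case False
    then obtain xs' \<beta> ys' \<beta>' where xs: "xs = xs' @ [\<beta>]" and ys: "ys = ys' @ [\<beta>']"
      by (metis append_butlast_last_id)
    obtain \<delta> where d: "\<delta> \<in> \<Delta>" "\<beta> = - w \<delta>" using chain_snocD(5)[OF less.prems(1)[unfolded xs]] by blast
    obtain \<delta>' where d': "\<delta>' \<in> \<Delta>" "\<beta>' = - w \<delta>'" using chain_snocD(5)[OF less.prems(2)[unfolded ys]] by blast
    have bP: "\<beta> \<in> P" "\<beta>' \<in> P" using chain_snocD(2)[OF less.prems(1)[unfolded xs]] chain_snocD(2)[OF less.prems(2)[unfolded ys]] by auto
    show ?thesis
    proof (cases "\<delta> = \<delta>'")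
      case True
      then have eq: "\<beta>' = \<beta>" using d d' by simp
      show ?thesis unfolding xs ys eq
        by (rule same[OF less.prems(1)[unfolded xs] less.prems(2)[unfolded ys eq]])
    next
      case False
      obtain T g where D: "dihedral T g" and g: "g 0 = \<delta>" "g (int (length T) - 1) = \<delta>'"
        using dihedral_exists[OF d(1) d'(1) False] by blast
      define m where "m = int (length T)"
      define \<zeta> where "\<zeta> i = - w (g i)" for i
      have m: "m \<ge> 2" using dihedral_length[OF D] by (simp add: m_def)
      have neg: "w (g 0) \<notin> P" "w (g (int (length T) - 1)) \<notin> P"
        using P_not_neg[of "w \<delta>"] P_not_neg[of "w \<delta>'"] bP by (auto simp: g d d')
      have Dz: "dihedral T \<zeta>" unfolding \<zeta>_def by (rule dihedral_negative[OF D w neg])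
      obtain x where x: "x \<in> W" "inversions x = inversions w - \<zeta> ` {0..<m}"
        and cx: "\<And>zs. chain x zs \<Longrightarrow> chain w (zs @ map \<zeta> (rev [0..m - 1]))"
        using chain_dihedral_end[OF D w _ _ Dz[unfolded \<zeta>_def]] d(1) d'(1) g
        unfolding \<zeta>_def[symmetric] m_def[symmetric] by metis
      define g' where "g' i = g (m - 1 - i)" for i
      have D': "dihedral (map prod.swap (rev T)) g'"
        using dihedral_reverse[OF D] unfolding g'_def m_def .
      have Dz': "dihedral (map prod.swap (rev T)) (\<lambda>i. - w (g' i))"
        using dihedral_reverse[OF Dz] unfolding g'_def \<zeta>_def m_def .
      have g': "g' 0 \<in> \<Delta>" "g' (m - 1) \<in> \<Delta>" using d d' g by (auto simp: g'_def m_def)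
      obtain x' where x': "x' \<in> W" "inversions x' = inversions w - (\<lambda>i. - w (g' i)) ` {0..<m}"
        and cx': "\<And>zs. chain x' zs \<Longrightarrow> chain w (zs @ map (\<lambda>i. - w (g' i)) (rev [0..m - 1]))"
        using chain_dihedral_end[OF D' w _ _ Dz'] g'
        unfolding length_map length_rev m_def[symmetric] by metis
      have "(\<lambda>i. - w (g' i)) ` {0..<m} = \<zeta> ` {0..<m}"
        using dihedral_reverse_image[of \<zeta> m] by (simp only: g'_def \<zeta>_def)
      then have "x' = x" using inversions_inj[OF x'(1) x(1)] x(2) x'(2) by simp
      obtain zs where zs: "chain x zs" using chain_exists[OF x(1)] by blast
      have "map (\<lambda>i. - w (g' i)) (rev [0..m - 1]) = map \<zeta> [0..m - 1]"
        unfolding rev_upto_0 map_map by (simp add: g'_def \<zeta>_def o_def)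
      then have c1: "chain w (zs @ map \<zeta> [0..m - 1])" using cx' zs \<open>x' = x\<close> by metis
      have c2: "chain w (zs @ map \<zeta> (rev [0..m - 1]))" using cx zs by blast
      have z: "\<zeta> 0 = \<beta>" "\<zeta> (m - 1) = \<beta>'" using g d d' by (auto simp: \<zeta>_def m_def)
      have l1: "map \<zeta> [0..m - 1] = map \<zeta> [0..m - 2] @ [\<beta>']"
        using upto_rec2[of 0 "m - 1"] m z by simp
      have l2: "map \<zeta> (rev [0..m - 1]) = map \<zeta> (rev [1..m - 1]) @ [\<beta>]"
        using upto_rec1[of 0 "m - 1"] m z by simp
      have "path_sum act edge xs F u = path_sum act edge (zs @ map \<zeta> (rev [0..m - 1])) F u"
        using same[of xs' \<beta> "zs @ map \<zeta> (rev [1..m - 1])"] less.prems(1) c2 unfolding xs l2 by simp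
      also have "\<dots> = path_sum act edge (zs @ map \<zeta> [0..m - 1]) F u"
        unfolding path_sum_append
      proof (rule path_sum_cong)
        show "path_sum act edge (map \<zeta> (rev [0..m - 1])) F v = path_sum act edge (map \<zeta> [0..m - 1]) F v"
          if "v \<in> W" for v
          using path_sum_dihedral_rev[OF Dz that] unfolding m_def by simp
        show "set zs \<subseteq> \<Phi>" using chain_inversions[OF zs] P_root by (auto simp: inversions_def)
      qed (rule less.prems(3))
      also have "\<dots> = path_sum act edge ys F u"
        using same[of ys' \<beta>' "zs @ map \<zeta> [0..m - 2]"] less.prems(2) c1 unfolding ys l1 by simp
      finally show ?thesis .
    qed
  qed
qed

end

section \<open>Reflection orderings\<close>

context positive_roots
begin

definition ascending :: "(('a \<Rightarrow> 'a) \<Rightarrow> nat) \<Rightarrow> int \<Rightarrow> (int \<Rightarrow> 'a) \<Rightarrow> bool" where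
  "ascending \<phi> m g \<longleftrightarrow>
     (\<forall>i j. 0 \<le> i \<longrightarrow> i < j \<longrightarrow> j < m \<longrightarrow> \<phi> (reflection (g i)) < \<phi> (reflection (g j)))"

text \<open>All that is needed from a reflection ordering, in a form that can be reversed.\<close>

definition plane_monotone :: "(('a \<Rightarrow> 'a) \<Rightarrow> nat) \<Rightarrow> bool" where
  "plane_monotone \<phi> \<longleftrightarrow> (\<forall>\<alpha>\<in>P. \<forall>\<beta>\<in>P. \<alpha> \<noteq> \<beta> \<longrightarrow>
     (\<exists>T g. dihedral T g \<and> P \<inter> span {\<alpha>, \<beta>} = g ` {0..<int (length T)} \<and>
       ascending \<phi> (int (length T)) g))"

lemma dihedral_inj:
  assumes D: "dihedral T g"
  shows "inj_on g {0..<int (length T)}"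
proof (rule linorder_inj_onI)
  fix i j assume ij: "i < j" "i \<in> {0..<int (length T)}" "j \<in> {0..<int (length T)}"
  note D4 = dihedralD(4)[OF D]
  show "g i \<noteq> g j"
  proof
    assume "g i = g j"
    \<comment> \<open>Up to sign, the two reflections take the root with index \<open>i + j\<close> to those with indices \<open>i - j\<close> and \<open>j - i\<close>.\<close>
    then have "reflection (g i) (g (i + j)) = reflection (g j) (g (i + j))" by simp
    then have "g (- (j - i)) = g (j - i)" by (simp add: D4)
    moreover have "g (- (j - i)) = - g (int (length T) - (j - i))"
      using dihedralD(3)[OF D, of "- (j - i)"] by (simp add: algebra_simps)
    moreover have "g (int (length T) - (j - i)) \<in> P" "g (j - i) \<in> P"
      using dihedralD(2)[OF D] ij by auto
    ultimately show False using P_not_neg by metis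
  qed
qed auto

text \<open>The words \<open>a, a b a, a b a b a, \<dots>\<close> of the definition of a reflection ordering run through
  the reflections in angular order.\<close>

lemma dihedral_alternating:
  assumes D: "dihedral T g"
  shows "reflection (g 0) \<circ> (reflection (g (int (length T) - 1)) \<circ> reflection (g 0)) ^^ i = reflection (g (int i))"
proof (induction i)
  case (Suc i)
  have b: "reflection (g (int (length T) - 1)) = reflection (g (- 1))"
    using dihedral_reflection_periodic[OF D, of "-1" 1] by (simp add: algebra_simps)
  have "reflection (g (- 1)) \<circ> reflection (g 0) = reflection (g (int i)) \<circ> reflection (g (int (Suc i)))"
    using dihedral_rotation[OF D, of "-1" 0 "int i + 1"] by (simp add: algebra_simps)
  then have "reflection (g 0) \<circ> (reflection (g (int (length T) - 1)) \<circ> reflection (g 0)) ^^ Suc i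
    = (reflection (g 0) \<circ> (reflection (g (int (length T) - 1)) \<circ> reflection (g 0)) ^^ i)
      \<circ> (reflection (g (int i)) \<circ> reflection (g (int (Suc i))))"
    unfolding funpow_Suc_right b by (simp only: comp_assoc)
  also have "\<dots> = reflection (g (int i)) \<circ> (reflection (g (int i)) \<circ> reflection (g (int (Suc i))))"
    unfolding Suc ..
  also have "\<dots> = reflection (g (int (Suc i)))" by (rule step_back)
  finally show ?case .
qed (simp only: funpow.simps comp_id of_nat_0)

lemma generate_span:
  assumes "w \<in> generate (BijGroup UNIV) (reflection ` X)" "X \<subseteq> span B"
  shows "w x - x \<in> span B"
proof -
  obtain ts where ts: "set ts \<subseteq> reflection ` X" "w = word_map ts"
    using assms(1) unfolding generate_reflections by blast
  have "word_map ts x - x \<in> span B"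
    using ts(1)
  proof (induction ts)
    case (Cons t ts)
    then obtain \<alpha> where a: "\<alpha> \<in> X" "t = reflection \<alpha>" by auto
    have "t y - y \<in> span B" for y
      using a assms(2) by (auto simp: reflection_def intro!: span_neg span_scale)
    from span_add[OF this[of "word_map ts x"] Cons.IH] Cons.prems show ?case by simp
  qed (simp add: span_zero)
  then show ?thesis by (simp add: ts)
qed

text \<open>The plane belongs to the reflection subgroup generated by its reflections: an element of this subgroup moves
  every vector within the plane, so it contains no other reflections, and its canonical generators are the
  reflections in the simple roots of the plane.\<close>

lemma reflection_ordering_dihedral:
  assumes ro: "reflection_ordering \<Phi> P N \<phi>"
    and D: "dihedral T g" and plane: "P \<inter> span B = g ` {0..<int (length T)}"
    and simple: "simple_roots (P \<inter> span B) = {g 0, g (int (length T) - 1)}"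
  shows "ascending \<phi> (int (length T)) g \<or>
    ascending \<phi> (int (length T)) (\<lambda>i. g (int (length T) - 1 - i))"
proof -
  define m where "m = int (length T)"
  have m: "m \<ge> 2" using dihedral_length[OF D] by (simp add: m_def)
  define W' where "W' = generate (BijGroup UNIV) (reflection ` (P \<inter> span B))"
  define a b where "a = reflection (g 0)" and "b = reflection (g (m - 1))"
  have in_W': "reflection \<alpha> \<in> W' \<longleftrightarrow> \<alpha> \<in> span B" if "\<alpha> \<in> P" for \<alpha>
  proof
    assume "reflection \<alpha> \<in> W'"
    from generate_span[OF this[unfolded W'_def], of B \<alpha>] have "- \<alpha> - \<alpha> \<in> span B"
      by (simp add: reflection_self)
    then have "(- 1 / 2) *\<^sub>R (- \<alpha> - \<alpha>) \<in> span B" by (rule span_scale)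
    also have "(- 1 / 2) *\<^sub>R (- \<alpha> - \<alpha>) = (1 / 2 + 1 / 2) *\<^sub>R \<alpha>" by (simp only: scaleR_left.add) (simp add: algebra_simps)
    finally show "\<alpha> \<in> span B" by simp
  qed (use that in \<open>auto simp: W'_def intro: generate.incl\<close>)
  have sub: "subsystem \<Phi> W' \<inter> P = P \<inter> span B"
    using in_W' P_root by (auto simp: subsystem_def)
  have gP: "g 0 \<in> P" "g (m - 1) \<in> P" using dihedralD(2)[OF D, folded m_def] m by auto
  have "reflection_subgroup \<Phi> P W'"
    unfolding reflection_subgroup_def W'_def reflections_eq
    by (intro exI[of _ "reflection ` (P \<inter> span B)"] conjI refl image_mono Int_lower1)
  moreover have "canonical_generators \<Phi> P W' = {a, b}"
    unfolding canonical_generators_def sub simple_reflections_def simple by (simp add: a_def b_def m_def)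
  moreover have "a \<noteq> b"
    using reflection_inj[OF gP] dihedral_ends_distinct[OF D] by (auto simp: a_def b_def m_def)
  moreover have "card (reflections \<Phi> P \<inter> W') = length T"
  proof -
    have "reflections \<Phi> P \<inter> W' = reflection ` (P \<inter> span B)"
      unfolding reflections_eq using in_W' by auto
    moreover have "inj_on reflection (P \<inter> span B)" by (rule inj_onI) (auto intro: reflection_inj)
    ultimately have "card (reflections \<Phi> P \<inter> W') = card (P \<inter> span B)" by (simp add: card_image)
    also have "\<dots> = length T" unfolding plane by (simp add: card_image[OF dihedral_inj[OF D]])
    finally show ?thesis .
  qed
  ultimately have "sorted_wrt (<) (map (\<lambda>i. \<phi> (a \<circ> (b \<circ> a) ^^ i)) [0..<length T]) \<or>
    sorted_wrt (>) (map (\<lambda>i. \<phi> (a \<circ> (b \<circ> a) ^^ i)) [0..<length T])"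
    using ro unfolding reflection_ordering_def Let_def by metis
  moreover have "a \<circ> (b \<circ> a) ^^ i = reflection (g (int i))" for i
    unfolding a_def b_def m_def by (rule dihedral_alternating[OF D])
  ultimately have s: "sorted_wrt (<) (map (\<lambda>i. \<phi> (reflection (g (int i)))) [0..<length T]) \<or>
    sorted_wrt (>) (map (\<lambda>i. \<phi> (reflection (g (int i)))) [0..<length T])" by simp
  from s show ?thesis
  proof
    assume *: "sorted_wrt (<) (map (\<lambda>i. \<phi> (reflection (g (int i)))) [0..<length T])"
    have "\<phi> (reflection (g i)) < \<phi> (reflection (g j))" if "0 \<le> i" "i < j" "j < int (length T)" for i j
      using *[unfolded sorted_wrt_iff_nth_less, rule_format, of "nat i" "nat j"] that by simp
    then show ?thesis by (simp add: ascending_def)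
  next
    assume *: "sorted_wrt (>) (map (\<lambda>i. \<phi> (reflection (g (int i)))) [0..<length T])"
    have "\<phi> (reflection (g j)) < \<phi> (reflection (g i))" if "0 \<le> i" "i < j" "j < int (length T)" for i j
      using *[unfolded sorted_wrt_iff_nth_less, rule_format, of "nat i" "nat j"] that by simp
    then show ?thesis by (simp add: ascending_def)
  qed
qed

lemma plane_monotoneI:
  assumes "\<And>\<alpha> \<beta>. \<alpha> \<in> P \<Longrightarrow> \<beta> \<in> P \<Longrightarrow> \<alpha> \<noteq> \<beta> \<Longrightarrow>
     \<exists>T g. dihedral T g \<and> P \<inter> span {\<alpha>, \<beta>} = g ` {0..<int (length T)} \<and>
       (ascending \<phi> (int (length T)) g \<or> ascending \<phi> (int (length T)) (\<lambda>i. g (int (length T) - 1 - i)))"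
  shows "plane_monotone \<phi>"
  unfolding plane_monotone_def
proof (intro ballI impI)
  fix \<alpha> \<beta> assume "\<alpha> \<in> P" "\<beta> \<in> P" "\<alpha> \<noteq> \<beta>"
  then obtain T g where D: "dihedral T g" and im: "P \<inter> span {\<alpha>, \<beta>} = g ` {0..<int (length T)}"
    and mono: "ascending \<phi> (int (length T)) g \<or> ascending \<phi> (int (length T)) (\<lambda>i. g (int (length T) - 1 - i))"
    using assms by meson
  from mono show "\<exists>T g. dihedral T g \<and> P \<inter> span {\<alpha>, \<beta>} = g ` {0..<int (length T)} \<and>
      ascending \<phi> (int (length T)) g"
  proof
    assume "ascending \<phi> (int (length T)) (\<lambda>i. g (int (length T) - 1 - i))"
    then show ?thesis
      by (intro exI[of _ "map prod.swap (rev T)"] exI[of _ "\<lambda>i. g (int (length T) - 1 - i)"] conjI)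
        (use dihedral_reverse[OF D] in \<open>simp_all add: im dihedral_reverse_image\<close>)
  qed (use D im in blast)
qed

lemma reflection_ordering_plane_monotone:
  assumes "reflection_ordering \<Phi> P N \<phi>"
  shows "plane_monotone \<phi>"
proof (rule plane_monotoneI)
  fix \<alpha> \<beta> assume ab: "\<alpha> \<in> P" "\<beta> \<in> P" "\<alpha> \<noteq> \<beta>"
  obtain T g where D: "dihedral T g" and im: "P \<inter> span {\<alpha>, \<beta>} = g ` {0..<int (length T)}"
    and s: "simple_roots (P \<inter> span {\<alpha>, \<beta>}) = {g 0, g (int (length T) - 1)}"
    by (rule dihedral_plane[OF ab])
  show "\<exists>T g. dihedral T g \<and> P \<inter> span {\<alpha>, \<beta>} = g ` {0..<int (length T)} \<and>
       (ascending \<phi> (int (length T)) g \<or>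
        ascending \<phi> (int (length T)) (\<lambda>i. g (int (length T) - 1 - i)))"
    using reflection_ordering_dihedral[OF assms D im s] D im by blast
qed

lemma positive_pair_independent:
  assumes a: "a \<in> P" and b: "b \<in> P" and ab: "a \<noteq> b" and eq: "x *\<^sub>R a + y *\<^sub>R b = x' *\<^sub>R a + y' *\<^sub>R b"
  shows "x = x' \<and> y = y'"
proof -
  have e: "(y' - y) *\<^sub>R b = (x - x') *\<^sub>R a" using eq by (simp add: algebra_simps)
  have "y' = y"
  proof (rule ccontr)
    assume ne: "y' \<noteq> y"
    have "inverse (y' - y) *\<^sub>R ((y' - y) *\<^sub>R b) = inverse (y' - y) *\<^sub>R ((x - x') *\<^sub>R a)" using e by simp
    then have "b = (inverse (y' - y) * (x - x')) *\<^sub>R a" using ne by simp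
    from P_parallel[OF a b this] show False using ab by simp
  qed
  then show ?thesis using e root_nz[OF P_root[OF a]] by simp
qed

text \<open>The slope of a sum of two vectors lies between their slopes, and a reflection ordering sorts the roots of a
  plane by slope.\<close>

lemma plane_monotone_between:
  assumes mono: "plane_monotone \<phi>" and b: "\<beta> \<in> P" and c: "\<gamma> \<in> P" and s: "\<beta> + \<gamma> \<in> P"
  defines "f \<equiv> \<lambda>\<alpha>. \<phi> (reflection \<alpha>)"
  shows "f \<beta> < f (\<beta> + \<gamma>) \<and> f (\<beta> + \<gamma>) < f \<gamma> \<or> f \<gamma> < f (\<beta> + \<gamma>) \<and> f (\<beta> + \<gamma>) < f \<beta>"
proof -
  have ne: "\<beta> \<noteq> \<gamma>"
  proof
    assume "\<beta> = \<gamma>"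
    then have "2 *\<^sub>R \<beta> \<in> P" using s by (simp add: scaleR_2)
    then show False using reduced_pos[OF b] by fastforce
  qed
  obtain T g where D: "dihedral T g" and im: "P \<inter> span {\<beta>, \<gamma>} = g ` {0..<int (length T)}"
    and mo: "\<And>i j. 0 \<le> i \<Longrightarrow> i < j \<Longrightarrow> j < int (length T) \<Longrightarrow> f (g i) < f (g j)"
    using mono b c ne unfolding plane_monotone_def ascending_def f_def by meson
  note tab = dihedral_table_facts[OF dihedralD(1)[OF D]]
  have "\<beta> \<in> P \<inter> span {\<beta>, \<gamma>}" "\<gamma> \<in> P \<inter> span {\<beta>, \<gamma>}" "\<beta> + \<gamma> \<in> P \<inter> span {\<beta>, \<gamma>}"
    using b c s by (auto intro: span_base span_add)
  then obtain i j l where i: "0 \<le> i" "i < int (length T)" "\<beta> + \<gamma> = g i" and j: "0 \<le> j" "j < int (length T)" "\<beta> = g j"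
    and l: "0 \<le> l" "l < int (length T)" "\<gamma> = g l"
    unfolding im by (auto simp: image_iff)
  define x y where "x i = fst (T ! nat i)" and "y i = snd (T ! nat i)" for i
  define a b where "a = g 0" and "b = g (int (length T) - 1)"
  have g: "g i = of_int (x i) *\<^sub>R a + of_int (y i) *\<^sub>R b" if "0 \<le> i" "i < int (length T)" for i
    using dihedralD(5)[OF D that] by (simp add: x_def y_def a_def b_def)
  have abP: "a \<in> P" "b \<in> P"
    unfolding a_def b_def by (rule dihedralD(2)[OF D]; use dihedral_length[OF D] in linarith)+
  have ab: "a \<noteq> b" using dihedral_ends_distinct[OF D] by (simp add: a_def b_def)
  have "of_int (x i) *\<^sub>R a + of_int (y i) *\<^sub>R b = g j + g l" using g[OF i(1,2)] i(3) j(3) l(3) by simp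
  also have "\<dots> = of_int (x j + x l) *\<^sub>R a + of_int (y j + y l) *\<^sub>R b"
    unfolding g[OF j(1,2)] g[OF l(1,2)] by (simp add: algebra_simps)
  finally have "real_of_int (x i) = of_int (x j + x l) \<and> real_of_int (y i) = of_int (y j + y l)"
    by (rule positive_pair_independent[OF abP ab])
  then have xy: "x i = x j + x l" "y i = y j + y l" by linarith+
  have slope: "x j * y i < x i * y j" if "0 \<le> i" "i < j" "j < int (length T)" for i j
    using tab(5)[of "nat i" "nat j"] that by (simp add: x_def y_def)
  have "i \<noteq> j" using i(3) j(3) root_nz[OF P_root[OF c]] by auto
  have "i \<noteq> l" using i(3) l(3) root_nz[OF P_root[OF \<open>\<beta> \<in> P\<close>]] by auto
  have "\<not> (i < j \<and> i < l)"
  proof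
    assume "i < j \<and> i < l"
    then have "x j * y i < x i * y j" "x l * y i < x i * y l" using slope i j l by auto
    then have "(x j + x l) * y i < x i * (y j + y l)" by (simp add: algebra_simps)
    then show False using xy by simp
  qed
  moreover have "\<not> (j < i \<and> l < i)"
  proof
    assume "j < i \<and> l < i"
    then have "x i * y j < x j * y i" "x i * y l < x l * y i" using slope i j l by auto
    then have "x i * (y j + y l) < (x j + x l) * y i" by (simp add: algebra_simps)
    then show False using xy by simp
  qed
  ultimately have "j < i \<and> i < l \<or> l < i \<and> i < j" using \<open>i \<noteq> j\<close> \<open>i \<noteq> l\<close> by linarith
  then show ?thesis using mo i j l by auto
qed

text \<open>The initial sections of a reflection ordering are inversion sets, by induction. If \<open>w\<close> belongs
  to the roots before \<open>\<beta>\<close>, then \<open>w\<^sup>-\<^sup>1 \<beta>\<close> is positive, and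
  the point is that it is simple. If it were a sum of positive roots, then \<open>\<beta>\<close> would be
  the sum of their images, and \<open>\<beta>\<close> has to lie between the two. If both images are
  positive, they are not inversions, so both come after \<open>\<beta>\<close>. If one of them is negative,
  its opposite is an inversion, and the other image lies between that root and \<open>\<beta>\<close>,
  although it is not an inversion.\<close>

lemma chain_of_ordering:
  assumes mono: "plane_monotone \<phi>" and xs: "set xs = P" "sorted_wrt (\<lambda>x y. \<phi> (reflection x) < \<phi> (reflection y)) xs"
  shows "\<exists>w. chain w xs"
proof -
  define f where "f \<alpha> = \<phi> (reflection \<alpha>)" for \<alpha>
  have sorted: "f (xs ! i) < f (xs ! j)" if "i < j" "j < length xs" for i j
    using xs(2) that by (simp add: sorted_wrt_iff_nth_less f_def)
  have "\<exists>w. chain w (take n xs)" if "n \<le> length xs" for n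
    using that
  proof (induction n)
    case 0
    then show ?case using chain_Nil by auto
  next
    case (Suc n)
    then obtain w where ch: "chain w (take n xs)" by auto
    have w: "w \<in> W" using chain_W[OF ch] .
    define \<beta> where "\<beta> = xs ! n"
    have n: "n < length xs" using Suc.prems by simp
    have b: "\<beta> \<in> P" using n xs(1) by (auto simp: \<beta>_def)
    have inv: "x \<in> inversions w \<longleftrightarrow> f x < f \<beta>" if x: "x \<in> P" for x
    proof -
      obtain k where k: "k < length xs" "x = xs ! k" using x xs(1) by (metis in_set_conv_nth)
      have "x \<in> inversions w \<longleftrightarrow> x \<in> set (take n xs)" using chain_inversions[OF ch] by simp
      also have "\<dots> \<longleftrightarrow> k < n"
      proof
        assume "x \<in> set (take n xs)"
        then obtain k' where "k' < n" "x = xs ! k'" using n by (auto simp: in_set_conv_nth)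
        then show "k < n" using sorted[of k' k] k n by (cases "k' < k") auto
      next
        assume "k < n"
        then show "x \<in> set (take n xs)" using k n by (auto simp: in_set_conv_nth)
      qed
      also have "\<dots> \<longleftrightarrow> f x < f \<beta>"
        using sorted[of k n] sorted[of n k] k n unfolding \<beta>_def by (cases k n rule: linorder_cases) auto
      finally show ?thesis .
    qed
    define \<delta> where "\<delta> = winv w \<beta>"
    have w\<delta>: "w \<delta> = \<beta>" by (simp add: \<delta>_def winv_right[OF w])
    have "\<beta> \<notin> inversions w" using inv[OF b] by simp
    then have dP: "\<delta> \<in> P" using b by (simp add: inversions_def \<delta>_def)
    have neg: "- w x \<in> inversions w" if "x \<in> P" "w x \<notin> P" for x
    proof -
      have "- w x \<in> P" using uminus_P[OF W_root[OF w P_root]] that by blast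
      moreover have "winv w (- w x) = - x" by (simp add: W_neg[OF W_winv[OF w]] winv_left[OF w])
      ultimately show ?thesis using P_not_neg[OF that(1)] by (simp add: inversions_def)
    qed
    have posi: "\<not> f (w x) < f \<beta>" if "x \<in> P" "w x \<in> P" for x
      using inv[OF that(2)] that(1) by (simp add: inversions_def winv_left[OF w])
    have "\<not> (\<exists>x\<in>P. \<exists>y\<in>P. \<delta> = x + y)"
    proof
      assume "\<exists>x\<in>P. \<exists>y\<in>P. \<delta> = x + y"
      then obtain x y where xy: "x \<in> P" "y \<in> P" "\<delta> = x + y" by auto
      have bsum: "\<beta> = w x + w y" using w\<delta> xy(3) by (simp add: W_add[OF w])
      \<comment> \<open>The case of a negative image: its opposite comes before \<open>\<beta>\<close>.\<close>
      have mixed: False if p: "p \<in> P" "q \<in> P" "\<beta> = w p + w q" "w p \<notin> P" for p q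
      proof -
        have n1: "- w p \<in> inversions w" by (rule neg[OF p(1,4)])
        then have nP: "- w p \<in> P" and less: "f (- w p) < f \<beta>" using inv by (auto simp: inversions_def)
        have e: "w q = \<beta> + (- w p)" using p(3) by simp
        have "pv \<bullet> w q > 0" unfolding e inner_add_right using P_pos[OF b] P_pos[OF nP] by linarith
        then have qP: "w q \<in> P" using W_root[OF w P_root[OF p(2)]] by (simp add: P_iff)
        have "f \<beta> < f (w q) \<and> f (w q) < f (- w p) \<or> f (- w p) < f (w q) \<and> f (w q) < f \<beta>"
          using plane_monotone_between[OF mono b nP] qP unfolding e f_def by blast
        then show False using posi[OF p(2) qP] less by linarith
      qed
      show False
      proof (cases "w x \<in> P \<and> w y \<in> P")
        case True
        have "f (w x) < f \<beta> \<and> f \<beta> < f (w y) \<or> f (w y) < f \<beta> \<and> f \<beta> < f (w x)"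
          using plane_monotone_between[OF mono, of "w x" "w y"] True b unfolding bsum f_def by blast
        then show False using posi xy True by blast
      next
        case False
        then show False using mixed[of x y] mixed[of y x] xy bsum by (auto simp: add.commute)
      qed
    qed
    then have "\<delta> \<in> \<Delta>" using dP by (simp add: simple_roots_def)
    then have "chain (w \<circ> reflection \<delta>) (take n xs @ [w \<delta>])"
      by (rule chain_snoc[OF ch]) (simp add: w\<delta> b)
    moreover have "take n xs @ [w \<delta>] = take (Suc n) xs" using n by (simp add: w\<delta> \<beta>_def take_Suc_conv_app_nth)
    ultimately show ?case by auto
  qed
  from this[of "length xs"] show ?thesis by simp
qed

section \<open>Counting increasing paths\<close>

lemma full_chain_start:
  assumes c: "chain w xs" "inversions w = P" and d: "\<delta> \<in> \<Delta>"
  shows "\<exists>ys. chain w (\<delta> # ys)"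
proof -
  have "chain (id \<circ> reflection \<delta>) ([] @ [id \<delta>])"
    by (rule chain_snoc[OF chain_Nil d]) (simp add: \<Delta>_P d)
  from chain_extend[OF this] obtain v ys where v: "chain v (([] @ [id \<delta>]) @ ys)" "inversions v = P" by auto
  have "v = w" using inversions_inj[OF chain_W[OF v(1)] chain_W[OF c(1)]] v(2) c(2) by simp
  then show ?thesis using v(1) by auto
qed

text \<open>The last root of a chain of the longest element \<open>w\<close> is \<open>- w \<sigma>\<close> for a simple
  root \<open>\<sigma>\<close>, and \<open>- w\<close> permutes the simple roots.\<close>

lemma full_chain_end:
  assumes c: "chain w xs" "inversions w = P" and d: "\<delta> \<in> \<Delta>"
  shows "\<exists>ys. chain w (ys @ [\<delta>])"
proof -
  have w: "w \<in> W" using chain_W[OF c(1)] .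
  have flip: "- winv w \<beta> \<in> P" if "\<beta> \<in> P" for \<beta>
  proof -
    have "\<beta> \<in> inversions w" using that c(2) by simp
    then show ?thesis using uminus_P[OF W_root[OF W_winv[OF w] P_root[OF that]]] by (simp add: inversions_def)
  qed
  have flip': "- w \<beta> \<in> P" if "\<beta> \<in> P" for \<beta>
  proof -
    have "w \<beta> \<notin> P"
      using flip[of "w \<beta>"] P_not_neg[OF that] by (auto simp: winv_left[OF w])
    then show ?thesis using uminus_P[OF W_root[OF w P_root[OF that]]] by simp
  qed
  \<comment> \<open>The root with \<open>- w \<sigma> = \<delta>\<close>.\<close>
  define \<sigma> where "\<sigma> = - winv w \<delta>"
  have ws: "w \<sigma> = - \<delta>" by (simp add: \<sigma>_def W_neg[OF w] winv_right[OF w])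
  have "\<sigma> \<in> P" unfolding \<sigma>_def by (rule flip[OF \<Delta>_P[OF d]])
  moreover have "\<not> (\<exists>x\<in>P. \<exists>y\<in>P. \<sigma> = x + y)"
  proof
    assume "\<exists>x\<in>P. \<exists>y\<in>P. \<sigma> = x + y"
    then obtain x y where xy: "x \<in> P" "y \<in> P" "\<sigma> = x + y" by auto
    have "\<delta> = - w \<sigma>" using ws by simp
    also have "\<dots> = - w x + - w y" using xy(3) by (simp add: W_add[OF w])
    finally have "\<exists>x\<in>P. \<exists>y\<in>P. \<delta> = x + y" using flip' xy by blast
    then show False using d by (simp add: simple_roots_def)
  qed
  ultimately have s: "\<sigma> \<in> \<Delta>" by (simp add: simple_roots_def)
  define x where "x = w \<circ> reflection \<sigma>"
  have x: "x \<in> W" by (simp add: x_def W_comp W_reflection w simple_root[OF s])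
  have xs: "x \<sigma> = \<delta>" by (simp add: x_def reflection_self W_neg[OF w] ws)
  obtain ys where "chain x ys" using chain_exists[OF x] by blast
  then have "chain (x \<circ> reflection \<sigma>) (ys @ [x \<sigma>])" by (rule chain_snoc) (use s xs \<Delta>_P[OF d] in auto)
  moreover have "x \<circ> reflection \<sigma> = w" by (simp add: x_def comp_assoc reflection_comp_self)
  ultimately show ?thesis using xs by auto
qed

definition delta :: "('a \<Rightarrow> 'a) \<Rightarrow> ('a \<Rightarrow> 'a) \<Rightarrow> nat" where
  "delta v w = (if w = v then 1 else 0)"

lemma word_map_invariant:
  assumes step: "\<And>w \<delta>. w \<in> W \<Longrightarrow> \<delta> \<in> \<Delta> \<Longrightarrow> Q (act w \<delta>) = Q w" and u: "u \<in> W"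
  shows "Q u = Q id"
proof -
  obtain ts where ts: "set ts \<subseteq> reflection ` \<Delta>" "word_map ts = u" using W_word[OF u] by blast
  have "Q (word_map ts) = Q id"
    using ts(1)
  proof (induction ts)
    case (Cons t ts)
    then obtain \<delta> where d: "\<delta> \<in> \<Delta>" "t = reflection \<delta>" by auto
    have "word_map ts \<in> W" using Cons.prems by (intro word_map_W) simp
    from step[OF this d(1)] have "Q (word_map (t # ts)) = Q (word_map ts)"
      unfolding act_def d(2) word_map.simps .
    also have "\<dots> = Q id" using Cons.prems by (intro Cons.IH) simp
    finally show ?case .
  qed simp
  then show ?thesis using ts by simp
qed

text \<open>The factor of a simple reflection \<open>s\<close> is \<open>F \<mapsto> F + F \<circ> s\<close>, because
  both steps between \<open>w\<close> and \<open>s w\<close> are edges. Moving \<open>s\<close> to the front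
  of the ordering shows that the number of paths does not change when the start is multiplied by
  \<open>s\<close>, and moving it to the end shows the same for the end point.\<close>

lemma path_sum_delta_const:
  assumes c: "chain w xs" "inversions w = P" and u: "u \<in> W" "u' \<in> W" and v: "v \<in> W" "v' \<in> W"
  shows "path_sum act edge xs (delta v) u = path_sum act edge xs (delta v') u'"
proof -
  have pair: "path_sum act edge [\<delta>] F z = F z + F (act z \<delta>)" if "z \<in> W" "\<delta> \<in> \<Delta>" for F z \<delta>
    using simple_edge[OF that] by simp
  have left: "path_sum act edge xs F (act z \<delta>) = path_sum act edge xs F z" if z: "z \<in> W" and d: "\<delta> \<in> \<Delta>" for F z \<delta>
  proof -
    obtain ys where ys: "chain w (\<delta> # ys)" using full_chain_start[OF c d] by blast
    have za: "act z \<delta> \<in> W" by (rule W_act[OF simple_root[OF d] z])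
    have "path_sum act edge xs F z = path_sum act edge ys F z + path_sum act edge ys F (act z \<delta>)" if z: "z \<in> W" for z
      using path_sum_chain[OF c(1) ys z, of F] simple_edge[OF z d] by simp
    from this[OF z] this[OF za] show ?thesis by (simp add: act_act)
  qed
  have right: "path_sum act edge xs (delta (act z \<delta>)) u = path_sum act edge xs (delta z) u"
    if z: "z \<in> W" and d: "\<delta> \<in> \<Delta>" and u: "u \<in> W" for z \<delta> u
  proof -
    obtain ys where ys: "chain w (ys @ [\<delta>])" using full_chain_end[OF c d] by blast
    have sub: "set ys \<subseteq> \<Phi>" using chain_inversions[OF ys] P_root by (auto simp: inversions_def)
    have "path_sum act edge ys (path_sum act edge [\<delta>] (delta (act z \<delta>))) u
      = path_sum act edge ys (path_sum act edge [\<delta>] (delta z)) u"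
    proof (rule path_sum_cong[OF _ sub u])
      fix y assume y: "y \<in> W"
      have A: "y = act z \<delta> \<longleftrightarrow> act y \<delta> = z" by (metis act_act)
      have B: "act y \<delta> = act z \<delta> \<longleftrightarrow> y = z" by (metis act_act)
      show "path_sum act edge [\<delta>] (delta (act z \<delta>)) y = path_sum act edge [\<delta>] (delta z) y"
        unfolding pair[OF y d] delta_def A B by (rule add.commute)
    qed
    then show ?thesis
      using path_sum_chain[OF c(1) ys u] by (simp only: path_sum_append)
  qed
  have "path_sum act edge xs (delta v) u = path_sum act edge xs (delta v) id"
    by (rule word_map_invariant[OF left u(1)])
  also have "\<dots> = path_sum act edge xs (delta id) id"
    by (rule word_map_invariant[OF right[OF _ _ W_id] v(1)])
  also have "\<dots> = path_sum act edge xs (delta v') id"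
    by (rule word_map_invariant[OF right[OF _ _ W_id] v(2), symmetric])
  also have "\<dots> = path_sum act edge xs (delta v') u'"
    by (rule word_map_invariant[OF left u(2), symmetric])
  finally show ?thesis .
qed

end

lemma labels_simps: "labels \<phi> [] = []" "labels \<phi> (e # p) = \<phi> (snd e) # labels \<phi> p"
  "labels \<phi> (p @ q) = labels \<phi> p @ labels \<phi> q" "length (labels \<phi> p) = length p"
  "set (labels \<phi> p) = \<phi> ` snd ` set p"
  by (auto simp: labels_def case_prod_unfold)

lemma lexord_trichotomy:
  fixes xs ys :: "nat list"
  assumes "length xs = length ys"
  shows "(xs, ys) \<in> lexord {(i, j). i < j} \<or> xs = ys \<or> (ys, xs) \<in> lexord {(i, j). i < j}"
  using assms by (induction xs ys rule: list_induct2) auto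

lemma lexord_flip:
  fixes xs ys :: "nat list"
  assumes "length xs = length ys" "set xs \<subseteq> {1..N}" "set ys \<subseteq> {1..N}"
    and "(map (\<lambda>i. N + 1 - i) xs, map (\<lambda>i. N + 1 - i) ys) \<in> lexord {(i, j). i < j}"
  shows "(ys, xs) \<in> lexord {(i, j). i < j}"
  using assms by (induction xs ys rule: list_induct2) auto

context positive_roots
begin

lemma bruhat_path_Nil: "bruhat_path \<Phi> P u [] v \<longleftrightarrow> u \<in> W \<and> u = v"
  by (simp add: bruhat_path_def pre_digraph.awalk_def pre_digraph.cas.simps bruhat_digraph_def)

lemma bruhat_path_Cons:
  "bruhat_path \<Phi> P u (e # p) v \<longleftrightarrow>
     u \<in> W \<and> (\<exists>\<alpha>\<in>P. e = (u, reflection \<alpha>) \<and> edge u \<alpha> \<and> bruhat_path \<Phi> P (act u \<alpha>) p v)"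
proof -
  obtain x \<tau> where e: "e = (x, \<tau>)" by (cases e)
  have "bruhat_path \<Phi> P u (e # p) v \<longleftrightarrow> u \<in> W \<and> x = u \<and> \<tau> \<in> reflection ` P \<and> bruhat_step P u \<tau> \<and>
      (set p \<subseteq> arcs (bruhat_digraph \<Phi> P) \<and> pre_digraph.cas (bruhat_digraph \<Phi> P) (\<tau> \<circ> u) p v)"
    by (auto simp: bruhat_path_def pre_digraph.awalk_def pre_digraph.cas.simps bruhat_digraph_def e reflections_eq)
  also have "\<dots> \<longleftrightarrow> u \<in> W \<and> (\<exists>\<alpha>\<in>P. e = (u, reflection \<alpha>) \<and> edge u \<alpha> \<and>
      (set p \<subseteq> arcs (bruhat_digraph \<Phi> P) \<and> pre_digraph.cas (bruhat_digraph \<Phi> P) (act u \<alpha>) p v))"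
    unfolding e act_def by blast
  also have "\<dots> \<longleftrightarrow> u \<in> W \<and> (\<exists>\<alpha>\<in>P. e = (u, reflection \<alpha>) \<and> edge u \<alpha> \<and> bruhat_path \<Phi> P (act u \<alpha>) p v)"
    using W_act[OF P_root] by (auto simp: bruhat_path_def pre_digraph.awalk_def bruhat_digraph_def)
  finally show ?thesis .
qed

lemma bruhat_path_ConsI:
  "u \<in> W \<Longrightarrow> \<alpha> \<in> P \<Longrightarrow> edge u \<alpha> \<Longrightarrow> bruhat_path \<Phi> P (act u \<alpha>) p v \<Longrightarrow>
    bruhat_path \<Phi> P u ((u, reflection \<alpha>) # p) v"
  unfolding bruhat_path_Cons by blast

lemma bruhat_path_W: "bruhat_path \<Phi> P u p v \<Longrightarrow> u \<in> W"
  by (cases p) (auto simp: bruhat_path_Nil bruhat_path_Cons)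

lemma bruhat_path_append:
  "bruhat_path \<Phi> P u (p @ q) v \<longleftrightarrow> (\<exists>w. bruhat_path \<Phi> P u p w \<and> bruhat_path \<Phi> P w q v)"
proof (induction p arbitrary: u)
  case Nil
  then show ?case using bruhat_path_W by (auto simp: bruhat_path_Nil)
next
  case (Cons e p)
  then show ?case by (auto simp: bruhat_path_Cons)
qed

lemma bruhat_path_reflections: "bruhat_path \<Phi> P u p v \<Longrightarrow> snd ` set p \<subseteq> reflection ` P"
  by (induction p arbitrary: u) (auto simp: bruhat_path_Cons)

lemma bruhat_path_length: "bruhat_path \<Phi> P u p v \<Longrightarrow> len P v \<le> len P u + length p"
proof (induction p arbitrary: u)
  case (Cons e p)
  then obtain \<alpha> where "edge u \<alpha>" "bruhat_path \<Phi> P (act u \<alpha>) p v" by (auto simp: bruhat_path_Cons)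
  moreover have "len P (act u \<alpha>) \<le> len P u + 1"
    using \<open>edge u \<alpha>\<close> by (auto simp: bruhat_step_def act_def)
  ultimately show ?case using Cons.IH by fastforce
qed (simp add: bruhat_path_Nil)

lemma bruhat_path_exists:
  assumes u: "u \<in> W" and v: "v \<in> W"
  shows "\<exists>p. bruhat_path \<Phi> P u p v"
proof -
  obtain ts where ts: "set ts \<subseteq> reflection ` \<Delta>" "word_map ts = v \<circ> winv u"
    using W_word[OF W_comp[OF v W_winv[OF u]]] by blast
  have "\<exists>p. bruhat_path \<Phi> P u p (word_map ts \<circ> u)"
    using ts(1)
  proof (induction ts)
    case Nil
    have "bruhat_path \<Phi> P u [] u" using u by (simp add: bruhat_path_Nil)
    then show ?case unfolding word_map.simps id_comp by blast
  next
    case (Cons t ts)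
    then have "set ts \<subseteq> reflection ` \<Delta>" by simp
    from Cons.IH[OF this] obtain p where p: "bruhat_path \<Phi> P u p (word_map ts \<circ> u)" by blast
    obtain \<delta> where d: "\<delta> \<in> \<Delta>" "t = reflection \<delta>" using Cons.prems by auto
    define z where "z = word_map ts \<circ> u"
    have z: "z \<in> W" unfolding z_def using Cons.prems u by (intro W_comp word_map_W) auto
    have "bruhat_path \<Phi> P z [(z, reflection \<delta>)] (act z \<delta>)"
      using z d \<Delta>_P[OF d(1)] simple_edge[OF z d(1)] W_act[OF simple_root[OF d(1)] z]
      by (auto simp: bruhat_path_Cons bruhat_path_Nil)
    then have "bruhat_path \<Phi> P u (p @ [(z, reflection \<delta>)]) (act z \<delta>)"
      using p unfolding bruhat_path_append z_def by blast
    moreover have "act z \<delta> = word_map (t # ts) \<circ> u"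
      unfolding act_def z_def word_map.simps d(2) comp_assoc ..
    ultimately show ?case by metis
  qed
  moreover have "word_map ts \<circ> u = v"
    unfolding ts(2) by (auto simp: fun_eq_iff winv_left[OF u])
  ultimately show ?thesis by simp
qed

definition increasing_paths :: "(('a \<Rightarrow> 'a) \<Rightarrow> nat) \<Rightarrow> 'a list \<Rightarrow> ('a \<Rightarrow> 'a) \<Rightarrow> ('a \<Rightarrow> 'a) \<Rightarrow> (('a \<Rightarrow> 'a) \<times> ('a \<Rightarrow> 'a)) list set" where
  "increasing_paths \<phi> xs u v =
     {p. bruhat_path \<Phi> P u p v \<and> sorted_wrt (<) (labels \<phi> p) \<and> snd ` set p \<subseteq> reflection ` set xs}"

lemma increasing_paths_Nil: "u \<in> W \<Longrightarrow> increasing_paths \<phi> [] u v = (if u = v then {[]} else {})"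
  by (auto simp: increasing_paths_def bruhat_path_Nil labels_simps)

text \<open>Since \<open>x\<close> has the smallest label, only the first step of an increasing path can use it.\<close>

lemma increasing_paths_Cons:
  assumes xs: "set (x # xs) \<subseteq> P" "sorted_wrt (\<lambda>x y. \<phi> (reflection x) < \<phi> (reflection y)) (x # xs)" and u: "u \<in> W"
  shows "increasing_paths \<phi> (x # xs) u v = increasing_paths \<phi> xs u v \<union>
      (if edge u x then (#) (u, reflection x) ` increasing_paths \<phi> xs (act u x) v else {})"
    (is "?L = ?A \<union> ?B")
    and "increasing_paths \<phi> xs u v \<inter>
      (if edge u x then (#) (u, reflection x) ` increasing_paths \<phi> xs (act u x) v else {}) = {}"
proof -
  have less: "\<phi> (reflection x) < \<phi> \<tau>" if "\<tau> \<in> reflection ` set xs" for \<tau> using xs(2) that by auto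
  have "reflection x \<notin> reflection ` set xs" using less by blast
  then show "?A \<inter> ?B = {}"
    by (auto simp: increasing_paths_def split: if_splits)
  show "?L = ?A \<union> ?B"
  proof (intro subset_antisym subsetI)
    fix p assume p: "p \<in> ?L"
    show "p \<in> ?A \<union> ?B"
    proof (cases p)
      case Nil
      then show ?thesis using p by (auto simp: increasing_paths_def)
    next
      case (Cons e q)
      then obtain \<alpha> where \<alpha>: "\<alpha> \<in> P" "e = (u, reflection \<alpha>)" "edge u \<alpha>" "bruhat_path \<Phi> P (act u \<alpha>) q v"
        using p by (auto simp: increasing_paths_def bruhat_path_Cons)
      have q: "sorted_wrt (<) (labels \<phi> q)" "\<And>\<tau>. \<tau> \<in> snd ` set q \<Longrightarrow> \<phi> (reflection \<alpha>) < \<phi> \<tau>"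
        "snd ` set q \<subseteq> reflection ` set (x # xs)" "reflection \<alpha> \<in> reflection ` set (x # xs)"
        using p \<alpha>(2) by (auto simp: increasing_paths_def Cons labels_simps)
      show ?thesis
      proof (cases "reflection \<alpha> = reflection x")
        case True
        then have "\<alpha> = x" using reflection_inj \<alpha>(1) xs(1) by auto
        have "snd ` set q \<subseteq> reflection ` set xs"
        proof
          fix \<tau> assume "\<tau> \<in> snd ` set q"
          then show "\<tau> \<in> reflection ` set xs" using q(2)[of \<tau>] q(3) True by auto
        qed
        then have "q \<in> increasing_paths \<phi> xs (act u x) v"
          using \<alpha>(4) q(1) \<open>\<alpha> = x\<close> by (simp add: increasing_paths_def)
        then show ?thesis using \<alpha> Cons \<open>\<alpha> = x\<close> by auto
      next
        case False
        then have in_xs: "reflection \<alpha> \<in> reflection ` set xs" using q(4) by auto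
        have "snd ` set q \<subseteq> reflection ` set xs"
        proof
          fix \<tau> assume "\<tau> \<in> snd ` set q"
          then show "\<tau> \<in> reflection ` set xs" using q(2)[of \<tau>] q(3) less[OF in_xs] by auto
        qed
        then have "p \<in> ?A" using p in_xs \<alpha>(2) by (auto simp: increasing_paths_def Cons)
        then show ?thesis by blast
      qed
    qed
  next
    fix p assume "p \<in> ?A \<union> ?B"
    then show "p \<in> ?L"
    proof
      assume "p \<in> ?A"
      then show ?thesis by (auto simp: increasing_paths_def)
    next
      assume "p \<in> ?B"
      then obtain q where q: "edge u x" "p = (u, reflection x) # q" "q \<in> increasing_paths \<phi> xs (act u x) v"
        by (auto split: if_splits)
      have "\<phi> (reflection x) < l" if "l \<in> set (labels \<phi> q)" for l
        using that q(3) less by (auto simp: increasing_paths_def labels_simps)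
      then show ?thesis using q u xs(1) by (auto simp: increasing_paths_def labels_simps bruhat_path_Cons)
    qed
  qed
qed

lemma card_increasing_paths:
  assumes "set xs \<subseteq> P" "sorted_wrt (\<lambda>x y. \<phi> (reflection x) < \<phi> (reflection y)) xs" "u \<in> W"
  shows "finite (increasing_paths \<phi> xs u v) \<and> card (increasing_paths \<phi> xs u v) = path_sum act edge xs (delta v) u"
  using assms
proof (induction xs arbitrary: u)
  case Nil
  then show ?case by (simp add: increasing_paths_Nil delta_def)
next
  case (Cons x xs)
  have x: "x \<in> \<Phi>" using Cons.prems P_root by auto
  have IH: "finite (increasing_paths \<phi> xs w v) \<and> card (increasing_paths \<phi> xs w v) = path_sum act edge xs (delta v) w"
    if "w \<in> W" for w using Cons.IH[OF _ _ that] Cons.prems by simp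
  note dec = increasing_paths_Cons[OF Cons.prems, of v]
  have inj: "inj_on ((#) (u, reflection x)) A" for A by simp
  show ?case
    using IH[OF Cons.prems(3)] IH[OF W_act[OF x Cons.prems(3)]] dec(2) unfolding dec(1)
    by (auto simp: card_Un_disjoint card_image[OF inj])
qed

lemma labels_determine_path:
  assumes inj: "inj_on \<phi> (reflection ` P)"
  shows "bruhat_path \<Phi> P u p v \<Longrightarrow> bruhat_path \<Phi> P u q v' \<Longrightarrow> labels \<phi> p = labels \<phi> q \<Longrightarrow> p = q"
proof (induction p arbitrary: u q)
  case Nil
  then show ?case by (cases q) (auto simp: labels_simps)
next
  case (Cons e p)
  then obtain e' q' where q: "q = e' # q'" by (cases q) (auto simp: labels_simps)
  obtain \<alpha> where a: "\<alpha> \<in> P" "e = (u, reflection \<alpha>)" "bruhat_path \<Phi> P (act u \<alpha>) p v"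
    using Cons.prems(1) by (auto simp: bruhat_path_Cons)
  obtain \<beta> where b: "\<beta> \<in> P" "e' = (u, reflection \<beta>)" "bruhat_path \<Phi> P (act u \<beta>) q' v'"
    using Cons.prems(2) by (auto simp: q bruhat_path_Cons)
  have "reflection \<alpha> = reflection \<beta>"
    using inj Cons.prems(3) a b by (auto simp: labels_simps q inj_on_def)
  then have "\<alpha> = \<beta>" using reflection_inj a b by blast
  then show ?case using Cons.IH[OF a(3)] b Cons.prems(3) a q by (auto simp: labels_simps)
qed

section \<open>Shortest paths\<close>

text \<open>Two consecutive steps with equal labels cancel. Two steps with decreasing labels are exchanged inside the
  plane of their roots, where the first label becomes smaller.\<close>

lemma descent_improvable:
  assumes bij: "bij_betw \<phi> (reflections \<Phi> P) {1..N}" and mono: "plane_monotone \<phi>"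
    and p: "bruhat_path \<Phi> P u p v" and ns: "\<not> sorted_wrt (<) (labels \<phi> p)"
  shows "\<exists>q. bruhat_path \<Phi> P u q v \<and> (labels \<phi> q, labels \<phi> p) \<in> lenlex {(i, j). i < j}"
proof -
  obtain i where i: "Suc i < length p" "\<not> labels \<phi> p ! i < labels \<phi> p ! Suc i"
    using ns by (auto simp: sorted_wrt_iff_nth_Suc_transp labels_simps)
  define p1 p2 e e' where "p1 = take i p" and "p2 = drop (Suc (Suc i)) p" and "e = p ! i" and "e' = p ! Suc i"
  have "p = take i p @ p ! i # drop (Suc i) p" by (rule id_take_nth_drop) (use i(1) in simp)
  moreover have "drop (Suc i) p = p ! Suc i # drop (Suc (Suc i)) p"
    by (rule Cons_nth_drop_Suc[symmetric, OF i(1)])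
  ultimately have split: "p = p1 @ e # e' # p2"
    unfolding p1_def p2_def e_def e'_def by metis
  have lab: "\<phi> (snd e') \<le> \<phi> (snd e)"
    using i by (simp add: labels_def case_prod_unfold e_def e'_def)
  obtain x where x: "bruhat_path \<Phi> P u p1 x" "bruhat_path \<Phi> P x (e # e' # p2) v"
    using p unfolding split bruhat_path_append by blast
  then obtain \<alpha> \<beta> where a: "\<alpha> \<in> P" "e = (x, reflection \<alpha>)" "edge x \<alpha>" and b: "\<beta> \<in> P" "e' = (act x \<alpha>, reflection \<beta>)"
    "edge (act x \<alpha>) \<beta>" and rest: "bruhat_path \<Phi> P (act (act x \<alpha>) \<beta>) p2 v" and xW: "x \<in> W"
    by (auto simp: bruhat_path_Cons)
  show ?thesis
  proof (cases "\<alpha> = \<beta>")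
    case True
    then have "bruhat_path \<Phi> P u (p1 @ p2) v" using x(1) rest unfolding bruhat_path_append by (auto simp: act_act)
    then show ?thesis by (intro exI[of _ "p1 @ p2"]) (simp add: lenlex_conv labels_simps split)
  next
    case False
    have "reflection \<alpha> \<noteq> reflection \<beta>" using reflection_inj a b False by blast
    then have "\<phi> (reflection \<alpha>) \<noteq> \<phi> (reflection \<beta>)"
      using bij a b unfolding bij_betw_def inj_on_def reflections_eq by blast
    then have less: "\<phi> (reflection \<beta>) < \<phi> (reflection \<alpha>)" using lab a b by simp
    obtain T g where D: "dihedral T g" and im: "P \<inter> span {\<alpha>, \<beta>} = g ` {0..<int (length T)}"
      and mo: "\<And>i j. 0 \<le> i \<Longrightarrow> i < j \<Longrightarrow> j < int (length T) \<Longrightarrow> \<phi> (reflection (g i)) < \<phi> (reflection (g j))"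
      using mono a b False unfolding plane_monotone_def ascending_def by meson
    have "\<alpha> \<in> P \<inter> span {\<alpha>, \<beta>}" "\<beta> \<in> P \<inter> span {\<alpha>, \<beta>}" using a b by (auto intro: span_base)
    then obtain i i' where i: "0 \<le> i" "i < int (length T)" "\<alpha> = g i" and i': "0 \<le> i'" "i' < int (length T)" "\<beta> = g i'"
      unfolding im by (auto simp: image_iff)
    have "i' < i" using mo[of i i'] less False i i' by (cases i i' rule: linorder_cases) auto
    from dihedral_exchange[OF D xW i'(1) this i(2)] a(3) b(3)
    obtain j j' where j: "0 \<le> j" "j < i" "j < j'" "j' < int (length T)" "edge x (g j)" "edge (act x (g j)) (g j')"
      "act (act x (g j)) (g j') = act (act x \<alpha>) \<beta>"
      unfolding i(3) i'(3) by blast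
    define q where "q = p1 @ (x, reflection (g j)) # (act x (g j), reflection (g j')) # p2"
    have gP: "g j \<in> P" "g j' \<in> P" using dihedralD(2)[OF D] j i by auto
    have "bruhat_path \<Phi> P x ((x, reflection (g j)) # (act x (g j), reflection (g j')) # p2) v"
      using xW W_act[OF P_root[OF gP(1)] xW] gP j(5,6) rest
      by (intro bruhat_path_ConsI) (simp_all add: j(7))
    then have "bruhat_path \<Phi> P u q v" using x(1) unfolding q_def bruhat_path_append by blast
    moreover have "\<phi> (reflection (g j)) < \<phi> (reflection \<alpha>)" using mo[of j i] j i by simp
    then have "(labels \<phi> q, labels \<phi> p) \<in> lenlex {(i, j). i < j}"
      by (simp add: lenlex_conv lexord_lex labels_simps q_def split a lexord_same_pref_iff)
    ultimately show ?thesis by blast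
  qed
qed

text \<open>The smallest path, first by length and then lexicographically, cannot be improved, so it has no descent.\<close>

lemma minimal_path:
  assumes bij: "bij_betw \<phi> (reflections \<Phi> P) {1..N}" and mono: "plane_monotone \<phi>"
    and u: "u \<in> W" and v: "v \<in> W"
  shows "\<exists>p. bruhat_path \<Phi> P u p v \<and> sorted_wrt (<) (labels \<phi> p) \<and> length p = path_dist \<Phi> P u v \<and>
    (\<forall>q. shortest_path \<Phi> P u q v \<longrightarrow> lex_le (labels \<phi> p) (labels \<phi> q))"
proof -
  define R where "R = inv_image (lenlex {(i, j). (i::nat) < j}) (labels \<phi>)"
  have "{(i, j). (i::nat) < j} = less_than" by auto
  then have "wf R" unfolding R_def by (intro wf_inv_image wf_lenlex) simp
  obtain p0 where "bruhat_path \<Phi> P u p0 v" using bruhat_path_exists[OF u v] by blast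
  then have "p0 \<in> {p. bruhat_path \<Phi> P u p v}" by simp
  from \<open>wf R\<close>[unfolded wf_eq_minimal, rule_format, OF this]
  obtain p where p: "bruhat_path \<Phi> P u p v" and min: "\<And>q. (q, p) \<in> R \<Longrightarrow> \<not> bruhat_path \<Phi> P u q v"
    by auto
  have sorted: "sorted_wrt (<) (labels \<phi> p)"
    using descent_improvable[OF bij mono p] min unfolding R_def in_inv_image by blast
  have shortest: "length p \<le> length q" if "bruhat_path \<Phi> P u q v" for q
  proof (rule ccontr)
    assume "\<not> length p \<le> length q"
    then have "(q, p) \<in> R" by (simp add: R_def lenlex_conv labels_simps)
    then show False using min that by blast
  qed
  have dist: "path_dist \<Phi> P u v = length p"
    unfolding path_dist_def by (rule Least_equality) (use p shortest in auto)
  have "lex_le (labels \<phi> p) (labels \<phi> q)" if q: "shortest_path \<Phi> P u q v" for q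
  proof -
    have len: "length (labels \<phi> p) = length (labels \<phi> q)"
      using q dist by (simp add: shortest_path_def labels_simps)
    have "(q, p) \<notin> R" using q min by (auto simp: shortest_path_def)
    then have "(labels \<phi> q, labels \<phi> p) \<notin> lexord {(i, j). i < j}"
      using len by (simp add: R_def lenlex_conv lexord_lex)
    then show ?thesis using lexord_trichotomy[OF len] by (auto simp: lex_le_def)
  qed
  then show ?thesis using p sorted dist by metis
qed

section \<open>The unique increasing path\<close>

text \<open>Each step raises the length by at most \<open>1\<close>, so the path has at least \<open>N\<close> steps,
  and its labels are distinct elements of \<open>{1..N}\<close>.\<close>

lemma increasing_path_to_longest:
  assumes bij: "bij_betw \<phi> (reflections \<Phi> P) {1..N}" and w: "len P w = N"
    and p: "bruhat_path \<Phi> P id p w" "sorted_wrt (<) (labels \<phi> p)"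
  shows "labels \<phi> p = [1..<N + 1]"
proof -
  have "len P (id :: 'a \<Rightarrow> 'a) = 0" using len_le[of "[]" id] by simp
  then have "N \<le> length (labels \<phi> p)"
    using bruhat_path_length[OF p(1)] w by (simp add: labels_simps)
  moreover have sub: "set (labels \<phi> p) \<subseteq> {1..N}"
    using bruhat_path_reflections[OF p(1)] bij unfolding labels_simps bij_betw_def reflections_eq by blast
  moreover have "distinct (labels \<phi> p)" using p(2) by (simp add: strict_sorted_iff)
  ultimately have full: "set (labels \<phi> p) = {1..N}"
    by (intro card_seteq) (auto simp: distinct_card)
  have "set [1..<N + 1] = {1..N}" by auto
  with full have eq: "set (labels \<phi> p) = set [1..<N + 1]" by (rule trans[OF _ sym])
  have "sorted (labels \<phi> p)" "distinct (labels \<phi> p)"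
    using p(2) unfolding strict_sorted_iff by auto
  then show ?thesis by (rule sorted_distinct_set_unique[OF _ _ sorted_upt distinct_upt eq])
qed

lemma ordered_roots:
  assumes bij: "bij_betw \<phi> (reflections \<Phi> P) {1..N}"
  obtains xs where "set xs = P" "sorted_wrt (\<lambda>x y. \<phi> (reflection x) < \<phi> (reflection y)) xs"
    "map (\<lambda>x. \<phi> (reflection x)) xs = [1..<N + 1]"
proof -
  define f where "f \<alpha> = \<phi> (reflection \<alpha>)" for \<alpha>
  have "inj_on reflection P" by (rule inj_onI) (auto intro: reflection_inj)
  then have "bij_betw (\<phi> \<circ> reflection) P {1..N}"
    using bij unfolding reflections_eq by (rule bij_betw_trans[OF inj_on_imp_bij_betw])
  moreover have "\<phi> \<circ> reflection = f" by (simp add: f_def fun_eq_iff)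
  ultimately have "bij_betw f P {1..N}" by simp
  then have f: "\<And>i. i \<in> {1..N} \<Longrightarrow> f (inv_into P f i) = i" and im: "inv_into P f ` {1..N} = P"
    by (auto simp: bij_betw_inv_into_right bij_betw_imp_surj_on[OF bij_betw_inv_into])
  define xs where "xs = map (inv_into P f) [1..<N + 1]"
  have "map f xs = map id [1..<N + 1]"
    unfolding xs_def map_map by (rule map_cong) (auto simp: f)
  then have m: "map f xs = [1..<N + 1]" by simp
  have "sorted_wrt (<) (map f xs)" unfolding m by (rule sorted_wrt_upt)
  then have "sorted_wrt (\<lambda>x y. f x < f y) xs" by (simp add: sorted_wrt_map)
  moreover have "set xs = P"
  proof -
    have "set [1..<N + 1] = {1..N}" by auto
    then show ?thesis using im unfolding xs_def set_map by simp
  qed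
  ultimately show ?thesis using that m unfolding f_def by metis
qed

lemma increasing_paths_all:
  assumes "set xs = P"
  shows "increasing_paths \<phi> xs u v = {p. bruhat_path \<Phi> P u p v \<and> sorted_wrt (<) (labels \<phi> p)}"
  unfolding increasing_paths_def assms
proof (rule Collect_cong)
  show "(bruhat_path \<Phi> P u p v \<and> sorted_wrt (<) (labels \<phi> p) \<and> snd ` set p \<subseteq> reflection ` P) \<longleftrightarrow>
    (bruhat_path \<Phi> P u p v \<and> sorted_wrt (<) (labels \<phi> p))" for p
  proof
    assume p: "bruhat_path \<Phi> P u p v \<and> sorted_wrt (<) (labels \<phi> p)"
    have "snd ` set p \<subseteq> reflection ` P" by (rule bruhat_path_reflections[OF conjunct1[OF p]])
    with p show "bruhat_path \<Phi> P u p v \<and> sorted_wrt (<) (labels \<phi> p) \<and> snd ` set p \<subseteq> reflection ` P"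
      by iprover
  qed iprover
qed

text \<open>The number does not depend on the end points, and it is \<open>1\<close> from the identity to the longest
  element.\<close>

lemma card_all_increasing_paths:
  assumes bij: "bij_betw \<phi> (reflections \<Phi> P) {1..N}" and mono: "plane_monotone \<phi>"
    and w: "w \<in> W" "len P w = N" and u: "u \<in> W" and v: "v \<in> W"
  shows "card {p. bruhat_path \<Phi> P u p v \<and> sorted_wrt (<) (labels \<phi> p)} = 1"
proof -
  define I where "I u v = {p. bruhat_path \<Phi> P u p v \<and> sorted_wrt (<) (labels \<phi> p)}" for u v
  obtain xs where xs: "set xs = P" "sorted_wrt (\<lambda>x y. \<phi> (reflection x) < \<phi> (reflection y)) xs"
    by (rule ordered_roots[OF bij])
  obtain z where z: "chain z xs" using chain_of_ordering[OF mono xs] by blast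
  have inv: "inversions z = P" using chain_inversions[OF z] xs(1) by simp
  have I: "finite (I u v) \<and> card (I u v) = path_sum act edge xs (delta v) u" if "u \<in> W" for u v
    using card_increasing_paths[OF _ xs(2) that, of v] xs(1) increasing_paths_all[OF xs(1)] by (simp add: I_def)
  have "card (I u v) = path_sum act edge xs (delta v) u" using I u by blast
  also have "\<dots> = path_sum act edge xs (delta w) id"
    by (rule path_sum_delta_const[OF z inv u W_id v w(1)])
  also have "\<dots> = card (I id w)" using I W_id by simp
  also have "\<dots> = 1"
  proof -
    obtain p where p: "p \<in> I id w" using minimal_path[OF bij mono W_id w(1)] by (auto simp: I_def)
    have inj: "inj_on \<phi> (reflection ` P)" using bij by (simp add: bij_betw_def reflections_eq)
    have "q = p" if "q \<in> I id w" for q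
    proof -
      have q: "bruhat_path \<Phi> P id q w" "sorted_wrt (<) (labels \<phi> q)" using that unfolding I_def by blast+
      have p': "bruhat_path \<Phi> P id p w" "sorted_wrt (<) (labels \<phi> p)" using p unfolding I_def by blast+
      have "labels \<phi> q = labels \<phi> p"
        by (simp only: increasing_path_to_longest[OF bij w(2) q] increasing_path_to_longest[OF bij w(2) p'])
      then show ?thesis by (rule labels_determine_path[OF inj q(1) p'(1)])
    qed
    then have "I id w = {p}" using p by blast
    then show ?thesis by simp
  qed
  finally show ?thesis by (simp add: I_def)
qed

lemma unique_increasing_path:
  assumes bij: "bij_betw \<phi> (reflections \<Phi> P) {1..N}" and mono: "plane_monotone \<phi>"
    and w: "w \<in> W" "len P w = N" and u: "u \<in> W" and v: "v \<in> W"
  shows "\<exists>!p. bruhat_path \<Phi> P u p v \<and> sorted_wrt (<) (labels \<phi> p)"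
    and "bruhat_path \<Phi> P u p v \<Longrightarrow> sorted_wrt (<) (labels \<phi> p) \<Longrightarrow> length p = path_dist \<Phi> P u v"
    and "bruhat_path \<Phi> P u p v \<Longrightarrow> sorted_wrt (<) (labels \<phi> p) \<Longrightarrow> shortest_path \<Phi> P u q v \<Longrightarrow>
      lex_le (labels \<phi> p) (labels \<phi> q)"
proof -
  obtain p0 where p0: "{p. bruhat_path \<Phi> P u p v \<and> sorted_wrt (<) (labels \<phi> p)} = {p0}"
    using card_all_increasing_paths[OF assms] by (auto simp: card_1_singleton_iff)
  then show "\<exists>!p. bruhat_path \<Phi> P u p v \<and> sorted_wrt (<) (labels \<phi> p)" by (metis (mono_tags, lifting) mem_Collect_eq singleton_iff)
  have eq: "p = p0" if "bruhat_path \<Phi> P u p v" "sorted_wrt (<) (labels \<phi> p)" for p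
    using p0 that by blast
  obtain p1 where p1: "bruhat_path \<Phi> P u p1 v" "sorted_wrt (<) (labels \<phi> p1)" "length p1 = path_dist \<Phi> P u v"
    "\<forall>q. shortest_path \<Phi> P u q v \<longrightarrow> lex_le (labels \<phi> p1) (labels \<phi> q)"
    using minimal_path[OF bij mono u v] by blast
  have "p1 = p0" using eq p1 by blast
  then show "bruhat_path \<Phi> P u p v \<Longrightarrow> sorted_wrt (<) (labels \<phi> p) \<Longrightarrow> length p = path_dist \<Phi> P u v"
    and "bruhat_path \<Phi> P u p v \<Longrightarrow> sorted_wrt (<) (labels \<phi> p) \<Longrightarrow> shortest_path \<Phi> P u q v \<Longrightarrow>
      lex_le (labels \<phi> p) (labels \<phi> q)"
    using eq[of p] p1 by auto
qed

subsection \<open>The reversed ordering\<close>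

lemma reversed_ordering:
  assumes bij: "bij_betw \<phi> (reflections \<Phi> P) {1..N}" and mono: "plane_monotone \<phi>"
  defines "\<phi>' \<equiv> \<lambda>\<tau>. N + 1 - \<phi> \<tau>"
  shows "bij_betw \<phi>' (reflections \<Phi> P) {1..N}" "plane_monotone \<phi>'"
proof -
  have "bij_betw (\<lambda>i. N + 1 - i) {1..N} {1..N}"
    by (rule bij_betw_byWitness[where f' = "\<lambda>i. N + 1 - i"]) auto
  from bij_betw_trans[OF bij this] show "bij_betw \<phi>' (reflections \<Phi> P) {1..N}"
    by (simp add: \<phi>'_def o_def)
  have range: "1 \<le> \<phi> (reflection \<alpha>) \<and> \<phi> (reflection \<alpha>) \<le> N" if "\<alpha> \<in> P" for \<alpha>
    using bij that unfolding bij_betw_def reflections_eq by auto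
  show "plane_monotone \<phi>'"
  proof (rule plane_monotoneI)
    fix \<alpha> \<beta> assume ab: "\<alpha> \<in> P" "\<beta> \<in> P" "\<alpha> \<noteq> \<beta>"
    then obtain T g where D: "dihedral T g" and im: "P \<inter> span {\<alpha>, \<beta>} = g ` {0..<int (length T)}"
      and mo: "\<And>i j. 0 \<le> i \<Longrightarrow> i < j \<Longrightarrow> j < int (length T) \<Longrightarrow> \<phi> (reflection (g i)) < \<phi> (reflection (g j))"
      using mono unfolding plane_monotone_def ascending_def by meson
    have "\<phi>' (reflection (g j)) < \<phi>' (reflection (g i))" if "0 \<le> i" "i < j" "j < int (length T)" for i j
      using mo[OF that] range[of "g i"] range[of "g j"] dihedralD(2)[OF D, of i] dihedralD(2)[OF D, of j] that
      unfolding \<phi>'_def by linarith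
    then have "ascending \<phi>' (int (length T)) (\<lambda>i. g (int (length T) - 1 - i))"
      by (simp add: ascending_def)
    then show "\<exists>T g. dihedral T g \<and> P \<inter> span {\<alpha>, \<beta>} = g ` {0..<int (length T)} \<and>
       (ascending \<phi>' (int (length T)) g \<or> ascending \<phi>' (int (length T)) (\<lambda>i. g (int (length T) - 1 - i)))"
      using D im by blast
  qed
qed

lemma reversed_labels:
  assumes bij: "bij_betw \<phi> (reflections \<Phi> P) {1..N}" and p: "bruhat_path \<Phi> P u p v"
  defines "\<phi>' \<equiv> \<lambda>\<tau>. N + 1 - \<phi> \<tau>"
  shows "set (labels \<phi> p) \<subseteq> {1..N}" "labels \<phi>' p = map (\<lambda>i. N + 1 - i) (labels \<phi> p)"
    "sorted_wrt (<) (labels \<phi>' p) \<longleftrightarrow> sorted_wrt (>) (labels \<phi> p)"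
proof -
  show sub: "set (labels \<phi> p) \<subseteq> {1..N}"
    using bruhat_path_reflections[OF p] bij unfolding labels_simps bij_betw_def reflections_eq by blast
  show eq: "labels \<phi>' p = map (\<lambda>i. N + 1 - i) (labels \<phi> p)"
    by (simp add: labels_def \<phi>'_def case_prod_unfold)
  show "sorted_wrt (<) (labels \<phi>' p) \<longleftrightarrow> sorted_wrt (>) (labels \<phi> p)"
    unfolding eq sorted_wrt_map
  proof
    show "sorted_wrt (\<lambda>x y. N + 1 - x < N + 1 - y) (labels \<phi> p) \<Longrightarrow> sorted_wrt (>) (labels \<phi> p)"
      by (erule sorted_wrt_mono_rel[rotated]) auto
    show "sorted_wrt (>) (labels \<phi> p) \<Longrightarrow> sorted_wrt (\<lambda>x y. N + 1 - x < N + 1 - y) (labels \<phi> p)"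
      by (erule sorted_wrt_mono_rel[rotated]) (use sub in \<open>auto simp: subset_iff Suc_diff_le\<close>)
  qed
qed

end

section \<open>The product of the operators\<close>

lemma lookup_scale: "Poly_Mapping.lookup (scale c x) k = c * Poly_Mapping.lookup x k"
  by (simp add: scale_def Poly_Mapping.map.rep_eq when_def)

lemma scale_add: "scale (c + d) x = scale c x + scale d x"
  by (rule poly_mapping_eqI) (simp add: lookup_scale lookup_add algebra_simps)

lemma scale_add_right: "scale c (x + y) = scale c x + scale c y"
  by (rule poly_mapping_eqI) (simp add: lookup_scale lookup_add algebra_simps)

lemma scale_zero: "scale 0 x = 0" "scale c 0 = 0"
  by (rule poly_mapping_eqI, simp add: lookup_scale)+

lemma scale_single: "scale c (Poly_Mapping.single w d) = Poly_Mapping.single w (c * d)"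
  by (rule poly_mapping_eqI) (simp add: lookup_scale lookup_single when_def)

lemma linear_extension_superset:
  assumes "finite S" "Poly_Mapping.keys x \<subseteq> S"
  shows "linear_extension f x = (\<Sum>w\<in>S. scale (Poly_Mapping.lookup x w) (f w))"
  unfolding linear_extension_def using assms
  by (intro sum.mono_neutral_left) (auto simp: in_keys_iff scale_zero)

lemma linear_extension_add: "linear_extension f (x + y) = linear_extension f x + linear_extension f y"
proof -
  define S where "S = Poly_Mapping.keys x \<union> Poly_Mapping.keys y"
  have S: "finite S" "Poly_Mapping.keys x \<subseteq> S" "Poly_Mapping.keys y \<subseteq> S" "Poly_Mapping.keys (x + y) \<subseteq> S"
    using Poly_Mapping.keys_add[of x y] by (auto simp: S_def)
  show ?thesis
    by (simp add: linear_extension_superset[OF S(1) S(2)] linear_extension_superset[OF S(1) S(3)]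
        linear_extension_superset[OF S(1) S(4)] lookup_add scale_add sum.distrib)
qed

lemma linear_extension_single: "linear_extension f (Poly_Mapping.single w c) = scale c (f w)"
  by (subst linear_extension_superset[of "{w}"]) auto

lemma R_op_add: "R_op P \<tau> (x + y) = R_op P \<tau> x + R_op P \<tau> y"
  by (simp add: R_op_def Q_op_def linear_extension_add scale_add_right)

lemma R_op_single: "R_op P \<tau> (Poly_Mapping.single w c) =
    Poly_Mapping.single w c + (if bruhat_step P w \<tau> then Poly_Mapping.single (\<tau> \<circ> w) (eps * c) else 0)"
  by (simp add: R_op_def Q_op_def linear_extension_single scale_single scale_zero)

lemma foldr_comp_apply: "foldr (\<lambda>x f. h x \<circ> f) xs k y = foldr (\<lambda>x f. h x \<circ> f) xs id (k y)"
  by (induction xs) auto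

lemma foldr_R_op_add: "foldr (\<lambda>x f. R_op P (r x) \<circ> f) xs id (y + z)
    = foldr (\<lambda>x f. R_op P (r x) \<circ> f) xs id y + foldr (\<lambda>x f. R_op P (r x) \<circ> f) xs id z"
  by (induction xs) (auto simp: R_op_add)

context positive_roots
begin

text \<open>The right-hand side of the formula is a sum over the group, which would be \<open>0\<close> by convention if
  the group were infinite.\<close>

lemma finite_W: "finite W"
proof (rule finite_imageD)
  show "finite (inversions ` W)"
    by (rule finite_subset[of _ "Pow P"]) (auto simp: inversions_def finite_P)
  show "inj_on inversions W" by (rule inj_onI) (rule inversions_inj)
qed

text \<open>The operator that acts first is the last one of the product. It contributes the first step of a path, so the
  product over the reversed list collects the increasing paths.\<close>

lemma product_of_operators:
  fixes c :: "'k::field_char_0 poly"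
  assumes "set xs \<subseteq> P" "sorted_wrt (\<lambda>x y. \<phi> (reflection x) < \<phi> (reflection y)) xs" "u \<in> W"
  shows "foldr (\<lambda>x f. R_op P (reflection x) \<circ> f) (rev xs) id (Poly_Mapping.single u c) =
    (\<Sum>v\<in>W. Poly_Mapping.single v (\<Sum>p\<in>increasing_paths \<phi> xs u v. c * eps ^ length p))"
  using assms
proof (induction xs arbitrary: u c)
  case Nil
  have "(\<Sum>v\<in>W. Poly_Mapping.single v (\<Sum>p\<in>increasing_paths \<phi> [] u v. c * eps ^ length p))
    = (\<Sum>v\<in>W. if v = u then Poly_Mapping.single u c else 0)"
    by (intro sum.cong) (auto simp: increasing_paths_Nil[OF Nil(3)])
  also have "\<dots> = Poly_Mapping.single u c" using Nil(3) finite_W by simp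
  finally show ?case by simp
next
  case (Cons x xs)
  let ?F = "\<lambda>xs. foldr (\<lambda>x f. R_op P (reflection x) \<circ> f) xs (id :: (('a \<Rightarrow> 'a) \<Rightarrow>\<^sub>0 'k poly) \<Rightarrow> _)"
  let ?S = "\<lambda>xs u v (c :: 'k poly). \<Sum>p\<in>increasing_paths \<phi> xs u v. c * eps ^ length p"
  have x: "x \<in> \<Phi>" using Cons.prems P_root by auto
  have IH: "?F (rev xs) (Poly_Mapping.single w d) = (\<Sum>v\<in>W. Poly_Mapping.single v (?S xs w v d))"
    if "w \<in> W" for w d by (rule Cons.IH[OF _ _ that]) (use Cons.prems in auto)
  have aW: "act u x \<in> W" by (rule W_act[OF x Cons.prems(3)])
  have fin: "finite (increasing_paths \<phi> xs w v)" if "w \<in> W" for w v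
    using card_increasing_paths[OF _ _ that] Cons.prems by simp
  have sum: "?S (x # xs) u v c = ?S xs u v c + (if edge u x then ?S xs (act u x) v (eps * c) else 0)" for v
  proof (cases "edge u x")
    case True
    have "?S (x # xs) u v c = ?S xs u v c
        + (\<Sum>p\<in>(#) (u, reflection x) ` increasing_paths \<phi> xs (act u x) v. c * eps ^ length p)"
      using increasing_paths_Cons[OF Cons.prems, of v] fin[OF Cons.prems(3)] fin[OF aW] True
      by (simp add: sum.union_disjoint)
    also have "(\<Sum>p\<in>(#) (u, reflection x) ` increasing_paths \<phi> xs (act u x) v. c * eps ^ length p)
      = ?S xs (act u x) v (eps * c)"
      by (subst sum.reindex) (simp_all add: algebra_simps)
    finally show ?thesis using True by simp
  qed (use increasing_paths_Cons[OF Cons.prems, of v] in simp)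
  have "?F (rev (x # xs)) (Poly_Mapping.single u c) = ?F (rev xs) (R_op P (reflection x) (Poly_Mapping.single u c))"
    using foldr_comp_apply[of "\<lambda>x. R_op P (reflection x)" "rev xs" "R_op P (reflection x)" "Poly_Mapping.single u c"]
    by simp
  also have "\<dots> = ?F (rev xs) (Poly_Mapping.single u c)
      + (if edge u x then ?F (rev xs) (Poly_Mapping.single (act u x) (eps * c)) else 0)"
    unfolding R_op_single act_def by (cases "bruhat_step P u (reflection x)") (simp_all add: foldr_R_op_add)
  also have "\<dots> = (\<Sum>v\<in>W. Poly_Mapping.single v (?S xs u v c))
      + (if edge u x then \<Sum>v\<in>W. Poly_Mapping.single v (?S xs (act u x) v (eps * c)) else 0)"
    unfolding IH[OF Cons.prems(3)] IH[OF aW] ..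
  also have "\<dots> = (\<Sum>v\<in>W. Poly_Mapping.single v (?S (x # xs) u v c))"
    unfolding sum by (simp add: single_add sum.distrib)
  finally show ?case .
qed

lemma operator_formula:
  assumes bij: "bij_betw \<phi> (reflections \<Phi> P) {1..N}" and mono: "plane_monotone \<phi>"
    and w: "w \<in> W" "len P w = N" and u: "u \<in> W"
  shows "foldr (\<lambda>i f. R_op P (inv_into (reflections \<Phi> P) \<phi> i) \<circ> f) [1..<N + 1] id (Poly_Mapping.single u 1) =
        (\<Sum>v\<in>W. Poly_Mapping.single v (eps ^ path_dist \<Phi> P u v :: 'k::field_char_0 poly))"
proof -
  define \<phi>' where "\<phi>' \<tau> = N + 1 - \<phi> \<tau>" for \<tau>
  have bij': "bij_betw \<phi>' (reflections \<Phi> P) {1..N}" and mono': "plane_monotone \<phi>'"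
    unfolding \<phi>'_def using reversed_ordering[OF bij mono] by simp_all
  obtain xs where xs: "set xs = P" "sorted_wrt (\<lambda>x y. \<phi> (reflection x) < \<phi> (reflection y)) xs"
    "map (\<lambda>x. \<phi> (reflection x)) xs = [1..<N + 1]"
    by (rule ordered_roots[OF bij])
  have range: "\<phi> (reflection \<alpha>) \<le> N" if "\<alpha> \<in> P" for \<alpha>
    using bij that unfolding bij_betw_def reflections_eq by auto
  have sorted': "sorted_wrt (\<lambda>x y. \<phi>' (reflection x) < \<phi>' (reflection y)) (rev xs)"
    unfolding sorted_wrt_rev
  proof (rule sorted_wrt_mono_rel[OF _ xs(2)])
    fix x y assume "x \<in> set xs" "y \<in> set xs" "\<phi> (reflection x) < \<phi> (reflection y)"
    then show "\<phi>' (reflection y) < \<phi>' (reflection x)"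
      using range[of x] range[of y] xs(1) unfolding \<phi>'_def by auto
  qed
  have inv: "inv_into (reflections \<Phi> P) \<phi> (\<phi> (reflection x)) = reflection x" if "x \<in> set xs" for x
    using bij that xs(1) by (intro inv_into_f_f) (auto simp: bij_betw_def reflections_eq)
  have "foldr (\<lambda>i f. R_op P (inv_into (reflections \<Phi> P) \<phi> i) \<circ> f) [1..<N + 1] id (Poly_Mapping.single u (1 :: 'k poly))
    = foldr (\<lambda>x f. R_op P (inv_into (reflections \<Phi> P) \<phi> (\<phi> (reflection x))) \<circ> f) xs id (Poly_Mapping.single u (1 :: 'k poly))"
    unfolding xs(3)[symmetric] foldr_map o_def ..
  also have "\<dots> = foldr (\<lambda>x f. R_op P (reflection x) \<circ> f) xs id (Poly_Mapping.single u (1 :: 'k poly))"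
    using inv by (simp cong: foldr_cong)
  also have "\<dots> = (\<Sum>v\<in>W. Poly_Mapping.single v (\<Sum>p\<in>increasing_paths \<phi>' (rev xs) u v. 1 * eps ^ length p))"
  proof -
    have "set (rev xs) \<subseteq> P" using xs(1) by simp
    from product_of_operators[OF this sorted' u, of "1 :: 'k poly"] show ?thesis unfolding rev_rev_ident .
  qed
  also have "\<dots> = (\<Sum>v\<in>W. Poly_Mapping.single v (eps ^ path_dist \<Phi> P u v))"
  proof (rule sum.cong[OF refl])
    fix v assume v: "v \<in> W"
    note unique = unique_increasing_path[OF bij' mono' w u v]
    obtain p where p: "bruhat_path \<Phi> P u p v" "sorted_wrt (<) (labels \<phi>' p)" using unique(1) by blast
    have "increasing_paths \<phi>' (rev xs) u v = {p}"
      unfolding increasing_paths_all[of "rev xs", simplified, OF xs(1)] using unique(1) p by blast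
    then show "Poly_Mapping.single v (\<Sum>p\<in>increasing_paths \<phi>' (rev xs) u v. 1 * eps ^ length p)
        = Poly_Mapping.single v (eps ^ path_dist \<Phi> P u v :: 'k poly)"
      using unique(2)[OF p] by simp
  qed
  finally show ?thesis .
qed

end

theorem theorem6p6:
  fixes \<Phi> P :: "'a::euclidean_space set"
    and w\<^sub>o :: "'a \<Rightarrow> 'a"
    and N :: nat
    and \<phi> :: "('a \<Rightarrow> 'a) \<Rightarrow> nat"
  assumes "root_system \<Phi>"
    and "positive_system \<Phi> P"
    and "longest_element \<Phi> P w\<^sub>o"
    and "N = len P w\<^sub>o"
    and "reflection_ordering \<Phi> P N \<phi>"
  shows
    "(\<forall>u\<in>weyl_group \<Phi>. \<forall>v\<in>weyl_group \<Phi>.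
        (\<exists>!p. bruhat_path \<Phi> P u p v \<and> sorted_wrt (<) (labels \<phi> p)) \<and>
        (\<exists>!p. bruhat_path \<Phi> P u p v \<and> sorted_wrt (>) (labels \<phi> p)))
     \<and>
     (\<forall>u\<in>weyl_group \<Phi>. \<forall>v\<in>weyl_group \<Phi>. \<forall>p. bruhat_path \<Phi> P u p v \<longrightarrow>
        (sorted_wrt (<) (labels \<phi> p) \<longrightarrow>
           length p = path_dist \<Phi> P u v \<and>
           (\<forall>q. shortest_path \<Phi> P u q v \<longrightarrow> lex_le (labels \<phi> p) (labels \<phi> q))) \<and>
        (sorted_wrt (>) (labels \<phi> p) \<longrightarrow>
           length p = path_dist \<Phi> P u v \<and>
           (\<forall>q. shortest_path \<Phi> P u q v \<longrightarrow> lex_le (labels \<phi> q) (labels \<phi> p))))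
     \<and>
     (\<forall>u\<in>weyl_group \<Phi>.
        foldr (\<lambda>i f. R_op P (inv_into (reflections \<Phi> P) \<phi> i) \<circ> f) [1..<N + 1] id
          (Poly_Mapping.single u 1 :: ('a \<Rightarrow> 'a) \<Rightarrow>\<^sub>0 'k::field_char_0 poly) =
        (\<Sum>v\<in>weyl_group \<Phi>. Poly_Mapping.single v (eps ^ path_dist \<Phi> P u v)))"
proof -
  interpret positive_roots \<Phi> P by (rule positive_roots.intro[OF assms(1,2)])
  have w: "w\<^sub>o \<in> W" "len P w\<^sub>o = N" using assms(3,4) by (auto simp: longest_element_def)
  have bij: "bij_betw \<phi> (reflections \<Phi> P) {1..N}" using assms(5) unfolding reflection_ordering_def by blast
  have mono: "plane_monotone \<phi>" by (rule reflection_ordering_plane_monotone[OF assms(5)])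
  define \<phi>' where "\<phi>' \<tau> = N + 1 - \<phi> \<tau>" for \<tau>
  have bij': "bij_betw \<phi>' (reflections \<Phi> P) {1..N}" and mono': "plane_monotone \<phi>'"
    unfolding \<phi>'_def using reversed_ordering[OF bij mono] by simp_all
  note inc = unique_increasing_path[OF bij mono w]
  note dec = unique_increasing_path[OF bij' mono' w]
  have flip: "sorted_wrt (<) (labels \<phi>' p) \<longleftrightarrow> sorted_wrt (>) (labels \<phi> p)" if "bruhat_path \<Phi> P u p v" for u p v
    unfolding \<phi>'_def using reversed_labels(3)[OF bij that] .
  have flip_lex: "lex_le (labels \<phi> q) (labels \<phi> p)"
    if p: "bruhat_path \<Phi> P u p v" and q: "bruhat_path \<Phi> P u q v" and len: "length p = length q"
      and le: "lex_le (labels \<phi>' p) (labels \<phi>' q)" for u v p q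
  proof -
    have inj: "inj_on \<phi>' (reflection ` P)" using bij' by (simp add: bij_betw_def reflections_eq)
    show ?thesis
    proof (cases "labels \<phi>' p = labels \<phi>' q")
      case True
      then have "p = q" by (rule labels_determine_path[OF inj p q])
      then show ?thesis by (simp add: lex_le_def)
    next
      case False
      then have "(labels \<phi>' p, labels \<phi>' q) \<in> lexord {(i, j). i < j}" using le by (simp add: lex_le_def)
      then have "(labels \<phi> q, labels \<phi> p) \<in> lexord {(i, j). i < j}"
        using reversed_labels[OF bij p] reversed_labels[OF bij q] len unfolding \<phi>'_def
        by (intro lexord_flip[of "labels \<phi> p" "labels \<phi> q" N]) (simp_all add: labels_simps)
      then show ?thesis by (simp add: lex_le_def)
    qed
  qed
  have dec1: "\<exists>!p. bruhat_path \<Phi> P u p v \<and> sorted_wrt (>) (labels \<phi> p)" if "u \<in> W" "v \<in> W" for u v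
    using dec(1)[OF that] flip by metis
  have dec2: "length p = path_dist \<Phi> P u v \<and> (\<forall>q. shortest_path \<Phi> P u q v \<longrightarrow> lex_le (labels \<phi> q) (labels \<phi> p))"
    if "u \<in> W" "v \<in> W" "bruhat_path \<Phi> P u p v" "sorted_wrt (>) (labels \<phi> p)" for u v p
  proof -
    have s: "sorted_wrt (<) (labels \<phi>' p)" using flip that by blast
    have len: "length p = path_dist \<Phi> P u v" by (rule dec(2)[OF that(1,2,3) s])
    have "lex_le (labels \<phi> q) (labels \<phi> p)" if q: "shortest_path \<Phi> P u q v" for q
      using flip_lex[OF \<open>bruhat_path \<Phi> P u p v\<close>, of q] dec(3)[OF \<open>u \<in> W\<close> \<open>v \<in> W\<close> \<open>bruhat_path \<Phi> P u p v\<close> s q]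
        q len by (simp add: shortest_path_def)
    then show ?thesis using len by blast
  qed
  show ?thesis
  proof (intro conjI ballI allI impI)
    fix u v assume uv: "u \<in> W" "v \<in> W"
    show "\<exists>!p. bruhat_path \<Phi> P u p v \<and> sorted_wrt (<) (labels \<phi> p)" by (rule inc(1)[OF uv])
    show "\<exists>!p. bruhat_path \<Phi> P u p v \<and> sorted_wrt (>) (labels \<phi> p)" by (rule dec1[OF uv])
    fix p assume p: "bruhat_path \<Phi> P u p v"
    show "length p = path_dist \<Phi> P u v" if "sorted_wrt (<) (labels \<phi> p)" by (rule inc(2)[OF uv p that])
    show "lex_le (labels \<phi> p) (labels \<phi> q)" if "sorted_wrt (<) (labels \<phi> p)" "shortest_path \<Phi> P u q v" for q
      by (rule inc(3)[OF uv p that])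
    show "length p = path_dist \<Phi> P u v" if "sorted_wrt (>) (labels \<phi> p)"
      by (rule conjunct1[OF dec2[OF uv p that]])
    show "lex_le (labels \<phi> q) (labels \<phi> p)" if "sorted_wrt (>) (labels \<phi> p)" "shortest_path \<Phi> P u q v" for q
      using dec2[OF uv p that(1)] that(2) by blast
  next
    fix u assume "u \<in> W"
    then show "foldr (\<lambda>i f. R_op P (inv_into (reflections \<Phi> P) \<phi> i) \<circ> f) [1..<N + 1] id
          (Poly_Mapping.single u 1 :: ('a \<Rightarrow> 'a) \<Rightarrow>\<^sub>0 'k poly) =
        (\<Sum>v\<in>W. Poly_Mapping.single v (eps ^ path_dist \<Phi> P u v))"
      by (rule operator_formula[OF bij mono w])
  qed
qed

end
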